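(* Let $M$ be a compact smooth $n$-manifold and $\pi:E\to M$ a smooth vector bundle of rank $r$ equipped with a fiber metric $\langle\cdot,\cdot\rangle_E$. Suppose $s\in\mathbb{R}$ and $p\in(1,\infty)$ are such that $sp>n$. Then $W^{s,p}(M,E)\hookrightarrow L^\infty(M,E)$ (continuous inclusion). Moreover, every element $u$ of $W^{s,p}(M,E)$ has a continuous version, i.e. agrees almost everywhere with a continuous section of $E$.
   Context: Manifolds are smooth, Hausdorff and second countable; $E_U=\pi^{-1}(U)$. A fiber metric assigns smoothly to each $x\in M$ an inner product on $E_x$; $|\cdot|_E$ is the associated norm. $L^\infty(M,E)$ is the space of (a.e.-classes of) measurable sections $u$ with $\|u\|_{L^\infty(M,E)}=\mathrm{ess\,sup}\,|u|_E<\infty$. Sobolev spaces. A total trivialization triple $(U,\varphi,\rho)$ for $E$ consists of a smooth chart $(U,\varphi)$ of $M$ and a smooth map $\rho=(\rho^1,\dots,\rho^r):E_U\to\mathbb{R}^r$ that is a linear isomorphism on each fibre and such that $(\pi,\rho):E_U\to U\times\mathbb{R}^r$ is a diffeomorphism. An augmented total trivialization atlas is a finite collection $\Lambda=\{(U_\alpha,\varphi_\alpha,\rho_\alpha,\psi_\alpha)\}_{1\le\alpha\le N}$ of such triples, whose charts form a smooth atlas, together with a smooth nonnegative partition of unity with $\mathrm{supp}\,\psi_\alpha\subseteq U_\alpha$. For nonempty open $\Omega\subseteq\mathbb{R}^n$ and $k\in\mathbb{N}_0$, $\|u\|_{W^{k,p}(\Omega)}=\sum_{|\nu|\le k}\|\partial^\nu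 u\|_{L^p(\Omega)}$, and for $s=k+\theta$, $\theta\in(0,1)$, $\|u\|_{W^{s,p}(\Omega)}=\|u\|_{W^{k,p}(\Omega)}+\sum_{|\nu|=k}\big(\iint_{\Omega\times\Omega}\frac{|\partial^\nu u(x)-\partial^\nu u(y)|^p}{|x-y|^{n+\theta p}}dx\,dy\big)^{1/p}$. Since $sp>n$ forces $s>0$, $W^{s,p}(M,E)$ consists of the sections $u\in L^p(M,E)$ with $\|u\|_{W^{s,p}(M,E)}=\sum_{\alpha=1}^N\sum_{l=1}^r\|\rho_\alpha^l\circ(\psi_\alpha u)\circ\varphi_\alpha^{-1}\|_{W^{s,p}(\varphi_\alpha(U_\alpha))}<\infty$; different choices of $\Lambda$ give the same space with equivalent norms, so $\Lambda$ is suppressed. *)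

theory Defs
  imports "HOL-Analysis.Analysis"
begin

section \<open>Smooth functions on open subsets of Euclidean spaces\<close>

fun Ck_on :: "nat \<Rightarrow> 'a set \<Rightarrow> ('a::euclidean_space \<Rightarrow> 'b::euclidean_space) \<Rightarrow> bool" where
  "Ck_on 0 S f \<longleftrightarrow> continuous_on S f"
| "Ck_on (Suc k) S f \<longleftrightarrow>
     (\<forall>x\<in>S. f differentiable (at x)) \<and> (\<forall>v. Ck_on k S (\<lambda>x. frechet_derivative f (at x) v))"

text \<open>Only meaningful for open \<open>S\<close>: the derivatives are taken with respect to the whole space.\<close>

definition smooth_on :: "'a set \<Rightarrow> ('a::euclidean_space \<Rightarrow> 'b::euclidean_space) \<Rightarrow> bool" where
  "smooth_on S f \<longleftrightarrow> (\<forall>k. Ck_on k S f)"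


section \<open>Smooth manifolds\<close>

text \<open>The carrier of a manifold is the \<open>topspace\<close> of its topology. \<open>Atlas\<close> is some smooth
  atlas, not necessarily a maximal one; \<open>smooth_chart\<close> below describes the members of the
  maximal atlas it determines. The map of a chart is relevant only on the domain of the chart.\<close>

type_synonym ('m, 'a) chart = "'m set \<times> ('m \<Rightarrow> 'a)"

record ('m, 'a) manifold =
  Top :: "'m topology"
  Atlas :: "('m, 'a) chart set"

abbreviation carrier_of :: "('m, 'a) manifold \<Rightarrow> 'm set" where
  "carrier_of M \<equiv> topspace (Top M)"

definition topological_chart :: "'m topology \<Rightarrow> ('m, 'a::euclidean_space) chart \<Rightarrow> bool" where
  "topological_chart X = (\<lambda>(U, \<phi>). openin X U \<and> open (\<phi> ` U) \<and>
     homeomorphic_map (subtopology X U) (top_of_set (\<phi> ` U)) \<phi>)"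

definition smooth_transition ::
  "('m, 'a::euclidean_space) chart \<Rightarrow> ('m, 'a) chart \<Rightarrow> bool" where
  "smooth_transition = (\<lambda>(U, \<phi>) (V, \<psi>). smooth_on (\<phi> ` (U \<inter> V)) (\<psi> \<circ> inv_into U \<phi>))"

definition smooth_chart :: "('m, 'a::euclidean_space) manifold \<Rightarrow> ('m, 'a) chart \<Rightarrow> bool" where
  "smooth_chart M c \<longleftrightarrow> topological_chart (Top M) c \<and>
     (\<forall>d\<in>Atlas M. smooth_transition c d \<and> smooth_transition d c)"

definition smooth_manifold :: "('m, 'a::euclidean_space) manifold \<Rightarrow> bool" where
  "smooth_manifold M \<longleftrightarrow> Hausdorff_space (Top M) \<and> second_countable (Top M) \<and>
     (\<forall>c\<in>Atlas M. smooth_chart M c) \<and> \<Union> (fst ` Atlas M) = carrier_of M"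

definition smooth_map ::
  "('m, 'a::euclidean_space) manifold \<Rightarrow> ('k, 'b::euclidean_space) manifold \<Rightarrow> ('m \<Rightarrow> 'k) \<Rightarrow> bool"
  where
  "smooth_map M N f \<longleftrightarrow> (\<forall>x\<in>carrier_of M. \<exists>U \<phi> V \<psi>.
     smooth_chart M (U, \<phi>) \<and> smooth_chart N (V, \<psi>) \<and> x \<in> U \<and> f ` U \<subseteq> V \<and>
     smooth_on (\<phi> ` U) (\<psi> \<circ> f \<circ> inv_into U \<phi>))"

definition diffeomorphism ::
  "('m, 'a::euclidean_space) manifold \<Rightarrow> ('k, 'b::euclidean_space) manifold \<Rightarrow> ('m \<Rightarrow> 'k) \<Rightarrow> bool"
  where
  "diffeomorphism M N f \<longleftrightarrow> smooth_map M N f \<and>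
     (\<exists>h. smooth_map N M h \<and>
          (\<forall>x\<in>carrier_of M. h (f x) = x) \<and> (\<forall>y\<in>carrier_of N. f (h y) = y))"

definition euclidean_manifold :: "('a::euclidean_space, 'a) manifold" where
  "euclidean_manifold = \<lparr>Top = euclidean, Atlas = {(UNIV, id)}\<rparr>"

definition open_submanifold :: "('m, 'a) manifold \<Rightarrow> 'm set \<Rightarrow> ('m, 'a) manifold" where
  "open_submanifold M S =
     \<lparr>Top = subtopology (Top M) S, Atlas = (\<lambda>(U, \<phi>). (U \<inter> S, \<phi>)) ` Atlas M\<rparr>"

definition prod_manifold ::
  "('m, 'a) manifold \<Rightarrow> ('k, 'b) manifold \<Rightarrow> ('m \<times> 'k, 'a \<times> 'b) manifold" where
  "prod_manifold M N =
     \<lparr>Top = prod_topology (Top M) (Top N),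
      Atlas = {(U \<times> V, map_prod \<phi> \<psi>) | U \<phi> V \<psi>. (U, \<phi>) \<in> Atlas M \<and> (V, \<psi>) \<in> Atlas N}\<rparr>"


section \<open>Smooth vector bundles and fiber metrics\<close>

definition real_vector_space_on ::
  "'e set \<Rightarrow> ('e \<Rightarrow> 'e \<Rightarrow> 'e) \<Rightarrow> (real \<Rightarrow> 'e \<Rightarrow> 'e) \<Rightarrow> bool" where
  "real_vector_space_on V add scl \<longleftrightarrow>
     (\<forall>v\<in>V. \<forall>w\<in>V. add v w \<in> V \<and> add v w = add w v) \<and>
     (\<forall>u\<in>V. \<forall>v\<in>V. \<forall>w\<in>V. add (add u v) w = add u (add v w)) \<and>
     (\<exists>z\<in>V. (\<forall>v\<in>V. add z v = v) \<and> (\<forall>v\<in>V. \<exists>w\<in>V. add v w = z)) \<and>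
     (\<forall>a. \<forall>v\<in>V. scl a v \<in> V) \<and>
     (\<forall>a. \<forall>v\<in>V. \<forall>w\<in>V. scl a (add v w) = add (scl a v) (scl a w)) \<and>
     (\<forall>a b. \<forall>v\<in>V. scl (a + b) v = add (scl a v) (scl b v)) \<and>
     (\<forall>a b. \<forall>v\<in>V. scl (a * b) v = scl a (scl b v)) \<and>
     (\<forall>v\<in>V. scl 1 v = v)"

text \<open>The operations are those of all fibres at once: \<open>fadd E v w\<close> is relevant only if \<open>v\<close> and
  \<open>w\<close> lie in the same fibre.\<close>

record ('e, 'm, 'c) vector_bundle =
  total :: "('e, 'c) manifold"
  bproj :: "'e \<Rightarrow> 'm"
  fadd :: "'e \<Rightarrow> 'e \<Rightarrow> 'e"
  fscale :: "real \<Rightarrow> 'e \<Rightarrow> 'e"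

definition fibre :: "('e, 'm, 'c) vector_bundle \<Rightarrow> 'm \<Rightarrow> 'e set" where
  "fibre E x = {v \<in> carrier_of (total E). bproj E v = x}"

text \<open>\<open>restrict_total E U\<close> is the open submanifold \<open>E\<^sub>U\<close> of the total space.\<close>

definition restrict_total :: "('e, 'm, 'c) vector_bundle \<Rightarrow> 'm set \<Rightarrow> ('e, 'c) manifold" where
  "restrict_total E U =
     open_submanifold (total E) {v \<in> carrier_of (total E). bproj E v \<in> U}"

definition fibre_iso ::
  "('e, 'm, 'c) vector_bundle \<Rightarrow> 'm \<Rightarrow> ('e \<Rightarrow> 'f::euclidean_space) \<Rightarrow> bool" where
  "fibre_iso E x \<rho> \<longleftrightarrow> bij_betw \<rho> (fibre E x) UNIV \<and>
     (\<forall>v\<in>fibre E x. \<forall>w\<in>fibre E x. \<rho> (fadd E v w) = \<rho> v + \<rho> w) \<and>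
     (\<forall>a. \<forall>v\<in>fibre E x. \<rho> (fscale E a v) = a *\<^sub>R \<rho> v)"

definition trivialization ::
  "('m, real ^ 'n) manifold \<Rightarrow> ('e, 'm, (real ^ 'n) \<times> (real ^ 'r)) vector_bundle \<Rightarrow>
   'm set \<Rightarrow> ('e \<Rightarrow> real ^ 'r) \<Rightarrow> bool" where
  "trivialization M E U \<rho> \<longleftrightarrow> openin (Top M) U \<and>
     smooth_map (restrict_total E U) euclidean_manifold \<rho> \<and>
     (\<forall>x\<in>U. fibre_iso E x \<rho>) \<and>
     diffeomorphism (restrict_total E U) (prod_manifold (open_submanifold M U) euclidean_manifold)
       (\<lambda>v. (bproj E v, \<rho> v))"

definition smooth_vector_bundle ::
  "('m, real ^ 'n) manifold \<Rightarrow> ('e, 'm, (real ^ 'n) \<times> (real ^ 'r)) vector_bundle \<Rightarrow> bool" where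
  "smooth_vector_bundle M E \<longleftrightarrow> smooth_manifold M \<and> smooth_manifold (total E) \<and>
     smooth_map (total E) M (bproj E) \<and> bproj E ` carrier_of (total E) = carrier_of M \<and>
     (\<forall>x\<in>carrier_of M. real_vector_space_on (fibre E x) (fadd E) (fscale E)) \<and>
     (\<forall>x\<in>carrier_of M. \<exists>U \<rho>. x \<in> U \<and> trivialization M E U \<rho>)"

definition section_over :: "('e, 'm, 'c) vector_bundle \<Rightarrow> 'm set \<Rightarrow> ('m \<Rightarrow> 'e) \<Rightarrow> bool" where
  "section_over E U u \<longleftrightarrow> (\<forall>x\<in>U. u x \<in> fibre E x)"

definition smooth_section ::
  "('m, real ^ 'n) manifold \<Rightarrow> ('e, 'm, (real ^ 'n) \<times> (real ^ 'r)) vector_bundle \<Rightarrow>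
   'm set \<Rightarrow> ('m \<Rightarrow> 'e) \<Rightarrow> bool" where
  "smooth_section M E U u \<longleftrightarrow>
     section_over E U u \<and> smooth_map (open_submanifold M U) (total E) u"

definition continuous_section ::
  "('m, real ^ 'n) manifold \<Rightarrow> ('e, 'm, (real ^ 'n) \<times> (real ^ 'r)) vector_bundle \<Rightarrow>
   ('m \<Rightarrow> 'e) \<Rightarrow> bool" where
  "continuous_section M E u \<longleftrightarrow>
     section_over E (carrier_of M) u \<and> continuous_map (Top M) (Top (total E)) u"

text \<open>Smooth dependence on the base point means that smooth local sections have smooth inner
  products.\<close>

definition fiber_metric ::
  "('m, real ^ 'n) manifold \<Rightarrow> ('e, 'm, (real ^ 'n) \<times> (real ^ 'r)) vector_bundle \<Rightarrow>
   ('e \<Rightarrow> 'e \<Rightarrow> real) \<Rightarrow> bool" where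
  "fiber_metric M E g \<longleftrightarrow>
     (\<forall>x\<in>carrier_of M. \<forall>u\<in>fibre E x. \<forall>v\<in>fibre E x.
        g u v = g v u \<and>
        (\<forall>w\<in>fibre E x. g (fadd E u v) w = g u w + g v w) \<and>
        (\<forall>a. g (fscale E a u) v = a * g u v) \<and>
        g u u \<ge> 0 \<and> (g u u = 0 \<longrightarrow> (\<forall>w\<in>fibre E x. fadd E u w = w))) \<and>
     (\<forall>U \<sigma> \<tau>. openin (Top M) U \<and> smooth_section M E U \<sigma> \<and> smooth_section M E U \<tau> \<longrightarrow>
        smooth_map (open_submanifold M U) euclidean_manifold (\<lambda>x. g (\<sigma> x) (\<tau> x)))"

definition fiber_norm :: "('e \<Rightarrow> 'e \<Rightarrow> real) \<Rightarrow> 'e \<Rightarrow> real" where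
  "fiber_norm g v = sqrt (g v v)"


section \<open>Sobolev norms on open subsets of Euclidean space\<close>

text \<open>All norms take values in \<open>[0,\<infinity>]\<close>; a space consists of the functions of finite norm.\<close>

definition ennreal_powr :: "ennreal \<Rightarrow> real \<Rightarrow> ennreal" where
  "ennreal_powr a q = (if a = \<infinity> then \<infinity> else ennreal (enn2real a powr q))"

definition Lp_norm :: "real \<Rightarrow> (real ^ 'n) set \<Rightarrow> (real ^ 'n \<Rightarrow> real) \<Rightarrow> ennreal" where
  "Lp_norm p \<Omega> f = ennreal_powr (\<integral>\<^sup>+x. ennreal (\<bar>f x\<bar> powr p) \<partial>lebesgue_on \<Omega>) (1 / p)"

type_synonym 'n multi_index = "'n \<Rightarrow> nat"

definition mi_order :: "'n::finite multi_index \<Rightarrow> nat" where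
  "mi_order \<nu> = (\<Sum>i\<in>UNIV. \<nu> i)"

lemma finite_multi_indices: "finite {\<nu> :: 'n::finite multi_index. mi_order \<nu> \<le> k}"
proof (rule finite_subset)
  show "{\<nu> :: 'n multi_index. mi_order \<nu> \<le> k} \<subseteq> (\<Pi>\<^sub>E i\<in>UNIV. {..k})"
  proof
    fix \<nu> :: "'n multi_index" assume "\<nu> \<in> {\<nu>. mi_order \<nu> \<le> k}"
    then have "\<nu> i \<le> k" for i
      using member_le_sum[of i UNIV \<nu>] by (simp add: mi_order_def)
    then show "\<nu> \<in> (\<Pi>\<^sub>E i\<in>UNIV. {..k})" by auto
  qed
qed (simp add: finite_PiE)

definition partial_deriv :: "'n \<Rightarrow> (real ^ 'n \<Rightarrow> real) \<Rightarrow> real ^ 'n \<Rightarrow> real" where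
  "partial_deriv i f x = frechet_derivative f (at x) (axis i 1)"

definition iterated_partial :: "'n list \<Rightarrow> (real ^ 'n \<Rightarrow> real) \<Rightarrow> real ^ 'n \<Rightarrow> real" where
  "iterated_partial is f = foldr partial_deriv is f"

definition test_function :: "(real ^ 'n) set \<Rightarrow> (real ^ 'n \<Rightarrow> real) \<Rightarrow> bool" where
  "test_function \<Omega> \<eta> \<longleftrightarrow> smooth_on UNIV \<eta> \<and>
     compact (closure {x. \<eta> x \<noteq> 0}) \<and> closure {x. \<eta> x \<noteq> 0} \<subseteq> \<Omega>"

definition locally_integrable :: "(real ^ 'n) set \<Rightarrow> (real ^ 'n \<Rightarrow> real) \<Rightarrow> bool" where
  "locally_integrable \<Omega> f \<longleftrightarrow> (\<forall>K. compact K \<and> K \<subseteq> \<Omega> \<longrightarrow> f absolutely_integrable_on K)"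

text \<open>The index type carries no order, so \<open>\<partial>\<^sup>\<nu> \<eta>\<close> is computed by every list that contains
  each \<open>i\<close> exactly \<open>\<nu> i\<close> times; for smooth \<open>\<eta>\<close> all these lists give the same function.\<close>

definition has_weak_deriv ::
  "(real ^ 'n) set \<Rightarrow> 'n multi_index \<Rightarrow> (real ^ 'n \<Rightarrow> real) \<Rightarrow> (real ^ 'n \<Rightarrow> real) \<Rightarrow> bool" where
  "has_weak_deriv \<Omega> \<nu> f h \<longleftrightarrow> locally_integrable \<Omega> f \<and> locally_integrable \<Omega> h \<and>
     (\<forall>\<eta> is. test_function \<Omega> \<eta> \<and> (\<forall>i. count_list is i = \<nu> i) \<longrightarrow>
        (\<integral>x. f x * iterated_partial is \<eta> x \<partial>lebesgue_on \<Omega>) =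
        (-1) ^ mi_order \<nu> * (\<integral>x. h x * \<eta> x \<partial>lebesgue_on \<Omega>))"

text \<open>Weak derivatives are unique up to null sets, and the norms below do not see null sets.\<close>

definition weak_deriv ::
  "(real ^ 'n) set \<Rightarrow> 'n multi_index \<Rightarrow> (real ^ 'n \<Rightarrow> real) \<Rightarrow> real ^ 'n \<Rightarrow> real" where
  "weak_deriv \<Omega> \<nu> f = (SOME h. has_weak_deriv \<Omega> \<nu> f h)"

definition Wkp_norm :: "nat \<Rightarrow> real \<Rightarrow> (real ^ 'n) set \<Rightarrow> (real ^ 'n \<Rightarrow> real) \<Rightarrow> ennreal" where
  "Wkp_norm k p \<Omega> f =
     (if \<forall>\<nu>. mi_order \<nu> \<le> k \<longrightarrow> (\<exists>h. has_weak_deriv \<Omega> \<nu> f h)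
      then \<Sum>\<nu> | mi_order \<nu> \<le> k. Lp_norm p \<Omega> (weak_deriv \<Omega> \<nu> f) else \<infinity>)"

definition slobodeckij_seminorm ::
  "real \<Rightarrow> real \<Rightarrow> (real ^ 'n) set \<Rightarrow> (real ^ 'n \<Rightarrow> real) \<Rightarrow> ennreal" where
  "slobodeckij_seminorm \<theta> p \<Omega> f = ennreal_powr
     (\<integral>\<^sup>+(x, y). ennreal (\<bar>f x - f y\<bar> powr p / norm (x - y) powr (real CARD('n) + \<theta> * p))
        \<partial>(lebesgue_on \<Omega> \<Otimes>\<^sub>M lebesgue_on \<Omega>)) (1 / p)"

text \<open>Intended for \<open>s \<ge> 0\<close>, decomposed as \<open>s = k + \<theta>\<close> with \<open>k = \<lfloor>s\<rfloor>\<close> and \<open>0 \<le> \<theta> < 1\<close>.\<close>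

definition Wsp_norm :: "real \<Rightarrow> real \<Rightarrow> (real ^ 'n) set \<Rightarrow> (real ^ 'n \<Rightarrow> real) \<Rightarrow> ennreal" where
  "Wsp_norm s p \<Omega> f = (let k = nat \<lfloor>s\<rfloor>; \<theta> = frac s in
     Wkp_norm k p \<Omega> f +
     (if \<theta> = 0 then 0
      else \<Sum>\<nu> | mi_order \<nu> = k. slobodeckij_seminorm \<theta> p \<Omega> (weak_deriv \<Omega> \<nu> f)))"


section \<open>Spaces of sections\<close>

text \<open>Elements of the spaces are represented by everywhere defined sections; classes are taken
  modulo equality almost everywhere.\<close>

definition lebesgue_measurable_in :: "('m, real ^ 'n) manifold \<Rightarrow> 'm set \<Rightarrow> bool" where
  "lebesgue_measurable_in M S \<longleftrightarrow> S \<subseteq> carrier_of M \<and>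
     (\<forall>U \<phi>. smooth_chart M (U, \<phi>) \<longrightarrow> \<phi> ` (U \<inter> S) \<in> sets lebesgue)"

definition ae_on :: "('m, real ^ 'n) manifold \<Rightarrow> ('m \<Rightarrow> bool) \<Rightarrow> bool" where
  "ae_on M P \<longleftrightarrow>
     (\<forall>U \<phi>. smooth_chart M (U, \<phi>) \<longrightarrow> negligible (\<phi> ` {x \<in> U. \<not> P x}))"

definition measurable_section ::
  "('m, real ^ 'n) manifold \<Rightarrow> ('e, 'm, (real ^ 'n) \<times> (real ^ 'r)) vector_bundle \<Rightarrow>
   ('m \<Rightarrow> 'e) \<Rightarrow> bool" where
  "measurable_section M E u \<longleftrightarrow> section_over E (carrier_of M) u \<and>
     (\<forall>W. openin (Top (total E)) W \<longrightarrow> lebesgue_measurable_in M {x \<in> carrier_of M. u x \<in> W})"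

text \<open>For compact \<open>M\<close>, integrability of \<open>|u|\<^sup>p\<close> over \<open>M\<close> with respect to a smooth positive
  density does not depend on the density and amounts to integrability, in each smooth chart,
  over the images of compact subsets of its domain.\<close>

definition Lp_sections ::
  "('m, real ^ 'n) manifold \<Rightarrow> ('e, 'm, (real ^ 'n) \<times> (real ^ 'r)) vector_bundle \<Rightarrow>
   ('e \<Rightarrow> 'e \<Rightarrow> real) \<Rightarrow> real \<Rightarrow> ('m \<Rightarrow> 'e) set" where
  "Lp_sections M E g p = {u. measurable_section M E u \<and>
     (\<forall>U \<phi> K. smooth_chart M (U, \<phi>) \<and> compactin (Top M) K \<and> K \<subseteq> U \<longrightarrow>
        Lp_norm p (\<phi> ` K) (\<lambda>z. fiber_norm g (u (inv_into U \<phi> z))) < \<infinity>)}"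

definition Linf_norm ::
  "('m, real ^ 'n) manifold \<Rightarrow> ('e \<Rightarrow> 'e \<Rightarrow> real) \<Rightarrow> ('m \<Rightarrow> 'e) \<Rightarrow> ennreal" where
  "Linf_norm M g u = Inf {c. ae_on M (\<lambda>x. ennreal (fiber_norm g (u x)) \<le> c)}"

definition Linf_sections ::
  "('m, real ^ 'n) manifold \<Rightarrow> ('e, 'm, (real ^ 'n) \<times> (real ^ 'r)) vector_bundle \<Rightarrow>
   ('e \<Rightarrow> 'e \<Rightarrow> real) \<Rightarrow> ('m \<Rightarrow> 'e) set" where
  "Linf_sections M E g = {u. measurable_section M E u \<and> Linf_norm M g u < \<infinity>}"

definition total_trivialization_triple ::
  "('m, real ^ 'n) manifold \<Rightarrow> ('e, 'm, (real ^ 'n) \<times> (real ^ 'r)) vector_bundle \<Rightarrow>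
   'm set \<times> ('m \<Rightarrow> real ^ 'n) \<times> ('e \<Rightarrow> real ^ 'r) \<Rightarrow> bool" where
  "total_trivialization_triple M E = (\<lambda>(U, \<phi>, \<rho>).
     smooth_chart M (U, \<phi>) \<and> trivialization M E U \<rho>)"

text \<open>A list of quadruples \<open>(U, \<phi>, \<rho>, \<psi>)\<close>, one for each \<open>\<alpha> = 1, \<dots>, N\<close>.\<close>

type_synonym ('m, 'e, 'n, 'r) augmented_atlas =
  "('m set \<times> ('m \<Rightarrow> real ^ 'n) \<times> ('e \<Rightarrow> real ^ 'r) \<times> ('m \<Rightarrow> real)) list"

text \<open>Any two smooth charts of \<open>M\<close> are compatible, so that the charts form a smooth atlas as
  soon as they cover \<open>M\<close>.\<close>

definition augmented_total_trivialization_atlas ::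
  "('m, real ^ 'n) manifold \<Rightarrow> ('e, 'm, (real ^ 'n) \<times> (real ^ 'r)) vector_bundle \<Rightarrow>
   ('m, 'e, 'n, 'r) augmented_atlas \<Rightarrow> bool" where
  "augmented_total_trivialization_atlas M E \<Lambda> \<longleftrightarrow>
     (\<forall>(U, \<phi>, \<rho>, \<psi>)\<in>set \<Lambda>. total_trivialization_triple M E (U, \<phi>, \<rho>) \<and>
        smooth_map M euclidean_manifold \<psi> \<and> (\<forall>x\<in>carrier_of M. \<psi> x \<ge> 0) \<and>
        Top M closure_of {x \<in> carrier_of M. \<psi> x \<noteq> 0} \<subseteq> U) \<and>
     (\<Union>(U, \<phi>, \<rho>, \<psi>)\<in>set \<Lambda>. U) = carrier_of M \<and>
     (\<forall>x\<in>carrier_of M. (\<Sum>(U, \<phi>, \<rho>, \<psi>)\<leftarrow>\<Lambda>. \<psi> x) = 1)"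

definition W_norm ::
  "('e, 'm, (real ^ 'n) \<times> (real ^ 'r)) vector_bundle \<Rightarrow> ('m, 'e, 'n, 'r) augmented_atlas \<Rightarrow>
   real \<Rightarrow> real \<Rightarrow> ('m \<Rightarrow> 'e) \<Rightarrow> ennreal" where
  "W_norm E \<Lambda> s p u = (\<Sum>(U, \<phi>, \<rho>, \<psi>)\<leftarrow>\<Lambda>. \<Sum>l\<in>UNIV.
     Wsp_norm s p (\<phi> ` U)
       (\<lambda>z. let x = inv_into U \<phi> z in \<rho> (fscale E (\<psi> x) (u x)) $ l))"

definition W_sections ::
  "('m, real ^ 'n) manifold \<Rightarrow> ('e, 'm, (real ^ 'n) \<times> (real ^ 'r)) vector_bundle \<Rightarrow>
   ('e \<Rightarrow> 'e \<Rightarrow> real) \<Rightarrow> ('m, 'e, 'n, 'r) augmented_atlas \<Rightarrow> real \<Rightarrow> real \<Rightarrow> ('m \<Rightarrow> 'e) set" where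
  "W_sections M E g \<Lambda> s p = {u \<in> Lp_sections M E g p. W_norm E \<Lambda> s p u < \<infinity>}"

definition continuously_included ::
  "'u set \<Rightarrow> ('u \<Rightarrow> ennreal) \<Rightarrow> 'u set \<Rightarrow> ('u \<Rightarrow> ennreal) \<Rightarrow> bool" where
  "continuously_included X norm_X Y norm_Y \<longleftrightarrow>
     X \<subseteq> Y \<and> (\<exists>C::real. \<forall>u\<in>X. norm_Y u \<le> ennreal C * norm_X u)"

end

theory Submission
  imports Defs
begin

text \<open>In a chart and a trivialization the assertion concerns a real function \<open>f\<close> on an open set \<open>\<Omega> \<subseteq> \<real>\<^sup>n\<close>:
  if \<open>sp > n\<close> and the norm of \<open>f\<close> in \<open>W\<^sup>s\<^sup>p(\<Omega>)\<close> is finite, then \<open>f\<close> has a continuous version, which on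
  each compact subset of \<open>\<Omega>\<close> is bounded by a multiple of the norm (\<open>sobolev_embedding_interior\<close>). The proof
  treats all \<open>s\<close> alike. Let \<open>f\<^sub>\<epsilon> x\<close> be the integral of \<open>\<epsilon> ^ (- n) f(y) \<eta>((x - y) / \<epsilon>)\<close> over \<open>y\<close>, and let
  \<open>k\<close> be the integral part of \<open>s\<close>. The mollifier \<open>\<eta>\<close> can be chosen such that \<open>\<eta>(x) - 2 ^ n \<eta>(2x)\<close> is a
  sum over \<open>i\<close> of pure derivatives \<open>\<partial>\<^sub>i ^ k \<theta>\<^sub>i\<close> of test functions of mean zero (\<open>smoothing_pair_exists\<close>).
  Moving these derivatives to \<open>f\<close>, one obtains \<open>f\<^sub>\<epsilon> x - f\<^sub>\<epsilon>\<^sub>/\<^sub>2 x\<close> as \<open>\<epsilon> ^ (k - n)\<close> times the sum of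
  the integrals of \<open>\<partial>\<^sub>i ^ k f(y) \<theta>\<^sub>i((x - y) / \<epsilon>)\<close>. Each integral is of order \<open>\<epsilon> powr (n + (s - k) - n/p)\<close>
  (\<open>kernel_pairing_bound\<close>): for \<open>s = k\<close> by Hoelder's inequality, and for \<open>s > k\<close> because the mean value zero of
  \<open>\<theta>\<^sub>i\<close> brings in the differences of \<open>\<partial>\<^sub>i ^ k f\<close> that the Slobodeckij seminorm controls. So the difference is of
  order \<open>\<epsilon> powr (s - n/p)\<close> (\<open>mollify_step\<close>), which is summable over the scales \<open>\<epsilon> = 2 ^ (- j)\<close> precisely
  because \<open>sp > n\<close>. The locally uniform limit is continuous, it obeys the bound, and it agrees with \<open>f\<close> almost
  everywhere, since mollifications converge weakly (\<open>mollify_limit_eq_AE\<close>). Only balls contained in \<open>\<Omega>\<close> occur, so the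
  estimates hold for arbitrary open sets.

  On the manifold, this gives for each member \<open>(U, \<phi>, \<rho>, \<psi>)\<close> of \<open>\<Lambda>\<close> a continuous version of \<open>u\<close> on the
  open set where \<open>\<psi> \<noteq> 0\<close> (\<open>local_continuous_version\<close>). Two of them agree almost everywhere where both are
  defined, hence everywhere there, because the total space is Hausdorff and nonempty open sets are not null sets; so they can
  be pasted. For the bound, the manifold is covered by the compact sets where \<open>\<psi> \<ge> c\<close>, for a small constant \<open>c > 0\<close>. On
  such a set \<open>\<rho> u\<close> is bounded by the local estimate divided by \<open>c\<close>, and the fibre norm is bounded by a multiple of the
  components of \<open>\<rho> u\<close>, because the metric has bounded coefficients in the frame of the trivialization
  (\<open>fiber_norm_bound\<close>).\<close>

section \<open>Differential calculus of smooth functions\<close>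

lemma Ck_on_subset: "Ck_on k S f \<Longrightarrow> T \<subseteq> S \<Longrightarrow> Ck_on k T f"
proof (induction k arbitrary: f)
  case 0 then show ?case by (auto intro: continuous_on_subset)
next
  case (Suc k) then show ?case by (auto simp: subset_iff)
qed

text \<open>The derivatives in \<^const>\<open>Ck_on\<close> are taken with respect to the whole space, so that only on an
  open set do the values on the set determine them.\<close>

lemma Ck_on_cong:
  assumes "open S" "\<And>x. x \<in> S \<Longrightarrow> f x = g x"
  shows "Ck_on k S f \<longleftrightarrow> Ck_on k S g"
proof -
  have "Ck_on k S g" if "open S" "\<And>x. x \<in> S \<Longrightarrow> f x = g x" "Ck_on k S f" for f g :: "'a \<Rightarrow> 'b" and k
    using that
  proof (induction k arbitrary: f g)
    case 0 then show ?case using continuous_on_cong by force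
  next
    case (Suc k)
    have "g differentiable (at x)" if "x \<in> S" for x
      using that Suc.prems unfolding differentiable_def
      by (metis Ck_on.simps(2) differentiable_def has_derivative_transform_within_open)
    moreover have "frechet_derivative f (at x) = frechet_derivative g (at x)" if "x \<in> S" for x
      using that Suc.prems by (intro frechet_derivative_transform_within_open[of f x S g]) auto
    ultimately show ?case
      using Suc.prems Suc.IH[of "\<lambda>x. frechet_derivative f (at x) v" "\<lambda>x. frechet_derivative g (at x) v" for v]
      by auto
  qed
  from this[of f g k] this[of g f k] assms show ?thesis by auto
qed

lemma Ck_on_Suc_imp: "Ck_on (Suc k) S f \<Longrightarrow> Ck_on k S f"
proof (induction k arbitrary: f)
  case 0
  then show ?case
    by (simp add: differentiable_imp_continuous_on differentiable_on_def differentiable_at_withinI)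
next
  case (Suc k) then show ?case by (metis Ck_on.simps(2))
qed

text \<open>This replaces \<^const>\<open>frechet_derivative\<close> by an explicitly known derivative; the
  closure properties below rest on this rule.\<close>

lemma Ck_on_SucI:
  assumes "open S" "\<And>x. x \<in> S \<Longrightarrow> (f has_derivative f' x) (at x)"
    and "\<And>v. Ck_on k S (\<lambda>x. f' x v)"
  shows "Ck_on (Suc k) S f"
proof -
  have "f' x = frechet_derivative f (at x)" if "x \<in> S" for x
    using assms(2)[OF that] by (rule frechet_derivative_at)
  then have "Ck_on k S (\<lambda>x. frechet_derivative f (at x) v)" for v
    using assms(3)[of v] Ck_on_cong[OF assms(1), of "\<lambda>x. f' x v" "\<lambda>x. frechet_derivative f (at x) v" k] by simp
  then show ?thesis using assms(2) by (auto simp: differentiable_def)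
qed

lemma Ck_on_SucD:
  assumes "Ck_on (Suc k) S f" "x \<in> S"
  shows "(f has_derivative frechet_derivative f (at x)) (at x)"
  using assms by (simp add: frechet_derivative_works)

lemma Ck_on_const: "open S \<Longrightarrow> Ck_on k S (\<lambda>x. c)"
proof (induction k arbitrary: c)
  case (Suc k) 
  show ?case by (rule Ck_on_SucI[where f' = "\<lambda>x v. 0"]) (use Suc in auto)
qed auto

lemma Ck_on_bounded_linear:
  assumes "bounded_linear L" "open S"
  shows "Ck_on k S f \<Longrightarrow> Ck_on k S (\<lambda>x. L (f x))"
proof (induction k arbitrary: f)
  case 0 then show ?case using assms by (auto intro: bounded_linear.continuous_on)
next
  case (Suc k)
  show ?case
  proof (rule Ck_on_SucI[where f' = "\<lambda>x v. L (frechet_derivative f (at x) v)"])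
    show "((\<lambda>x. L (f x)) has_derivative (\<lambda>v. L (frechet_derivative f (at x) v))) (at x)" if "x \<in> S" for x
      by (rule bounded_linear.has_derivative[OF assms(1) Ck_on_SucD[OF Suc.prems that]])
  qed (use Suc assms in auto)
qed

lemma Ck_on_linear:
  assumes "bounded_linear L" "open S"
  shows "Ck_on k S L"
proof (cases k)
  case 0 then show ?thesis using assms linear_continuous_on by auto
next
  case (Suc j)
  then show ?thesis
    using Ck_on_SucI[where f = L and f' = "\<lambda>x. L" and k = j] assms Ck_on_const bounded_linear_imp_has_derivative
    by blast
qed

lemma Ck_on_add:
  assumes "open S"
  shows "Ck_on k S f \<Longrightarrow> Ck_on k S g \<Longrightarrow> Ck_on k S (\<lambda>x. f x + g x)"
proof (induction k arbitrary: f g)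
  case (Suc k)
  show ?case
    by (rule Ck_on_SucI[where f' = "\<lambda>x v. frechet_derivative f (at x) v + frechet_derivative g (at x) v"])
      (use Suc assms in \<open>auto intro!: has_derivative_add Ck_on_SucD\<close>)
qed (auto intro: continuous_intros)

lemma Ck_on_sum:
  assumes "open S" "\<And>i. i \<in> I \<Longrightarrow> Ck_on k S (f i)"
  shows "Ck_on k S (\<lambda>x. \<Sum>i\<in>I. f i x)"
  using assms by (induction I rule: infinite_finite_induct) (auto intro: Ck_on_add Ck_on_const)

lemma Ck_on_scaleR:
  assumes "open S"
  shows "Ck_on k S c \<Longrightarrow> Ck_on k S f \<Longrightarrow> Ck_on k S (\<lambda>x. c x *\<^sub>R f x)"
proof (induction k arbitrary: c f)
  case (Suc k)
  show ?case
  proof (rule Ck_on_SucI[where f' = "\<lambda>x v. c x *\<^sub>R frechet_derivative f (at x) v + frechet_derivative c (at x) v *\<^sub>R f x"])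
    show "Ck_on k S (\<lambda>x. c x *\<^sub>R frechet_derivative f (at x) v + frechet_derivative c (at x) v *\<^sub>R f x)" for v
      using Suc by (intro Ck_on_add Suc.IH assms) (auto intro: Ck_on_Suc_imp)
  qed (use Suc assms in \<open>auto intro!: has_derivative_scaleR Ck_on_SucD\<close>)
qed (auto intro: continuous_intros)

lemma Ck_on_mult:
  fixes f g :: "'a::euclidean_space \<Rightarrow> real"
  assumes "open S" "Ck_on k S f" "Ck_on k S g"
  shows "Ck_on k S (\<lambda>x. f x * g x)"
  using Ck_on_scaleR[OF assms] by simp

lemma Ck_on_prod:
  fixes f :: "'i \<Rightarrow> 'a::euclidean_space \<Rightarrow> real"
  assumes "open S" "\<And>i. i \<in> I \<Longrightarrow> Ck_on k S (f i)"
  shows "Ck_on k S (\<lambda>x. \<Prod>i\<in>I. f i x)"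
  using assms by (induction I rule: infinite_finite_induct) (auto intro: Ck_on_mult Ck_on_const)

text \<open>By the chain rule the derivative in direction \<open>v\<close> is \<open>f' (g x) (g' x v)\<close>. Its
  dependence on \<open>x\<close> runs through both factors; expanding \<open>g' x v\<close> in the standard basis turns it into a
  finite sum of products to which the induction hypothesis applies.\<close>

lemma Ck_on_compose:
  assumes "open S" "g ` S \<subseteq> T"
  shows "Ck_on k T f \<Longrightarrow> Ck_on k S g \<Longrightarrow> Ck_on k S (\<lambda>x. f (g x))"
proof (induction k arbitrary: f)
  case 0 then show ?case using assms continuous_on_compose2 by (metis Ck_on.simps(1))
next
  case (Suc k)
  let ?f' = "\<lambda>x. frechet_derivative f (at x)" and ?g' = "\<lambda>x. frechet_derivative g (at x)"
  show ?case
  proof (rule Ck_on_SucI[where f' = "\<lambda>x v. \<Sum>b\<in>Basis. (?g' x v \<bullet> b) *\<^sub>R ?f' (g x) b"])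
    show "((\<lambda>x. f (g x)) has_derivative (\<lambda>v. \<Sum>b\<in>Basis. (?g' x v \<bullet> b) *\<^sub>R ?f' (g x) b)) (at x)" if "x \<in> S" for x
    proof -
      have f: "(f has_derivative ?f' (g x)) (at (g x))"
        using Suc.prems assms that by (blast intro: Ck_on_SucD)
      have "((\<lambda>x. f (g x)) has_derivative (\<lambda>v. ?f' (g x) (?g' x v))) (at x)"
        using has_derivative_compose[OF Ck_on_SucD[OF Suc.prems(2) that] f] .
      moreover have "?f' (g x) w = (\<Sum>b\<in>Basis. (w \<bullet> b) *\<^sub>R ?f' (g x) b)" for w
        using has_derivative_linear[OF f]
        by (subst euclidean_representation[of w, symmetric]) (simp add: linear_sum linear_scale)
      then have "(\<lambda>v. ?f' (g x) (?g' x v)) = (\<lambda>v. \<Sum>b\<in>Basis. (?g' x v \<bullet> b) *\<^sub>R ?f' (g x) b)" by blast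
      ultimately show ?thesis by (simp only:)
    qed
    show "Ck_on k S (\<lambda>x. \<Sum>b\<in>Basis. (?g' x v \<bullet> b) *\<^sub>R ?f' (g x) b)" for v
      using Suc.prems Suc.IH[OF _ Ck_on_Suc_imp[OF Suc.prems(2)]]
      by (intro Ck_on_sum Ck_on_scaleR Ck_on_bounded_linear[of "\<lambda>w. w \<bullet> b" for b] assms)
        (auto intro: bounded_linear_inner_left)
  qed (use assms in auto)
qed

lemma smooth_on_compose:
  "open S \<Longrightarrow> g ` S \<subseteq> T \<Longrightarrow> smooth_on T f \<Longrightarrow> smooth_on S g \<Longrightarrow> smooth_on S (\<lambda>x. f (g x))"
  using Ck_on_compose unfolding smooth_on_def by blast

lemma smooth_on_cong: "open S \<Longrightarrow> (\<And>x. x \<in> S \<Longrightarrow> f x = g x) \<Longrightarrow> smooth_on S f \<longleftrightarrow> smooth_on S g"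
  using Ck_on_cong unfolding smooth_on_def by blast

lemma smooth_on_subset: "smooth_on S f \<Longrightarrow> T \<subseteq> S \<Longrightarrow> smooth_on T f"
  using Ck_on_subset unfolding smooth_on_def by blast

lemma smooth_on_continuous_on: "smooth_on S f \<Longrightarrow> continuous_on S f"
  unfolding smooth_on_def by (metis Ck_on.simps(1))

lemma smooth_on_differentiable: "smooth_on S f \<Longrightarrow> x \<in> S \<Longrightarrow> f differentiable (at x)"
  unfolding smooth_on_def by (metis Ck_on.simps(2))

lemma smooth_on_frechet: "smooth_on S f \<Longrightarrow> smooth_on S (\<lambda>x. frechet_derivative f (at x) v)"
  unfolding smooth_on_def by (metis Ck_on.simps(2))

lemma smooth_on_affine: "smooth_on UNIV (\<lambda>x. a *\<^sub>R (x::'a::euclidean_space) + c)"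
  unfolding smooth_on_def
  by (intro allI Ck_on_add Ck_on_linear Ck_on_const) (auto intro: bounded_linear_scaleR_right)

lemma smooth_on_affine_compose:
  "smooth_on UNIV f \<Longrightarrow> smooth_on UNIV (\<lambda>x. f (a *\<^sub>R (x::'a::euclidean_space) + c))"
  using smooth_on_compose[OF open_UNIV _ _ smooth_on_affine, of a c UNIV f] by auto

lemma smooth_on_add: "open S \<Longrightarrow> smooth_on S f \<Longrightarrow> smooth_on S g \<Longrightarrow> smooth_on S (\<lambda>x. f x + g x)"
  using Ck_on_add unfolding smooth_on_def by blast

lemma smooth_on_mult:
  fixes f g :: "'a::euclidean_space \<Rightarrow> real"
  shows "open S \<Longrightarrow> smooth_on S f \<Longrightarrow> smooth_on S g \<Longrightarrow> smooth_on S (\<lambda>x. f x * g x)"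
  using Ck_on_mult unfolding smooth_on_def by blast

lemma smooth_on_const: "open S \<Longrightarrow> smooth_on S (\<lambda>x. c)"
  using Ck_on_const unfolding smooth_on_def by blast

lemma smooth_on_UNIV_has_real_derivative:
  fixes b :: "real \<Rightarrow> real"
  assumes "smooth_on UNIV b"
  shows "(b has_real_derivative deriv b x) (at x)"
  using smooth_on_differentiable[OF assms, of x] real_differentiable_def
  by (metis DERIV_deriv_iff_real_differentiable UNIV_I)

lemma smooth_on_UNIV_deriv:
  fixes b :: "real \<Rightarrow> real"
  assumes "smooth_on UNIV b"
  shows "smooth_on UNIV (deriv b)"
proof -
  have "deriv b = (\<lambda>x. frechet_derivative b (at x) 1)"
    using frechet_derivative_at[OF smooth_on_UNIV_has_real_derivative[OF assms, unfolded has_field_derivative_def]]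
    by (metis mult.right_neutral)
  then show ?thesis using smooth_on_frechet[OF assms, of 1] by simp
qed

lemma smooth_on_UNIV_derivI:
  fixes b c :: "real \<Rightarrow> real"
  assumes "\<And>x. (c has_real_derivative b x) (at x)" "smooth_on UNIV b"
  shows "smooth_on UNIV c" 
  unfolding smooth_on_def
proof
  fix k show "Ck_on k UNIV c"
  proof (rule Ck_on_Suc_imp, rule Ck_on_SucI[where f'="\<lambda>x v. b x * v"])
    show "Ck_on k UNIV (\<lambda>x. b x * v)" for v
      using assms(2) unfolding smooth_on_def by (intro Ck_on_mult Ck_on_const) auto
  qed (use assms(1) in \<open>auto simp: has_field_derivative_def\<close>)
qed

section \<open>Bump functions with vanishing moments\<close>

text \<open>The derivative of \<open>exp (-1/t)\<close>, cut off at \<open>0\<close>, is no longer of this form, but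
  the family with the extra powers of \<open>1/t\<close> is closed under differentiation up to linear combinations.\<close>

definition exp_cutoff :: "nat \<Rightarrow> real \<Rightarrow> real" where
  "exp_cutoff m t = (if t > 0 then (1 / t) ^ m * exp (- (1 / t)) else 0)"

lemma exp_cutoff_tendsto_0: "(exp_cutoff m \<longlongrightarrow> 0) (at 0)"
proof (rule filterlim_split_at_real)
  show "(exp_cutoff m \<longlongrightarrow> 0) (at_left 0)"
  proof (rule tendsto_eventually)
    show "\<forall>\<^sub>F t in at_left 0. exp_cutoff m t = 0"
      by (auto simp: exp_cutoff_def eventually_at_filter)
  qed
  have "((\<lambda>x::real. x ^ m / exp x) \<longlongrightarrow> 0) at_top" by (rule tendsto_power_div_exp_0)
  then have "((\<lambda>t::real. (inverse t) ^ m / exp (inverse t)) \<longlongrightarrow> 0) (at_right 0)"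
    using filterlim_compose filterlim_inverse_at_top_right by blast
  moreover have "\<forall>\<^sub>F t in at_right 0. (inverse t) ^ m / exp (inverse t) = exp_cutoff m t"
    by (auto simp: exp_cutoff_def eventually_at_filter exp_minus field_simps)
  ultimately show "(exp_cutoff m \<longlongrightarrow> 0) (at_right 0)" by (rule Lim_transform_eventually)
qed

lemma exp_cutoff_deriv:
  "(exp_cutoff m has_real_derivative (exp_cutoff (m + 2) t - m * exp_cutoff (m + 1) t)) (at t)"
proof -
  consider "t > 0" | "t < 0" | "t = 0" by linarith
  then show ?thesis
  proof cases
    case 1
    define z where "z = 1 / t"
    have z: "((\<lambda>t. 1 / t) has_real_derivative - (z * z)) (at t)"
      using 1 by (auto intro!: derivative_eq_intros simp: z_def)
    have "((\<lambda>t. (1 / t) ^ m * exp (- (1 / t))) has_real_derivative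
        z ^ m * (exp (- z) * (z * z)) + real m * (- (z * z) * z ^ (m - Suc 0)) * exp (- z)) (at t)"
      using DERIV_mult[OF DERIV_power[OF z, of m] DERIV_fun_exp[OF DERIV_minus[OF z]]]
      by (simp add: z_def algebra_simps)
    also have "z ^ m * (exp (- z) * (z * z)) + real m * (- (z * z) * z ^ (m - Suc 0)) * exp (- z)
        = exp_cutoff (m + 2) t - m * exp_cutoff (m + 1) t"
      using 1 unfolding exp_cutoff_def z_def[symmetric] by (cases m) (auto simp: algebra_simps)
    finally have "((\<lambda>t. (1 / t) ^ m * exp (- (1 / t))) has_real_derivative
        exp_cutoff (m + 2) t - m * exp_cutoff (m + 1) t) (at t)" .
    then show ?thesis
      by (rule has_field_derivative_transform_within_open[where S="{0<..}"]) (use 1 in \<open>auto simp: exp_cutoff_def\<close>)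
  next
    case 2
    have "((\<lambda>t. 0) has_real_derivative 0) (at t)" by simp
    then have "(exp_cutoff m has_real_derivative 0) (at t)"
      by (rule has_field_derivative_transform_within_open[where S="{..<0}"]) (use 2 in \<open>auto simp: exp_cutoff_def\<close>)
    then show ?thesis using 2 by (simp add: exp_cutoff_def)
  next
    case 3
    have "((\<lambda>h. (exp_cutoff m (0 + h) - exp_cutoff m 0) / h) \<longlongrightarrow> 0) (at 0)"
    proof (rule Lim_transform_eventually[OF exp_cutoff_tendsto_0[of "Suc m"]])
      show "\<forall>\<^sub>F h in at 0. exp_cutoff (Suc m) h = (exp_cutoff m (0 + h) - exp_cutoff m 0) / h"
        by (auto simp: exp_cutoff_def eventually_at_filter)
    qed
    then show ?thesis unfolding DERIV_def using 3 by (simp add: exp_cutoff_def)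
  qed
qed

text \<open>Induction on the order for all \<open>m\<close> at once, since the derivative involves
  the indices \<open>m + 1\<close> and \<open>m + 2\<close>.\<close>

lemma exp_cutoff_smooth: "smooth_on UNIV (exp_cutoff m)"
  unfolding smooth_on_def
proof
  fix k show "Ck_on k UNIV (exp_cutoff m)"
  proof (induction k arbitrary: m)
    case 0 show ?case
      using exp_cutoff_deriv[THEN DERIV_isCont] by (simp add: continuous_at_imp_continuous_on)
  next
    case (Suc k)
    have "Ck_on k UNIV (\<lambda>x. ((1 * exp_cutoff (m + 2) x) + (- real m) * exp_cutoff (m + 1) x) * v)" for v
      by (intro Ck_on_mult Ck_on_const Ck_on_add open_UNIV Suc.IH)
    then show ?case
      by (intro Ck_on_SucI[where f' = "\<lambda>x v. (exp_cutoff (m + 2) x - m * exp_cutoff (m + 1) x) * v"])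
         (use exp_cutoff_deriv in \<open>auto simp: has_field_derivative_def\<close>)
  qed
qed

definition bump :: "(real \<Rightarrow> real) \<Rightarrow> bool" where
  "bump b \<longleftrightarrow> smooth_on UNIV b \<and> (\<forall>x. \<bar>x\<bar> > 1 \<longrightarrow> b x = 0)"

lemma bump_deriv: assumes "bump b" shows "bump (deriv b)"
proof -
  have "deriv b x = 0" if "\<bar>x\<bar> > 1" for x
  proof -
    have "((\<lambda>x. 0) has_real_derivative 0) (at x)" by simp
    then have "(b has_real_derivative 0) (at x)"
      by (rule has_field_derivative_transform_within_open[where S="- {-1..1}"])
         (use that assms in \<open>auto simp: bump_def abs_if split: if_splits\<close>)
    then show ?thesis by (rule DERIV_imp_deriv)
  qed
  then show ?thesis using assms smooth_on_UNIV_deriv unfolding bump_def by auto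
qed

lemma bump_integrable: assumes "bump b" shows "integrable lborel b"
proof -
  have "set_integrable lborel {-1..1} b"
    using assms unfolding bump_def
    by (intro borel_integrable_atLeastAtMost') (auto dest!: smooth_on_continuous_on intro: continuous_on_subset)
  then have "integrable lborel (\<lambda>x. indicator {-1..1} x *\<^sub>R b x)" unfolding set_integrable_def .
  moreover have "(\<lambda>x. indicator {-1..1} x *\<^sub>R b x) = b"
  proof
    fix x show "indicator {-1..1} x *\<^sub>R b x = b x"
      using assms by (cases "\<bar>x\<bar> > 1") (auto simp: bump_def indicator_def abs_if split: if_splits)
  qed
  ultimately show ?thesis by simp
qed

lemma bump_dilate: "bump b \<Longrightarrow> bump (\<lambda>x. A * b x + B * b (2 * x))"
  unfolding bump_def using smooth_on_affine_compose[of b 2 0]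
  by (auto intro!: smooth_on_add smooth_on_mult smooth_on_const)

lemma bump_dilate_integral:
  assumes "bump b"
  shows "(\<integral>x. A * b x + B * b (2 * x) \<partial>lborel) = (A + B / 2) * (\<integral>x. b x \<partial>lborel)"
proof -
  have i: "integrable lborel b" "integrable lborel (\<lambda>x. b (2 * x))"
    using bump_integrable[OF assms] lborel_integrable_real_affine[of b 2 0] by auto
  have "(\<integral>x. b x \<partial>lborel) = 2 * (\<integral>x. b (2 * x) \<partial>lborel)"
    using lborel_integral_real_affine[of 2 b 0] by simp
  then show ?thesis using i by (simp add: field_simps)
qed

text \<open>The vanishing integral is what makes the antiderivative vanish to the right of
  the support as well.\<close>

lemma bump_antiderivative:
  assumes b: "bump b" and z: "(\<integral>x. b x \<partial>lborel) = 0"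
  obtains c where "bump c" "deriv c = b"
proof -
  have bc: "continuous_on S b" for S
    using b unfolding bump_def by (meson smooth_on_continuous_on continuous_on_subset subset_UNIV)
  have b0: "b x = 0" if "\<bar>x\<bar> > 1" for x using that b by (auto simp: bump_def)
  \<comment> \<open>The base point lies to the left of the support, so that \<open>c\<close> is given by one formula around \<open>-1\<close>.\<close>
  define c where "c x = integral {-2..x} b" for x
  have c0: "c x = 0" if "x < -1" for x
    unfolding c_def by (rule integral_unique, rule has_integral_is_0) (use that b0 in auto)
  have c1: "c x = 0" if "x > 1" for x
  proof -
    have "(b has_integral 0) UNIV"
      using has_integral_integral_lborel[OF bump_integrable[OF b]] z by simp
    moreover have "b = (\<lambda>y. if y \<in> {-2..x} then b y else 0)"
      using that b0 by force
    ultimately have "(b has_integral 0) {-2..x}"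
      using has_integral_restrict_UNIV[of "{-2..x}" b 0] by simp
    then show ?thesis unfolding c_def by blast
  qed
  have d: "(c has_real_derivative b x) (at x)" for x
  proof (cases "x < -1")
    case True
    have "((\<lambda>x. 0) has_real_derivative 0) (at x)" by simp
    then have "(c has_real_derivative 0) (at x)"
      by (rule has_field_derivative_transform_within_open[where S="{..< -1}"]) (use True c0 in auto)
    then show ?thesis using True b0[of x] by simp
  next
    case False
    have "((\<lambda>u. integral {-2..u} b) has_real_derivative b x) (at x within {-2..x+1})"
      by (rule integral_has_real_derivative) (use bc False in auto)
    then show ?thesis unfolding c_def
      using False at_within_Icc_at[of "-2" x "x+1"] by simp
  qed
  have "bump c" unfolding bump_def
    using smooth_on_UNIV_derivI[OF d] b c0 c1 by (auto simp: bump_def abs_if split: if_splits)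
  moreover have "deriv c = b" using d by (auto intro: DERIV_imp_deriv)
  ultimately show ?thesis using that by blast
qed

lemma bump_exists: obtains b where "bump b" "(\<integral>x. b x \<partial>lborel) = 1"
proof -
  define a where "a x = exp_cutoff 0 (1 + x) * exp_cutoff 0 (1 - x)" for x
  have "smooth_on UNIV (\<lambda>x. exp_cutoff 0 (1 + x))" "smooth_on UNIV (\<lambda>x. exp_cutoff 0 (1 - x))"
    using smooth_on_affine_compose[OF exp_cutoff_smooth, where a = 1 and c = 1]
      smooth_on_affine_compose[OF exp_cutoff_smooth, where a = "-1" and c = 1]
    by (simp_all add: add.commute)
  then have "bump a" unfolding bump_def a_def
    by (auto intro!: smooth_on_mult simp: exp_cutoff_def)
  have cont: "continuous_on UNIV a" using \<open>bump a\<close> smooth_on_continuous_on by (auto simp: bump_def)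
  have a_nonneg: "a x \<ge> 0" for x by (simp add: a_def exp_cutoff_def)
  have "(\<integral>x. a x \<partial>lborel) \<noteq> 0"
  proof
    assume "(\<integral>x. a x \<partial>lborel) = 0"
    then have "AE x in lborel. a x = 0"
      using integral_nonneg_eq_0_iff_AE[OF bump_integrable[OF \<open>bump a\<close>]] a_nonneg by auto
    then have "AE x in lborel. x \<notin> {-1<..<1::real}"
      by (rule eventually_mono) (auto simp: a_def exp_cutoff_def)
    then have "{-1<..<1::real} \<in> null_sets lborel"
      by (subst AE_iff_null_sets) auto
    then show False by (simp add: null_sets_def)
  qed
  then show ?thesis
    by (intro that[of "\<lambda>x. (1 / (\<integral>x. a x \<partial>lborel)) * a x + 0 * a (2 * x)"]
        bump_dilate[OF \<open>bump a\<close>], subst bump_dilate_integral[OF \<open>bump a\<close>]) simp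
qed

lemma smooth_funpow_deriv: "smooth_on UNIV (f::real\<Rightarrow>real) \<Longrightarrow> smooth_on UNIV ((deriv ^^ j) f)"
  by (induction j) (auto intro: smooth_on_UNIV_deriv)

lemma funpow_deriv_dilate:
  fixes f :: "real \<Rightarrow> real"
  assumes "smooth_on UNIV f"
  shows "(deriv ^^ j) (\<lambda>x. A * f x + B * f (2 * x)) =
    (\<lambda>x. A * (deriv ^^ j) f x + B * 2 ^ j * (deriv ^^ j) f (2 * x))"
proof (induction j)
  case (Suc j)
  let ?g = "(deriv ^^ j) f"
  have d: "(?g has_real_derivative deriv ?g x) (at x)" for x
    by (rule smooth_on_UNIV_has_real_derivative smooth_funpow_deriv assms)+
  have "((\<lambda>x. ?g (2 * x)) has_real_derivative deriv ?g (2 * x) * 2) (at x)" for x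
    by (rule DERIV_chain2[where g = "\<lambda>x. 2 * x", OF d]) (auto intro!: derivative_eq_intros)
  from DERIV_add[OF DERIV_cmult[OF d, of A] DERIV_cmult[OF this, of "B * 2^j"]]
  have "deriv (\<lambda>x. A * ?g x + B * 2 ^ j * ?g (2 * x)) =
      (\<lambda>x. A * deriv ?g x + B * 2 ^ j * (deriv ?g (2 * x) * 2))"
    by (blast intro: DERIV_imp_deriv)
  then show ?case unfolding funpow.simps o_apply Suc by (simp add: mult_ac)
qed simp

text \<open>A bump of integral \<open>1\<close> whose difference with its rescaling \<open>2 * b (2 * x)\<close> is a
  derivative of high order, i.e. all of whose moments of low positive order vanish. The order is raised by one in each
  step: write \<open>D b\<close> for the rescaling, which preserves the integral. If \<open>b - D b\<close> is the \<open>j\<close>-th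
  derivative of \<open>c\<close> and \<open>b' = a b + (1 - a) D b\<close>, then \<open>b' - D b'\<close> is the \<open>j\<close>-th derivative of
  \<open>a c + (1 - a) 2 ^ (- j) D c\<close>. For \<open>j \<ge> 1\<close> the number \<open>a\<close> can be chosen such that this
  function has integral \<open>0\<close>, and then it is itself the derivative of a bump. The induction starts at
  \<open>j = 1\<close>, because \<open>b - D b\<close> has integral \<open>0\<close> for every bump.\<close>

lemma kernel_1d:
  "\<exists>b c. bump b \<and> bump c \<and> (\<integral>x. b x \<partial>lborel) = 1 \<and>
     (\<forall>x. b x - 2 * b (2 * x) = (deriv ^^ Suc j) c x)"
proof (induction j)
  case 0
  obtain b where b: "bump b" "(\<integral>x. b x \<partial>lborel) = 1" by (rule bump_exists)
  obtain c where "bump c" "deriv c = (\<lambda>x. 1 * b x + (-2) * b (2 * x))"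
    using bump_antiderivative[OF bump_dilate[OF b(1), of 1 "-2"]]
      bump_dilate_integral[OF b(1), of 1 "-2"] by auto
  then have "\<forall>x. b x - 2 * b (2 * x) = (deriv ^^ Suc 0) c x" by simp
  then show ?case using b \<open>bump c\<close> by blast
next
  case (Suc j)
  then obtain b c where bc: "bump b" "bump c" "(\<integral>x. b x \<partial>lborel) = 1"
    "\<And>x. b x - 2 * b (2 * x) = (deriv ^^ Suc j) c x" by blast
  define q :: real where "q = 1 / 2 ^ Suc j"
  \<comment> \<open>The solution of \<open>a + (1 - a) * q = 0\<close>.\<close>
  define a where "a = - q / (1 - q)"
  have q: "0 < q" "q < 1" "2 ^ Suc j * q = 1" by (auto simp: q_def simp del: power_Suc intro: one_less_power)
  have "a + (1 - a) * q = 0" using q by (simp add: a_def field_simps)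
  moreover have "2 * (1 - a) * q / 2 = (1 - a) * q" by (simp add: field_simps)
  ultimately have "a + 2 * (1 - a) * q / 2 = 0" by linarith
  then have "(a + 2 * (1 - a) * q / 2) * (\<integral>x. c x \<partial>lborel) = 0" by (simp only: mult_zero_left)
  then obtain d where d: "bump d" "deriv d = (\<lambda>x. a * c x + (2 * (1 - a) * q) * c (2 * x))"
    using bump_antiderivative[OF bump_dilate[OF bc(2), of a "2 * (1 - a) * q"]]
      bump_dilate_integral[OF bc(2), of a "2 * (1 - a) * q"] by metis
  let ?b = "\<lambda>x. a * b x + (2 * (1 - a)) * b (2 * x)"
  have "?b x - 2 * ?b (2 * x) = (deriv ^^ Suc (Suc j)) d x" for x
  proof -
    have "(deriv ^^ Suc (Suc j)) d x = (deriv ^^ Suc j) (\<lambda>x. a * c x + (2 * (1 - a) * q) * c (2 * x)) x"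
      by (simp only: funpow_Suc_right o_def d(2))
    also have "\<dots> = a * (deriv ^^ Suc j) c x + (2 * (1 - a) * q) * 2 ^ Suc j * (deriv ^^ Suc j) c (2 * x)"
      using funpow_deriv_dilate[of c "Suc j"] bc(2) by (simp only: bump_def)
    also have "(2 * (1 - a) * q) * 2 ^ Suc j = 2 * (1 - a) * (2 ^ Suc j * q)" by (simp only: ac_simps)
    also have "\<dots> = 2 * (1 - a)" using q by simp
    also have "a * (deriv ^^ Suc j) c x + 2 * (1 - a) * (deriv ^^ Suc j) c (2 * x) = ?b x - 2 * ?b (2 * x)"
      by (simp only: bc(4)[symmetric]) (simp add: algebra_simps)
    finally show ?thesis by simp
  qed
  moreover have "bump ?b" by (rule bump_dilate[OF bc(1)])
  moreover have "(\<integral>x. ?b x \<partial>lborel) = 1" using bump_dilate_integral[OF bc(1), of a "2 * (1 - a)"] bc(3) by (simp add: field_simps)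
  ultimately show ?case using d(1) by blast
qed

section \<open>Smoothing kernels in several variables\<close>

definition tensor :: "('n \<Rightarrow> real \<Rightarrow> real) \<Rightarrow> real ^ 'n \<Rightarrow> real" where
  "tensor B x = (\<Prod>i\<in>UNIV. B i (x $ i))"

lemma tensor_smooth:
  assumes "\<And>i. smooth_on UNIV (B i)"
  shows "smooth_on UNIV (tensor B)"
proof -
  have "smooth_on UNIV (\<lambda>x::real ^ 'a. x $ i)" for i
    unfolding smooth_on_def by (intro allI Ck_on_linear bounded_linear_vec_nth open_UNIV)
  then have "smooth_on UNIV (\<lambda>x::real ^ 'a. B i (x $ i))" for i
    using assms smooth_on_compose[of UNIV "\<lambda>x. x $ i" UNIV "B i"] by simp
  then show ?thesis unfolding tensor_def[abs_def] smooth_on_def by (simp add: Ck_on_prod)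
qed

lemma prod_remove_UNIV: "(\<Prod>i\<in>UNIV. f i) = f i * (\<Prod>j\<in>UNIV - {i}. f j)" for i :: "'i::finite"
  by (rule prod.remove) auto

lemma partial_deriv_tensor:
  assumes "\<And>i. smooth_on UNIV (B i)"
  shows "partial_deriv i (tensor B) = tensor (B(i := deriv (B i)))"
proof
  fix x
  have "((\<lambda>x. B j (x $ j)) has_derivative (\<lambda>v. deriv (B j) (x $ j) * v $ j)) (at x)" for j
    using has_derivative_compose[OF bounded_linear_imp_has_derivative[OF bounded_linear_vec_nth]
        smooth_on_UNIV_has_real_derivative[OF assms[of j], of "x $ j", unfolded has_field_derivative_def]]
    by (simp add: mult.commute)
  then have "(tensor B has_derivative
      (\<lambda>v. \<Sum>j\<in>UNIV. (deriv (B j) (x $ j) * v $ j) * (\<Prod>k\<in>UNIV - {j}. B k (x $ k)))) (at x)"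
    unfolding tensor_def[abs_def] by (rule has_derivative_prod)
  from fun_cong[OF frechet_derivative_at[OF this], of "axis i 1"] have "partial_deriv i (tensor B) x =
      (\<Sum>j\<in>UNIV. (deriv (B j) (x $ j) * axis i 1 $ j) * (\<Prod>k\<in>UNIV - {j}. B k (x $ k)))"
    unfolding partial_deriv_def by simp
  also have "\<dots> = deriv (B i) (x $ i) * (\<Prod>k\<in>UNIV - {i}. B k (x $ k))"
    by (subst sum.remove[of _ i]) (auto simp: axis_def)
  also have "\<dots> = tensor (B(i := deriv (B i))) x"
    unfolding tensor_def prod_remove_UNIV[of "\<lambda>j. (B(i := deriv (B i))) j (x $ j)" i]
    by (auto intro!: prod.cong)
  finally show "partial_deriv i (tensor B) x = tensor (B(i := deriv (B i))) x" .
qed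

lemma iterated_partial_tensor:
  assumes "\<And>i. smooth_on UNIV (B i)"
  shows "iterated_partial (replicate k i) (tensor B) = tensor (B(i := (deriv ^^ k) (B i)))"
proof (induction k)
  case (Suc k)
  have "smooth_on UNIV ((B(i := (deriv ^^ k) (B i))) j)" for j
    using assms smooth_funpow_deriv by auto
  from partial_deriv_tensor[of "B(i := (deriv ^^ k) (B i))" i, OF this] Suc
  show ?case by (simp add: iterated_partial_def fun_upd_def cong: if_cong)
qed (simp add: iterated_partial_def)

lemma tensor_vanishes:
  assumes "\<And>i. bump (B i)" "norm x > real CARD('n)"
  shows "tensor B (x :: real ^ 'n) = 0"
proof -
  have "norm x \<le> (\<Sum>i\<in>UNIV. \<bar>x $ i\<bar>)" by (rule norm_le_l1_cart)
  then have "\<exists>i. \<bar>x $ i\<bar> > 1"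
    using assms(2) sum_bounded_above[of UNIV "\<lambda>i. \<bar>x $ i\<bar>" 1] by (force simp: not_less)
  then show ?thesis using assms(1) unfolding tensor_def bump_def by (auto simp: prod_zero_iff)
qed

text \<open>Fubini for a product of functions of the single coordinates; Lebesgue measure on
  the Euclidean space is the image of the product measure indexed by the standard basis.\<close>

lemma tensor_integral:
  fixes B :: "'n::finite \<Rightarrow> real \<Rightarrow> real"
  assumes "\<And>i. integrable lborel (B i)"
  shows "(\<integral>x. tensor B x \<partial>lborel) = (\<Prod>i\<in>UNIV. \<integral>t. B i t \<partial>lborel)"
proof -
  interpret product_sigma_finite "\<lambda>_::real ^ 'n. lborel :: real measure" ..
  define A where "A b = B (THE i. b = axis i (1::real))" for b :: "real ^ 'n"
  have A: "A (axis i 1) = B i" for i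
    unfolding A_def by (rule arg_cong[where f = B]) (auto simp: axis_eq_axis)
  have inj: "inj (\<lambda>i::'n. axis i (1::real))" by (auto simp: inj_on_def axis_eq_axis)
  have Basis: "(Basis :: (real ^ 'n) set) = range (\<lambda>i. axis i 1)" by (auto simp: Basis_vec_def)
  have [measurable]: "B i \<in> borel_measurable borel" for i
    using assms[of i] by (simp add: borel_measurable_integrable)
  have [measurable]: "tensor B \<in> borel_measurable borel" unfolding tensor_def[abs_def] by measurable
  have "(\<integral>x. tensor B x \<partial>lborel) =
      (\<integral>f. tensor B (\<Sum>b\<in>Basis. f b *\<^sub>R b) \<partial>(\<Pi>\<^sub>M b\<in>(Basis :: (real ^ 'n) set). lborel))"
    by (subst lborel_eq, subst integral_distr) auto
  also have "\<dots> = (\<integral>f. (\<Prod>b\<in>Basis. A b (f b)) \<partial>(\<Pi>\<^sub>M b\<in>(Basis :: (real ^ 'n) set). lborel))"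
  proof (rule Bochner_Integration.integral_cong[OF refl])
    fix f :: "real ^ 'n \<Rightarrow> real"
    have "(\<Sum>b\<in>Basis. f b *\<^sub>R b) $ i = f (axis i 1)" for i
      unfolding Basis by (subst sum.reindex[OF inj]) (auto simp: axis_def if_distrib cong: if_cong)
    then show "tensor B (\<Sum>b\<in>Basis. f b *\<^sub>R b) = (\<Prod>b\<in>Basis. A b (f b))"
      unfolding tensor_def Basis by (simp add: prod.reindex[OF inj] A)
  qed
  also have "\<dots> = (\<Prod>b\<in>Basis. \<integral>t. A b t \<partial>lborel)"
    by (rule product_integral_prod) (auto simp: Basis A assms)
  also have "\<dots> = (\<Prod>i\<in>UNIV. \<integral>t. B i t \<partial>lborel)"
    unfolding Basis by (simp add: prod.reindex[OF inj] A)
  finally show ?thesis .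
qed

text \<open>Passing from \<open>b\<close> to \<open>a\<close> one index at a time telescopes the difference. The
  order in which the indices are treated is recorded by the sets \<open>S i\<close> of those treated before \<open>i\<close>, since the
  index type carries no order; they do not depend on \<open>a\<close> and \<open>b\<close>.\<close>

lemma prod_diff_telescope:
  fixes A :: "'i set"
  assumes "finite A"
  shows "\<exists>S. \<forall>a b :: 'i \<Rightarrow> real. (\<Prod>i\<in>A. a i) - (\<Prod>i\<in>A. b i) =
    (\<Sum>i\<in>A. (a i - b i) * (\<Prod>j\<in>A - {i}. if j \<in> S i then a j else b j))"
  using assms
proof induction
  case (insert x A)
  then obtain S where S: "\<And>a b :: 'i \<Rightarrow> real. (\<Prod>i\<in>A. a i) - (\<Prod>i\<in>A. b i) =
    (\<Sum>i\<in>A. (a i - b i) * (\<Prod>j\<in>A - {i}. if j \<in> S i then a j else b j))" by blast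
  define S' where "S' i = (if i = x then A else S i - {x})" for i
  have "(\<Prod>i\<in>insert x A. a i) - (\<Prod>i\<in>insert x A. b i) =
    (\<Sum>i\<in>insert x A. (a i - b i) * (\<Prod>j\<in>insert x A - {i}. if j \<in> S' i then a j else b j))"
    for a b :: "'i \<Rightarrow> real"
  proof -
    have "(\<Prod>j\<in>insert x A - {i}. if j \<in> S' i then a j else b j) =
        b x * (\<Prod>j\<in>A - {i}. if j \<in> S i then a j else b j)" if "i \<in> A" for i
    proof -
      have "insert x A - {i} = insert x (A - {i})" using that insert by auto
      moreover have "(\<Prod>j\<in>A - {i}. if j \<in> S' i then a j else b j) = (\<Prod>j\<in>A - {i}. if j \<in> S i then a j else b j)"
        using that insert by (intro prod.cong) (auto simp: S'_def)
      ultimately show ?thesis using insert that by (auto simp: S'_def)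
    qed
    moreover have "(\<Prod>j\<in>insert x A - {x}. if j \<in> S' x then a j else b j) = (\<Prod>j\<in>A. a j)"
      using insert by (intro prod.cong) (auto simp: S'_def)
    ultimately have "(\<Sum>i\<in>insert x A. (a i - b i) * (\<Prod>j\<in>insert x A - {i}. if j \<in> S' i then a j else b j))
      = (a x - b x) * (\<Prod>j\<in>A. a j) +
        b x * (\<Sum>i\<in>A. (a i - b i) * (\<Prod>j\<in>A - {i}. if j \<in> S i then a j else b j))"
      using insert by (simp add: sum_distrib_left mult_ac)
    also have "\<dots> = (\<Prod>i\<in>insert x A. a i) - (\<Prod>i\<in>insert x A. b i)"
      using insert(1,2) by (subst S[symmetric]) (simp add: algebra_simps)
    finally show ?thesis by simp
  qed
  then show ?case by blast
qed auto

text \<open>The function \<open>\<eta>\<close> is the mollifier. The last condition says that passing to half the scale changes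
  the mollification by a sum of pure derivatives of order \<open>k\<close>; the \<open>\<theta> i\<close> still have mean zero. The
  radius \<open>CARD('n)\<close> of the supports is that of a ball containing the cube \<open>[-1, 1] ^ n\<close>.\<close>

definition smoothing_pair :: "nat \<Rightarrow> (real ^ 'n \<Rightarrow> real) \<Rightarrow> ('n \<Rightarrow> real ^ 'n \<Rightarrow> real) \<Rightarrow> bool" where
  "smoothing_pair k \<eta> \<theta> \<longleftrightarrow>
    smooth_on UNIV \<eta> \<and> (\<forall>x. norm x > CARD('n) \<longrightarrow> \<eta> x = 0) \<and> (\<integral>x. \<eta> x \<partial>lborel) = 1 \<and>
    (\<forall>i. smooth_on UNIV (\<theta> i) \<and> (\<forall>x. norm x > CARD('n) \<longrightarrow> \<theta> i x = 0) \<and> (\<integral>x. \<theta> i x \<partial>lborel) = 0) \<and>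
    (\<forall>x. \<eta> x - 2 ^ CARD('n) * \<eta> (2 *\<^sub>R x) = (\<Sum>i\<in>UNIV. iterated_partial (replicate k i) (\<theta> i) x))"

text \<open>The mollifier is the tensor power of the bump \<open>b\<close> of \<open>kernel_1d\<close> for the order
  \<open>k + 1\<close>. Telescoping the difference of the two tensor powers leaves in the \<open>i\<close>-th term the factor
  \<open>b - D b\<close>, a derivative of order \<open>k + 1\<close>, in the coordinate \<open>i\<close>. Of these \<open>k + 1\<close>
  derivatives \<open>k\<close> are taken out as partial derivatives; the remaining one, in the factor \<open>deriv c\<close>, makes the
  integral of \<open>\<theta> i\<close> vanish.\<close>

lemma smoothing_pair_exists: "\<exists>\<eta> \<theta>. smoothing_pair k \<eta> (\<theta> :: 'n::finite \<Rightarrow> _)"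
proof -
  obtain b c where b: "bump b" and c: "bump c" and b1: "(\<integral>x. b x \<partial>lborel) = 1"
    and bc: "\<And>x. b x - 2 * b (2 * x) = (deriv ^^ Suc k) c x"
    using kernel_1d[of k] by blast
  define d where "d x = 2 * b (2 * x)" for x
  have d: "bump d" using bump_dilate[OF b, of 0 2] by (simp add: d_def[abs_def])
  have c': "bump (deriv c)" by (rule bump_deriv[OF c])
  have c'0: "(\<integral>x. deriv c x \<partial>lborel) = 0"
  proof -
    have "smooth_on UNIV c" using c by (simp add: bump_def)
    then have "(deriv c has_integral (c 2 - c (-2))) {-2..2}"
      by (intro fundamental_theorem_of_calculus)
        (auto simp: has_real_derivative_iff_has_vector_derivative[symmetric]
          intro: has_field_derivative_at_within smooth_on_UNIV_has_real_derivative)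
    then have "(deriv c has_integral 0) {-2..2}" using c by (simp add: bump_def)
    moreover have "deriv c = (\<lambda>y. if y \<in> {-2..2} then deriv c y else 0)"
      using c' by (force simp: bump_def)
    ultimately have "(deriv c has_integral 0) UNIV"
      using has_integral_restrict_UNIV[of "{-2..2}" "deriv c" 0] by simp
    then show ?thesis
      using has_integral_integral_lborel[OF bump_integrable[OF c']] has_integral_unique by blast
  qed
  obtain S :: "'n \<Rightarrow> 'n set" where S: "\<And>a b :: 'n \<Rightarrow> real. (\<Prod>i\<in>UNIV. a i) - (\<Prod>i\<in>UNIV. b i) =
    (\<Sum>i\<in>UNIV. (a i - b i) * (\<Prod>j\<in>UNIV - {i}. if j \<in> S i then a j else b j))"
    using prod_diff_telescope[of "UNIV :: 'n set"] by auto
  define B where "B i j = (if j = i then deriv c else if j \<in> S i then b else d)" for i j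
  have B: "bump (B i j)" for i j using b c' d by (simp add: B_def)
  then have Bs: "smooth_on UNIV (B i j)" for i j by (simp add: bump_def)
  have i0: "(\<integral>x. tensor (B i) x \<partial>lborel) = 0" for i
  proof -
    have "(\<integral>x. tensor (B i) x \<partial>lborel) = (\<Prod>j\<in>UNIV. \<integral>t. B i j t \<partial>lborel)"
      by (rule tensor_integral[OF bump_integrable[OF B]])
    also have "\<dots> = 0" using c'0 by (subst prod_remove_UNIV[of _ i]) (simp add: B_def)
    finally show ?thesis .
  qed
  have "tensor (\<lambda>_. b) x - 2 ^ CARD('n) * tensor (\<lambda>_. b) (2 *\<^sub>R x) =
      (\<Sum>i\<in>UNIV. iterated_partial (replicate k i) (tensor (B i)) x)" for x :: "real ^ 'n"
  proof -
    have "2 ^ CARD('n) * tensor (\<lambda>_. b) (2 *\<^sub>R x) = (\<Prod>i\<in>UNIV. d (x $ i))"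
      by (simp add: tensor_def d_def prod.distrib)
    then have "tensor (\<lambda>_. b) x - 2 ^ CARD('n) * tensor (\<lambda>_. b) (2 *\<^sub>R x) =
      (\<Sum>i\<in>UNIV. (b (x $ i) - d (x $ i)) * (\<Prod>j\<in>UNIV - {i}. if j \<in> S i then b (x $ j) else d (x $ j)))"
      by (simp add: tensor_def S)
    also have "\<dots> = (\<Sum>i\<in>UNIV. tensor ((B i)(i := (deriv ^^ k) (B i i))) x)"
    proof (rule sum.cong[OF refl])
      fix i
      have "(deriv ^^ Suc k) c = (deriv ^^ k) (B i i)" by (simp add: funpow_Suc_right B_def del: funpow.simps)
      then have "b (x $ i) - d (x $ i) = (deriv ^^ k) (B i i) (x $ i)" using bc unfolding d_def by metis
      then show "(b (x $ i) - d (x $ i)) * (\<Prod>j\<in>UNIV - {i}. if j \<in> S i then b (x $ j) else d (x $ j)) =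
        tensor ((B i)(i := (deriv ^^ k) (B i i))) x"
        unfolding tensor_def prod_remove_UNIV[of "\<lambda>j. ((B i)(i := (deriv ^^ k) (B i i))) j (x $ j)" i]
        by (intro arg_cong2[where f = "(*)"] prod.cong) (auto simp: B_def)
    qed
    also have "\<dots> = (\<Sum>i\<in>UNIV. iterated_partial (replicate k i) (tensor (B i)) x)"
      by (simp add: iterated_partial_tensor[OF Bs])
    finally show ?thesis .
  qed
  moreover have "(\<integral>x. tensor (\<lambda>_. b) (x :: real ^ 'n) \<partial>lborel) = 1"
    using tensor_integral[of "\<lambda>_::'n. b"] bump_integrable[OF b] b1 by simp
  ultimately show ?thesis
    using b unfolding smoothing_pair_def
    by (intro exI[of _ "tensor (\<lambda>_. b)"] exI[of _ "\<lambda>i. tensor (B i)"] conjI allI impI tensor_smooth Bs i0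
      tensor_vanishes B) (auto simp: bump_def)
qed

lemma smooth_on_partial_deriv: "smooth_on UNIV f \<Longrightarrow> smooth_on UNIV (partial_deriv i f)"
  unfolding partial_deriv_def[abs_def] by (rule smooth_on_frechet)

lemma smooth_on_iterated_partial: "smooth_on UNIV f \<Longrightarrow> smooth_on UNIV (iterated_partial is f)"
  by (induction "is") (auto simp: iterated_partial_def smooth_on_partial_deriv)

lemma iterated_partial_affine:
  assumes "smooth_on UNIV f"
  shows "iterated_partial is (\<lambda>y. f (a *\<^sub>R (x - y))) =
    (\<lambda>y. (- a) ^ length is * iterated_partial is f (a *\<^sub>R (x - y)))"
proof (induction "is")
  case (Cons i "is")
  let ?f = "iterated_partial is f"
  have d: "(?f has_derivative frechet_derivative ?f (at z)) (at z)" for z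
    using smooth_on_differentiable[OF smooth_on_iterated_partial[OF assms]]
    by (simp add: frechet_derivative_works)
  have "partial_deriv i (\<lambda>y. (- a) ^ length is * ?f (a *\<^sub>R (x - y))) y =
      (- a) ^ length is * frechet_derivative ?f (at (a *\<^sub>R (x - y))) (- a *\<^sub>R axis i 1)" for y
  proof -
    have "((\<lambda>y. a *\<^sub>R (x - y)) has_derivative (\<lambda>v. - a *\<^sub>R v)) (at y)"
      by (auto intro!: derivative_eq_intros)
    from fun_cong[OF frechet_derivative_at[OF has_derivative_mult_right[OF
          has_derivative_compose[OF this d], of "(- a) ^ length is"]], of "axis i 1"]
    show ?thesis unfolding partial_deriv_def by simp
  qed
  moreover have "frechet_derivative ?f (at z) (- a *\<^sub>R v) = - a * frechet_derivative ?f (at z) v" for z v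
    using linear_scale[OF has_derivative_linear[OF d], of z "- a" v] by simp
  ultimately have "partial_deriv i (\<lambda>y. (- a) ^ length is * ?f (a *\<^sub>R (x - y))) =
      (\<lambda>y. (- a) ^ Suc (length is) * partial_deriv i ?f (a *\<^sub>R (x - y)))"
    by (simp add: partial_deriv_def mult_ac fun_eq_iff)
  moreover have "iterated_partial (i # is) h = partial_deriv i (iterated_partial is h)" for h :: "real ^ 'a \<Rightarrow> real"
    by (simp add: iterated_partial_def)
  ultimately show ?case using Cons by simp
qed (simp add: iterated_partial_def)

section \<open>Weak convergence of mollifications\<close>

text \<open>Convolution of \<open>f\<close> with the kernel \<open>\<kappa>\<close> at scale \<open>\<epsilon>\<close>, evaluated at \<open>x\<close>, is the pairing
  of \<open>f\<close> with \<open>rescale \<kappa> \<epsilon> x\<close>, up to the normalizing factor \<open>\<epsilon> ^ (- n)\<close>.\<close>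

abbreviation rescale :: "('a::euclidean_space \<Rightarrow> real) \<Rightarrow> real \<Rightarrow> 'a \<Rightarrow> 'a \<Rightarrow> real" where
  "rescale \<kappa> \<epsilon> x y \<equiv> \<kappa> ((1 / \<epsilon>) *\<^sub>R (x - y))"

abbreviation pairing :: "(real ^ 'n) set \<Rightarrow> (real ^ 'n \<Rightarrow> real) \<Rightarrow> (real ^ 'n \<Rightarrow> real) \<Rightarrow> real" where
  "pairing \<Omega> f \<tau> \<equiv> (\<integral>y. f y * \<tau> y \<partial>lebesgue_on \<Omega>)"

lemma integral_lborel_affine:
  fixes f :: "'a::euclidean_space \<Rightarrow> real"
  assumes "f \<in> borel_measurable borel" "c \<noteq> 0"
  shows "(\<integral>x. f x \<partial>lborel) = \<bar>c\<bar> ^ DIM('a) * (\<integral>x. f (t + c *\<^sub>R x) \<partial>lborel)"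
  using assms by (subst lborel_affine[of c t]) (auto simp: integral_density integral_distr)

text \<open>The sets over which \<open>H\<close> has integral zero form a Dynkin system, and the open boxes
  are an intersection-stable generator of the Borel sets. That the integral over the whole space vanishes, as needed for
  complements, follows by exhausting the space with boxes.\<close>

lemma AE_zero_if_box_integrals_zero:
  fixes H :: "'a::euclidean_space \<Rightarrow> real"
  assumes H: "integrable lborel H"
    and z: "\<And>c d. (\<integral>x. indicator (box c d) x * H x \<partial>lborel) = 0"
  shows "AE x in lborel. H x = 0"
proof -
  have [measurable]: "H \<in> borel_measurable borel" using H by (simp add: borel_measurable_integrable)
  have int: "integrable lborel (\<lambda>x. indicator A x * H x)" if [measurable]: "A \<in> sets borel" for A
    using integrable_mult_indicator[of A lborel H] H by simp
  have all: "(\<integral>x. H x \<partial>lborel) = 0"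
  proof (rule LIMSEQ_unique)
    show "(\<lambda>k. \<integral>x. indicator (box (- (real k *\<^sub>R One)) (real k *\<^sub>R One)) x * H x \<partial>lborel) \<longlonglongrightarrow> (\<integral>x. H x \<partial>lborel)"
    proof (rule integral_dominated_convergence[where w = "\<lambda>x. \<bar>H x\<bar>"])
      show "AE x in lborel. (\<lambda>k. indicator (box (- (real k *\<^sub>R One)) (real k *\<^sub>R One)) x * H x) \<longlonglongrightarrow> H x"
      proof (rule AE_I2)
        fix x :: 'a
        obtain k0 :: nat where "x \<in> box (- (real k0 *\<^sub>R One)) (real k0 *\<^sub>R One)"
          using UN_box_eq_UNIV by blast
        then have "x \<in> box (- (real k *\<^sub>R One)) (real k *\<^sub>R One)" if "k \<ge> k0" for k
          using that by (force simp: box_def)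
        then show "(\<lambda>k. indicator (box (- (real k *\<^sub>R One)) (real k *\<^sub>R One)) x * H x) \<longlonglongrightarrow> H x"
          by (intro tendsto_eventually eventually_sequentiallyI[of k0]) auto
      qed
    qed (use H in \<open>auto simp: indicator_def\<close>)
  qed (simp add: z)
  have "(\<integral>x. indicator A x * H x \<partial>lborel) = 0" if "A \<in> sets borel" for A
  proof -
    let ?E = "range (\<lambda>(a, b). box a b :: 'a set)"
    have "Int_stable ?E" "?E \<subseteq> Pow UNIV" "A \<in> sigma_sets UNIV ?E"
      using that by (auto simp: borel_eq_box Int_stable_def box_Int_box)
    then show ?thesis
    proof (induction rule: sigma_sets_induct_disjoint)
      case (basic A) then show ?case using z by auto
    next
      case empty then show ?case by simp
    next
      case (compl A)
      have [measurable]: "A \<in> sets borel" using compl(1) by (simp add: borel_eq_box)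
      have "(\<integral>x. indicator (UNIV - A) x * H x \<partial>lborel) = (\<integral>x. H x - indicator A x * H x \<partial>lborel)"
        by (intro Bochner_Integration.integral_cong) (auto simp: indicator_def)
      also have "\<dots> = 0" using H int[of A] all compl by simp
      finally show ?case .
    next
      case (union A)
      have [measurable]: "A i \<in> sets borel" for i using union(2) by (auto simp: borel_eq_box)
      have "(LINT x:(\<Union>i. A i)|lborel. H x) = (\<Sum>i. (LINT x:(A i)|lborel. H x))"
        using union(1) int[of "\<Union>i. A i"]
        by (intro lebesgue_integral_countable_add) (auto simp: set_integrable_def disjoint_family_on_def)
      then show ?case using union(3) by (simp add: set_lebesgue_integral_def)
    qed
  qed
  then have "AE x in lborel. H x = (\<lambda>_. 0) x"
    using H by (intro density_unique_real) (auto simp: set_lebesgue_integral_def)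
  then show ?thesis by simp
qed

text \<open>By Fubini the mollification can be moved from \<open>g\<close> to the indicator function of
  the box. The mollified indicator functions are bounded and converge to the indicator function off the boundary of the box,
  which is a null set; so dominated convergence applies.\<close>

lemma mollified_box_integral_tendsto:
  fixes g \<eta> :: "'a::euclidean_space \<Rightarrow> real"
  assumes g: "integrable lborel g"
    and \<eta>: "continuous_on UNIV \<eta>" "integrable lborel \<eta>" "(\<integral>x. \<eta> x \<partial>lborel) = 1"
    and T: "\<And>x. \<bar>\<eta> x\<bar> \<le> T"
    and \<epsilon>: "\<And>j. \<epsilon> j > 0" "\<epsilon> \<longlonglongrightarrow> 0"
  shows "(\<lambda>j::nat. \<integral>x. indicator (box c d) x * ((1 / \<epsilon> j) ^ DIM('a) *
       (\<integral>y. g y * rescale \<eta> (\<epsilon> j) x y \<partial>lborel)) \<partial>lborel)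
    \<longlonglongrightarrow> (\<integral>x. indicator (box c d) x * g x \<partial>lborel)"
proof -
  have [measurable]: "\<eta> \<in> borel_measurable borel" using \<eta>(1) by (rule borel_measurable_continuous_onI)
  have [measurable]: "g \<in> borel_measurable borel" using g by (simp add: borel_measurable_integrable)
  define m where "m j y = (\<integral>z. indicator (box c d) (y + \<epsilon> j *\<^sub>R z) * \<eta> z \<partial>lborel)" for j y
  have m_meas [measurable]: "m j \<in> borel_measurable borel" for j
    unfolding m_def by measurable
  have bi: "integrable lborel (indicator (box c d) :: 'a \<Rightarrow> real)"
    by (rule integrable_real_indicator[OF _ emeasure_lborel_box_finite]) simp
  have T0: "T \<ge> 0" using T[of 0] by (rule order_trans[OF abs_ge_zero])
  have eq: "(\<integral>x. indicator (box c d) x * ((1 / \<epsilon> j) ^ DIM('a) *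
       (\<integral>y. g y * rescale \<eta> (\<epsilon> j) x y \<partial>lborel)) \<partial>lborel) = (\<integral>y. g y * m j y \<partial>lborel)" for j
  proof -
    let ?G = "\<lambda>x y. indicator (box c d) x * ((1 / \<epsilon> j) ^ DIM('a) * (g y * rescale \<eta> (\<epsilon> j) x y)) :: real"
    have dom: "integrable (lborel \<Otimes>\<^sub>M lborel) (\<lambda>(x, y). ((1 / \<epsilon> j) ^ DIM('a) * T * indicator (box c d) x) * g y)"
    proof (rule lborel_pair.Fubini_integrable)
      show "integrable lborel (\<lambda>x. \<integral>y. norm (case (x, y) of (x, y) \<Rightarrow>
          ((1 / \<epsilon> j) ^ DIM('a) * T * indicator (box c d) x) * g y) \<partial>lborel)"
        using bi by (simp add: abs_mult)
    qed (use g in auto)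
    have "integrable (lborel \<Otimes>\<^sub>M lborel) (\<lambda>(x, y). ?G x y)"
    proof (rule Bochner_Integration.integrable_bound[OF dom])
      show "AE z in lborel \<Otimes>\<^sub>M lborel. norm (case z of (x, y) \<Rightarrow> ?G x y)
          \<le> norm (case z of (x, y) \<Rightarrow> ((1 / \<epsilon> j) ^ DIM('a) * T * indicator (box c d) x) * g y)"
      proof (rule AE_I2, clarify)
        fix x y :: 'a
        have "\<bar>rescale \<eta> (\<epsilon> j) x y\<bar> * \<bar>g y\<bar> \<le> T * \<bar>g y\<bar>" by (intro mult_right_mono T) auto
        from mult_left_mono[OF this, of "(1 / \<epsilon> j) ^ DIM('a) * indicator (box c d) x"]
        show "norm (?G x y) \<le> norm (((1 / \<epsilon> j) ^ DIM('a) * T * indicator (box c d) x) * g y)"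
          using T0 \<epsilon>(1)[of j] by (simp add: abs_mult mult_ac)
      qed
    qed measurable
    then have "(\<integral>x. (\<integral>y. ?G x y \<partial>lborel) \<partial>lborel) = (\<integral>y. (\<integral>x. ?G x y \<partial>lborel) \<partial>lborel)"
      by (rule lborel_pair.Fubini_integral[symmetric])
    moreover have "(\<integral>x. ?G x y \<partial>lborel) = g y * m j y" for y
    proof -
      have "(\<integral>x. ?G x y \<partial>lborel) = \<bar>\<epsilon> j\<bar> ^ DIM('a) * (\<integral>z. ?G (y + \<epsilon> j *\<^sub>R z) y \<partial>lborel)"
        by (rule integral_lborel_affine) (use \<epsilon>(1)[of j] in auto)
      also have "(\<integral>z. ?G (y + \<epsilon> j *\<^sub>R z) y \<partial>lborel) =
          (\<integral>z. ((1 / \<epsilon> j) ^ DIM('a) * g y) * (indicator (box c d) (y + \<epsilon> j *\<^sub>R z) * \<eta> z) \<partial>lborel)"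
        using \<epsilon>(1)[of j] by (intro Bochner_Integration.integral_cong) auto
      also have "\<dots> = (1 / \<epsilon> j) ^ DIM('a) * g y * m j y" unfolding m_def by simp
      finally show ?thesis using \<epsilon>(1)[of j] by (simp add: power_one_over)
    qed
    ultimately show ?thesis by simp
  qed
  have lim: "(\<lambda>j. m j y) \<longlonglongrightarrow> indicator (box c d) y" if "y \<notin> frontier (box c d)" for y
  proof -
    have "(\<lambda>j. \<integral>z. indicator (box c d) (y + \<epsilon> j *\<^sub>R z) * \<eta> z \<partial>lborel) \<longlonglongrightarrow>
        (\<integral>z. indicator (box c d) y * \<eta> z \<partial>lborel)"
    proof (rule integral_dominated_convergence[where w = "\<lambda>z. \<bar>\<eta> z\<bar>"])
      show "AE z in lborel. (\<lambda>j. indicator (box c d) (y + \<epsilon> j *\<^sub>R z) * \<eta> z)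
          \<longlonglongrightarrow> indicator (box c d) y * \<eta> z"
      proof (rule AE_I2)
        fix z :: 'a
        have t: "(\<lambda>j. y + \<epsilon> j *\<^sub>R z) \<longlonglongrightarrow> y"
          using tendsto_add[OF tendsto_const tendsto_scaleR[OF \<epsilon>(2) tendsto_const[of z]], of y] by simp
        have "\<forall>\<^sub>F j in sequentially. indicator (box c d) (y + \<epsilon> j *\<^sub>R z) = (indicator (box c d) y :: real)"
        proof (cases "y \<in> box c d")
          case True
          then show ?thesis using topological_tendstoD[OF t open_box True] by (auto elim: eventually_mono)
        next
          case False
          then have "y \<in> - closure (box c d)" using that by (auto simp: frontier_def interior_open[OF open_box])
          then have "\<forall>\<^sub>F j in sequentially. y + \<epsilon> j *\<^sub>R z \<in> - closure (box c d)"
            using topological_tendstoD[OF t, of "- closure (box c d)"] by auto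
          then show ?thesis
            by (rule eventually_mono) (use False closure_subset in \<open>auto simp: indicator_def\<close>)
        qed
        then show "(\<lambda>j. indicator (box c d) (y + \<epsilon> j *\<^sub>R z) * \<eta> z) \<longlonglongrightarrow> indicator (box c d) y * \<eta> z"
          by (intro tendsto_eventually) (auto elim: eventually_mono)
      qed
    qed (use \<eta>(2) in \<open>auto simp: indicator_def\<close>)
    then show ?thesis unfolding m_def using \<eta>(3) by simp
  qed
  define I where "I = (\<integral>z. \<bar>\<eta> z\<bar> \<partial>lborel)"
  have m_bound: "\<bar>m j y\<bar> \<le> I" for j y
  proof -
    have "\<bar>m j y\<bar> \<le> (\<integral>z. \<bar>indicator (box c d) (y + \<epsilon> j *\<^sub>R z) * \<eta> z\<bar> \<partial>lborel)"
      unfolding m_def by (rule integral_abs_bound)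
    also have "\<dots> \<le> I" unfolding I_def
      by (rule integral_mono') (use \<eta>(2) in \<open>auto simp: indicator_def\<close>)
    finally show ?thesis .
  qed
  have "(\<lambda>j. \<integral>y. g y * m j y \<partial>lborel) \<longlonglongrightarrow> (\<integral>y. g y * indicator (box c d) y \<partial>lborel)"
  proof (rule integral_dominated_convergence[where w = "\<lambda>y. \<bar>g y\<bar> * I"])
    have "frontier (box c d) \<in> null_sets lborel"
      using negligible_convex_frontier[OF convex_box(2)[of c d]]
      by (simp add: negligible_iff_null_sets null_sets_completion_iff)
    then have "AE y in lborel. y \<notin> frontier (box c d)" by (rule AE_not_in)
    then show "AE y in lborel. (\<lambda>j. g y * m j y) \<longlonglongrightarrow> g y * indicator (box c d) y"
      by (rule eventually_mono) (intro tendsto_mult lim tendsto_const)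
    show "AE y in lborel. norm (g y * m j y) \<le> \<bar>g y\<bar> * I" for j
      using m_bound by (auto simp: abs_mult intro!: mult_left_mono)
  qed (use g in auto)
  then show ?thesis unfolding eq by (simp add: mult.commute)
qed

section \<open>Pairings with functions of small support\<close>

lemma ident_measurable_lebesgue_on: "(\<lambda>x. x) \<in> lebesgue_on S \<rightarrow>\<^sub>M borel"
  by (intro measurable_restrict_space1 measurable_completion) simp

lemma sigma_finite_lebesgue_on:
  assumes "S \<in> sets lebesgue"
  shows "sigma_finite_measure (lebesgue_on S :: 'a::euclidean_space measure)"
proof (rule sigma_finite_measure_restrict_space[OF _ assms])
  obtain A :: "'a set set" where A: "countable A" "A \<subseteq> sets lborel" "\<Union>A = space lborel" "\<forall>a\<in>A. emeasure lborel a \<noteq> \<infinity>"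
    using lborel.sigma_finite_countable by blast
  then show "sigma_finite_measure (lebesgue :: 'a measure)"
    by (intro sigma_finite_measure.intro exI[of _ A]) (auto simp: subset_iff emeasure_completion)
qed

lemma locally_integrable_borel_measurable:
  assumes "open \<Omega>" "locally_integrable \<Omega> h"
  shows "h \<in> borel_measurable (lebesgue_on \<Omega>)"
proof -
  obtain C :: "nat \<Rightarrow> (real ^ 'a) set" where C: "\<And>n. compact (C n)" "\<And>n. C n \<subseteq> \<Omega>" "\<Union>(range C) = \<Omega>"
    "\<And>K. compact K \<Longrightarrow> K \<subseteq> \<Omega> \<Longrightarrow> \<exists>N. \<forall>n\<ge>N. K \<subseteq> C n"
    by (rule open_Union_compact_subsets[OF assms(1)]) blast
  have "(\<lambda>x. indicator \<Omega> x *\<^sub>R h x) \<in> borel_measurable lebesgue"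
  proof (rule borel_measurable_LIMSEQ_real)
    show "(\<lambda>x. indicator (C n) x *\<^sub>R h x) \<in> borel_measurable lebesgue" for n
    proof -
      have "set_integrable lebesgue (C n) h"
        by (rule assms(2)[unfolded locally_integrable_def, rule_format]) (simp add: C(1,2))
      then show ?thesis unfolding set_integrable_def by (rule borel_measurable_integrable)
    qed
    show "(\<lambda>n. indicator (C n) x *\<^sub>R h x) \<longlonglongrightarrow> indicator \<Omega> x *\<^sub>R h x" for x
    proof (rule tendsto_eventually)
      show "\<forall>\<^sub>F n in sequentially. indicator (C n) x *\<^sub>R h x = indicator \<Omega> x *\<^sub>R h x"
      proof (cases "x \<in> \<Omega>")
        case True
        then obtain N where "\<And>n. n \<ge> N \<Longrightarrow> x \<in> C n" using C(4)[of "{x}"] by auto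
        then show ?thesis using True by (intro eventually_sequentiallyI[of N]) simp
      next
        case False
        then have "x \<notin> C n" for n using C(2) by auto
        then show ?thesis using False by simp
      qed
    qed
  qed
  then show ?thesis using assms(1) by (subst borel_measurable_restrict_space_iff) (auto simp: mult.commute)
qed

lemma locally_integrable_pairing:
  fixes f \<tau> :: "real ^ 'n \<Rightarrow> real"
  assumes "open \<Omega>" "locally_integrable \<Omega> f" "compact K" "K \<subseteq> \<Omega>"
    and \<tau>: "continuous_on UNIV \<tau>" "\<And>y. y \<notin> K \<Longrightarrow> \<tau> y = 0"
  shows integrable_on_compact: "integrable lebesgue (\<lambda>y. indicator K y * f y)"
    and integrable_pairing: "integrable (lebesgue_on \<Omega>) (\<lambda>y. f y * \<tau> y)"
    and integral_pairing_eq: "pairing \<Omega> f \<tau> = (\<integral>y. (indicator K y * f y) * \<tau> y \<partial>lebesgue)"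
proof -
  show 1: "integrable lebesgue (\<lambda>y. indicator K y * f y)"
    using assms unfolding locally_integrable_def set_integrable_def by simp
  have "bounded (\<tau> ` K)" using \<tau>(1) \<open>compact K\<close> by (meson compact_continuous_image compact_imp_bounded continuous_on_subset subset_UNIV)
  then obtain B where B: "\<And>y. y \<in> K \<Longrightarrow> \<bar>\<tau> y\<bar> \<le> B" by (auto simp: bounded_iff)
  have [measurable]: "\<tau> \<in> borel_measurable lebesgue"
    using borel_measurable_continuous_onI[OF \<tau>(1)] by (simp add: measurable_completion)
  have 2: "integrable lebesgue (\<lambda>y. (indicator K y * f y) * \<tau> y)"
  proof (rule Bochner_Integration.integrable_bound)
    show "integrable lebesgue (\<lambda>y. B * (indicator K y * f y))" using 1 by simp
    show "(\<lambda>y. (indicator K y * f y) * \<tau> y) \<in> borel_measurable lebesgue" using 1 by measurable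
    have "\<bar>\<tau> y\<bar> * \<bar>f y\<bar> \<le> \<bar>B\<bar> * \<bar>f y\<bar>" if "y \<in> K" for y
      using B[OF that] by (intro mult_right_mono) auto
    then show "AE y in lebesgue. norm (indicator K y * f y * \<tau> y) \<le> norm (B * (indicator K y * f y))"
      by (auto simp: indicator_def abs_mult mult.commute)
  qed
  have eq: "indicator \<Omega> y *\<^sub>R (f y * \<tau> y) = indicator K y * f y * \<tau> y" for y
    using \<tau>(2)[of y] \<open>K \<subseteq> \<Omega>\<close> by (auto simp: indicator_def)
  show "integrable (lebesgue_on \<Omega>) (\<lambda>y. f y * \<tau> y)"
    using 2 \<open>open \<Omega>\<close> by (subst integrable_restrict_space) (auto simp: eq simp del: real_scaleR_def)
  show "pairing \<Omega> f \<tau> = (\<integral>y. (indicator K y * f y) * \<tau> y \<partial>lebesgue)"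
    using \<open>open \<Omega>\<close> by (subst integral_restrict_space) (auto simp: eq simp del: real_scaleR_def)
qed

text \<open>With a parameter \<open>\<mu>\<close> still to be chosen this takes the place of Hoelder's inequality: integrated over a
  set of measure \<open>m\<close>, it bounds the \<open>L\<^sup>1\<close> norm by \<open>\<mu> * m\<close> plus a multiple of the \<open>p\<close>-th power of
  the \<open>L\<^sup>p\<close> norm, and the optimal \<open>\<mu>\<close> gives Hoelder up to a factor \<open>2\<close>.\<close>

lemma le_powr_split:
  fixes t :: real
  assumes "t \<ge> 0" "\<mu> > 0" "1 \<le> p"
  shows "t \<le> \<mu> + \<mu> powr (1 - p) * t powr p"
proof (cases "t \<le> \<mu>")
  case True then show ?thesis by (simp add: add_increasing2)
next
  case False
  then have "t = t powr (1 - p) * t powr p" using assms by (simp flip: powr_add)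
  also have "\<dots> \<le> \<mu> powr (1 - p) * t powr p"
    using False assms by (intro mult_right_mono powr_mono2') auto
  finally show ?thesis using assms by simp
qed

text \<open>Stated in \<^typ>\<open>ennreal\<close>, because it will be integrated with respect to a parameter on which \<open>f\<close>
  depends and for exceptional values of which the right-hand side is infinite.\<close>

lemma pairing_bound:
  fixes f \<tau> :: "real ^ 'n \<Rightarrow> real"
  assumes "open \<Omega>" "locally_integrable \<Omega> f" "compact K" "K \<subseteq> \<Omega>"
    and \<tau>: "continuous_on UNIV \<tau>" "\<And>y. y \<notin> K \<Longrightarrow> \<tau> y = 0" "\<And>y. \<bar>\<tau> y\<bar> \<le> T"
    and p: "1 < p" and \<mu>: "\<mu> > 0"
  shows "ennreal \<bar>pairing \<Omega> f \<tau>\<bar> \<le>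
    ennreal (T * \<mu>) * emeasure lebesgue K +
    ennreal (T * \<mu> powr (1 - p)) * (\<integral>\<^sup>+y. ennreal (\<bar>f y\<bar> powr p) * indicator K y \<partial>lebesgue)"
proof -
  note i = locally_integrable_pairing[OF assms(1-6)]
  have T: "T \<ge> 0" using \<tau>(3)[of 0] by (rule order_trans[OF abs_ge_zero])
  have [measurable]: "(\<lambda>y. indicator K y * f y) \<in> borel_measurable lebesgue" 
    using i(1) by (rule borel_measurable_integrable)
  have [measurable]: "K \<in> sets lebesgue" using \<open>compact K\<close> by (simp add: lmeasurable_compact fmeasurableD)
  have "ennreal \<bar>\<integral>y. indicator K y * f y * \<tau> y \<partial>lebesgue\<bar> \<le> (\<integral>\<^sup>+y. ennreal \<bar>indicator K y * f y * \<tau> y\<bar> \<partial>lebesgue)"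
    using integral_norm_bound_ennreal[of lebesgue "\<lambda>y. indicator K y * f y * \<tau> y"]
    by (cases "integrable lebesgue (\<lambda>y. indicator K y * f y * \<tau> y)") (auto simp: not_integrable_integral_eq)
  also have "\<dots> \<le> (\<integral>\<^sup>+y. ennreal (T * \<mu>) * indicator K y +
      ennreal (T * \<mu> powr (1 - p)) * ennreal (\<bar>indicator K y * f y\<bar> powr p) \<partial>lebesgue)"
  proof (rule nn_integral_mono)
    fix y
    have "\<bar>f y * \<tau> y\<bar> \<le> T * \<mu> + T * \<mu> powr (1 - p) * \<bar>f y\<bar> powr p"
    proof -
      have "\<bar>f y * \<tau> y\<bar> \<le> \<bar>f y\<bar> * T" unfolding abs_mult by (rule mult_left_mono[OF \<tau>(3)]) simp
      also have "\<dots> \<le> (\<mu> + \<mu> powr (1 - p) * \<bar>f y\<bar> powr p) * T"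
        using le_powr_split[of "\<bar>f y\<bar>" \<mu> p] p \<mu> by (intro mult_right_mono T) auto
      finally show ?thesis by (simp add: algebra_simps)
    qed
    then show "ennreal \<bar>indicator K y * f y * \<tau> y\<bar> \<le> ennreal (T * \<mu>) * indicator K y +
      ennreal (T * \<mu> powr (1 - p)) * ennreal (\<bar>indicator K y * f y\<bar> powr p)"
      using T \<mu> by (auto simp: indicator_def ennreal_mult[symmetric] ennreal_plus[symmetric] simp del: ennreal_plus)
  qed
  also have "\<dots> = ennreal (T * \<mu>) * emeasure lebesgue K +
    ennreal (T * \<mu> powr (1 - p)) * (\<integral>\<^sup>+y. ennreal (\<bar>indicator K y * f y\<bar> powr p) \<partial>lebesgue)"
    by (simp add: nn_integral_add nn_integral_cmult)
  also have "(\<integral>\<^sup>+y. ennreal (\<bar>indicator K y * f y\<bar> powr p) \<partial>lebesgue) =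
      (\<integral>\<^sup>+y. ennreal (\<bar>f y\<bar> powr p) * indicator K y \<partial>lebesgue)"
    by (rule nn_integral_cong) (auto simp: indicator_def)
  finally show ?thesis using i(3) by simp
qed

lemma ennreal_powr_le:
  assumes "ennreal_powr a (1 / p) \<le> ennreal N" "N \<ge> 0" "p > 0"
  shows "a \<le> ennreal (N powr p)"
proof -
  have fin: "a \<noteq> \<infinity>" using assms by (auto simp: ennreal_powr_def top_unique)
  then have "enn2real a powr (1 / p) \<le> N" using assms by (simp add: ennreal_powr_def)
  then have "(enn2real a powr (1 / p)) powr p \<le> N powr p" using assms by (intro powr_mono2) auto
  then have "enn2real a \<le> N powr p" using assms by (simp add: powr_powr)
  then show ?thesis using fin by (metis ennreal_enn2real ennreal_leI infinity_ennreal_def less_top)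
qed

lemma emeasure_lebesgue_cball:
  "r \<ge> 0 \<Longrightarrow> emeasure lebesgue (cball c r :: (real ^ 'n) set) = ennreal (unit_ball_vol CARD('n) * r ^ CARD('n))"
  using emeasure_cball[of r c] by simp

text \<open>Hoelder's inequality on a ball of radius proportional to \<open>\<epsilon>\<close>, whose measure to the power \<open>1 - 1/p\<close>
  gives the power of \<open>\<epsilon>\<close>.\<close>

lemma Lp_pairing_bound:
  fixes h \<tau> :: "real ^ 'n \<Rightarrow> real"
  assumes "open \<Omega>" "locally_integrable \<Omega> h" "cball x (R * \<epsilon>) \<subseteq> \<Omega>"
    and \<tau>: "continuous_on UNIV \<tau>" "\<And>y. y \<notin> cball x (R * \<epsilon>) \<Longrightarrow> \<tau> y = 0" "\<And>y. \<bar>\<tau> y\<bar> \<le> T"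
    and p: "1 < p" and N: "N > 0" "Lp_norm p \<Omega> h \<le> ennreal N" and \<epsilon>: "\<epsilon> > 0" and R: "R > 0"
  shows "\<bar>pairing \<Omega> h \<tau>\<bar> \<le>
    T * (unit_ball_vol CARD('n) * R ^ CARD('n) + 1) * N * \<epsilon> powr (CARD('n) - CARD('n) / p)"
proof -
  let ?n = "real CARD('n)" and ?V = "unit_ball_vol CARD('n)" and ?K = "cball x (R * \<epsilon>)"
  \<comment> \<open>This choice makes both terms of \<open>pairing_bound\<close> of the same order in \<open>\<epsilon>\<close>.\<close>
  define \<mu> where "\<mu> = N * \<epsilon> powr (- ?n / p)"
  have \<mu>: "\<mu> > 0" using N \<epsilon> by (simp add: \<mu>_def)
  have T: "T \<ge> 0" using \<tau>(3)[of 0] by (rule order_trans[OF abs_ge_zero])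
  have "(\<integral>\<^sup>+y. ennreal (\<bar>h y\<bar> powr p) * indicator ?K y \<partial>lebesgue) \<le>
      (\<integral>\<^sup>+y. ennreal (\<bar>h y\<bar> powr p) * indicator \<Omega> y \<partial>lebesgue)"
    using assms(3) by (intro nn_integral_mono) (auto simp: indicator_def)
  also have "\<dots> = (\<integral>\<^sup>+y. ennreal (\<bar>h y\<bar> powr p) \<partial>lebesgue_on \<Omega>)"
    using assms(1) by (subst nn_integral_restrict_space) auto
  also have "\<dots> \<le> ennreal (N powr p)"
    using N p by (intro ennreal_powr_le) (auto simp: Lp_norm_def)
  finally have I: "(\<integral>\<^sup>+y. ennreal (\<bar>h y\<bar> powr p) * indicator ?K y \<partial>lebesgue) \<le> ennreal (N powr p)" .
  have "ennreal \<bar>pairing \<Omega> h \<tau>\<bar> \<le>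
    ennreal (T * \<mu>) * emeasure lebesgue ?K +
    ennreal (T * \<mu> powr (1 - p)) * (\<integral>\<^sup>+y. ennreal (\<bar>h y\<bar> powr p) * indicator ?K y \<partial>lebesgue)"
    by (rule pairing_bound[OF assms(1,2) _ assms(3) \<tau> p \<mu>]) simp
  also have "\<dots> \<le> ennreal (T * \<mu>) * ennreal (?V * (R * \<epsilon>) ^ CARD('n)) + ennreal (T * \<mu> powr (1 - p)) * ennreal (N powr p)"
    using I R \<epsilon> by (intro add_mono mult_left_mono) (simp_all only: emeasure_lebesgue_cball zero_le mult_nonneg_nonneg less_imp_le)
  also have "\<dots> = ennreal (T * \<mu> * (?V * (R * \<epsilon>) ^ CARD('n)) + T * \<mu> powr (1 - p) * N powr p)"
    using T \<mu> R \<epsilon> by (simp add: ennreal_mult)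
  finally have "\<bar>pairing \<Omega> h \<tau>\<bar> \<le> T * \<mu> * (?V * (R * \<epsilon>) ^ CARD('n)) + T * \<mu> powr (1 - p) * N powr p"
    using T \<mu> R \<epsilon> by (subst (asm) ennreal_le_iff) auto
  also have "\<dots> = T * (\<mu> * (?V * (R * \<epsilon>) ^ CARD('n))) + T * (\<mu> powr (1 - p) * N powr p)"
    by (simp add: algebra_simps)
  also have "\<mu> * (?V * (R * \<epsilon>) ^ CARD('n)) = ?V * R ^ CARD('n) * N * \<epsilon> powr (?n - ?n / p)"
    using \<epsilon> by (simp add: \<mu>_def power_mult_distrib powr_diff powr_minus powr_realpow field_simps)
  also have "\<mu> powr (1 - p) * N powr p = N * \<epsilon> powr (?n - ?n / p)"
  proof -
    have "\<mu> powr (1 - p) = N powr (1 - p) * \<epsilon> powr ((- ?n / p) * (1 - p))"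
      using N \<epsilon> by (simp add: \<mu>_def powr_mult powr_powr)
    moreover have "(- ?n / p) * (1 - p) = ?n - ?n / p" using p by (simp add: field_simps)
    moreover have "N powr (1 - p) * N powr p = N" using N by (simp flip: powr_add)
    ultimately show ?thesis by (simp add: mult_ac)
  qed
  finally show ?thesis by (simp add: algebra_simps)
qed

lemma locally_integrable_diff_const:
  assumes "locally_integrable \<Omega> h" shows "locally_integrable \<Omega> (\<lambda>y. h y - c)"
  unfolding locally_integrable_def
proof (intro allI impI)
  fix K assume K: "compact K \<and> K \<subseteq> \<Omega>"
  have "(\<lambda>_. c) absolutely_integrable_on K"
    using K by (auto intro!: absolutely_integrable_continuous continuous_on_const
      simp: lmeasurable_compact absolutely_integrable_on_const)
  then show "(\<lambda>y. h y - c) absolutely_integrable_on K"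
    using K assms unfolding locally_integrable_def by (intro set_integral_diff(1)) auto
qed

text \<open>The inner integral of the double integral in \<^const>\<open>slobodeckij_seminorm\<close>, without the weight.\<close>

abbreviation energy :: "real \<Rightarrow> (real ^ 'n \<Rightarrow> real) \<Rightarrow> (real ^ 'n) set \<Rightarrow> real ^ 'n \<Rightarrow> ennreal" where
  "energy p h K z \<equiv> (\<integral>\<^sup>+y. ennreal (\<bar>h y - h z\<bar> powr p) * indicator K y \<partial>lebesgue)"

text \<open>On a ball of radius \<open>r\<close> the weight \<open>norm (x - y)\<close> is at most \<open>2 * r\<close>, so that it
  can be removed at the cost of a power of \<open>r\<close>. On the diagonal the quotient in the seminorm is \<open>0\<close>, but so is the
  numerator.\<close>

lemma slobodeckij_double_integral:
  fixes h :: "real ^ 'n \<Rightarrow> real" and p \<theta> N r :: real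
  assumes "open \<Omega>" "locally_integrable \<Omega> h" "cball x r \<subseteq> \<Omega>" "r > 0"
    and p: "1 < p" and \<theta>: "\<theta> > 0" and N: "N > 0" "slobodeckij_seminorm \<theta> p \<Omega> h \<le> ennreal N"
  shows "(\<lambda>z. energy p h (cball x r) z * indicator (cball x r) z)
      \<in> borel_measurable lebesgue" (is ?meas)
    and "(\<integral>\<^sup>+z. energy p h (cball x r) z * indicator (cball x r) z \<partial>lebesgue)
    \<le> ennreal ((2 * r) powr (CARD('n) + \<theta> * p) * N powr p)" (is ?bound)
proof -
  let ?e = "real CARD('n) + \<theta> * p" and ?K = "cball x r" and ?L = "lebesgue_on \<Omega>"
  let ?q = "\<lambda>z y. ennreal (\<bar>h z - h y\<bar> powr p / norm (z - y) powr ?e)"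
  have S: "\<Omega> \<in> sets lebesgue" using assms(1) by simp
  interpret L: sigma_finite_measure ?L using S by (rule sigma_finite_lebesgue_on)
  have [measurable]: "h \<in> borel_measurable ?L" by (rule locally_integrable_borel_measurable[OF assms(1,2)])
  have [measurable]: "fst \<in> ?L \<Otimes>\<^sub>M ?L \<rightarrow>\<^sub>M borel" "snd \<in> ?L \<Otimes>\<^sub>M ?L \<rightarrow>\<^sub>M borel"
    using measurable_compose[OF measurable_fst ident_measurable_lebesgue_on]
      measurable_compose[OF measurable_snd ident_measurable_lebesgue_on] by auto
  have q: "(\<lambda>(z, y). ?q z y) \<in> borel_measurable (?L \<Otimes>\<^sub>M ?L)"
    unfolding split_beta' by measurable
  have "(\<integral>\<^sup>+z. (\<integral>\<^sup>+y. ?q z y \<partial>?L) \<partial>?L) = (\<integral>\<^sup>+(z, y). ?q z y \<partial>(?L \<Otimes>\<^sub>M ?L))"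
    using L.nn_integral_fst[OF q] by simp
  also have "\<dots> \<le> ennreal (N powr p)"
    using N p by (intro ennreal_powr_le) (auto simp: slobodeckij_seminorm_def)
  finally have I: "(\<integral>\<^sup>+z. (\<integral>\<^sup>+y. ?q z y \<partial>?L) \<partial>?L) \<le> ennreal (N powr p)" .
  have restr: "(\<integral>\<^sup>+y. F y \<partial>?L) = (\<integral>\<^sup>+y. F y * indicator \<Omega> y \<partial>lebesgue)" for F :: "real ^ 'n \<Rightarrow> ennreal"
    using S by (subst nn_integral_restrict_space) auto
  have "(\<integral>\<^sup>+z. energy p h ?K z * indicator ?K z \<partial>lebesgue)
    \<le> (\<integral>\<^sup>+z. (ennreal ((2 * r) powr ?e) * (\<integral>\<^sup>+y. ?q z y \<partial>?L)) \<partial>?L)"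
    unfolding restr
  proof (intro nn_integral_mono)
    fix z
    show "energy p h ?K z * indicator ?K z \<le>
      ennreal ((2 * r) powr ?e) * (\<integral>\<^sup>+y. ?q z y * indicator \<Omega> y \<partial>lebesgue) * indicator \<Omega> z"
    proof (cases "z \<in> ?K")
      case True
      then have z: "z \<in> \<Omega>" using assms(3) by auto
      have "energy p h ?K z
        \<le> (\<integral>\<^sup>+y. ennreal ((2 * r) powr ?e) * (?q z y * indicator \<Omega> y) \<partial>lebesgue)"
      proof (rule nn_integral_mono)
        fix y
        show "ennreal (\<bar>h y - h z\<bar> powr p) * indicator ?K y \<le> ennreal ((2 * r) powr ?e) * (?q z y * indicator \<Omega> y)"
        proof (cases "y \<in> ?K")
          case True
          then have y: "y \<in> \<Omega>" using assms(3) by auto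
          have d: "norm (z - y) \<le> 2 * r"
            using True \<open>z \<in> ?K\<close> dist_triangle2[of z y x] by (simp add: dist_norm norm_minus_commute)
          have "\<bar>h y - h z\<bar> powr p \<le> (2 * r) powr ?e * (\<bar>h z - h y\<bar> powr p / norm (z - y) powr ?e)"
          proof (cases "z = y")
            case False
            have "norm (z - y) powr ?e \<le> (2 * r) powr ?e" using d \<theta> p by (intro powr_mono2) auto
            then have "\<bar>h z - h y\<bar> powr p * norm (z - y) powr ?e \<le> \<bar>h z - h y\<bar> powr p * (2 * r) powr ?e"
              by (intro mult_left_mono) auto
            then show ?thesis using False by (simp add: field_simps abs_minus_commute)
          qed simp
          then show ?thesis using True y
            by (simp add: ennreal_mult'[symmetric])
        qed simp
      qed
      also have "\<dots> = ennreal ((2 * r) powr ?e) * (\<integral>\<^sup>+y. ?q z y * indicator \<Omega> y \<partial>lebesgue)"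
      proof (rule nn_integral_cmult)
        have "(\<lambda>y. ?q z y) \<in> borel_measurable ?L"
          using measurable_Pair2[OF q, of z] z by (simp only: prod.case space_restrict_space space_completion space_lborel space_borel Int_UNIV_right simp_thms)
        then show "(\<lambda>y. ?q z y * indicator \<Omega> y) \<in> borel_measurable lebesgue"
          by (rule borel_measurable_restrict_space_iff_ennreal[THEN iffD1, rotated]) (use S in simp)
      qed
      finally show ?thesis using True z by simp
    qed simp
  qed
  also have "\<dots> = ennreal ((2 * r) powr ?e) * (\<integral>\<^sup>+z. (\<integral>\<^sup>+y. ?q z y \<partial>?L) \<partial>?L)"
    using L.borel_measurable_nn_integral_fst[OF q] by (intro nn_integral_cmult) simp
  also have "\<dots> \<le> ennreal ((2 * r) powr ?e) * ennreal (N powr p)" by (intro mult_left_mono I) simp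
  also have "\<dots> = ennreal ((2 * r) powr ?e * N powr p)" by (simp add: ennreal_mult)
  finally show ?bound .
  have [measurable]: "indicator ?K \<in> borel_measurable ?L" for x :: "real ^ 'n"
    by (rule borel_measurable_indicator) (use S assms(3) in \<open>auto simp: sets_restrict_space_iff\<close>)
  have "(\<lambda>(z, y). ennreal (\<bar>h y - h z\<bar> powr p) * indicator ?K y) \<in> borel_measurable (?L \<Otimes>\<^sub>M ?L)"
    unfolding split_beta' by measurable
  from L.borel_measurable_nn_integral_fst[OF this]
  have "(\<lambda>z. \<integral>\<^sup>+y. ennreal (\<bar>h y - h z\<bar> powr p) * indicator ?K y \<partial>?L) \<in> borel_measurable ?L" by simp
  then have "(\<lambda>z. (\<integral>\<^sup>+y. ennreal (\<bar>h y - h z\<bar> powr p) * indicator ?K y \<partial>?L) * indicator \<Omega> z) \<in> borel_measurable lebesgue"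
    by (rule borel_measurable_restrict_space_iff_ennreal[THEN iffD1, rotated]) (use S in simp)
  moreover have [measurable]: "?K \<in> sets lebesgue" by simp
  ultimately have "(\<lambda>z. (\<integral>\<^sup>+y. ennreal (\<bar>h y - h z\<bar> powr p) * indicator ?K y \<partial>?L) * indicator \<Omega> z * indicator ?K z) \<in> borel_measurable lebesgue"
    by measurable
  moreover have "(\<integral>\<^sup>+y. ennreal (\<bar>h y - h z\<bar> powr p) * indicator ?K y \<partial>?L) =
     energy p h ?K z" for z
    unfolding restr using assms(3) by (intro nn_integral_cong) (auto simp: indicator_def simp del: mem_cball)
  moreover have "indicator \<Omega> z * indicator ?K z = (indicator ?K z :: ennreal)" for z
    using assms(3) by (auto simp: indicator_def simp del: mem_cball)
  ultimately show ?meas by (simp add: mult.assoc)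
qed

text \<open>As \<open>\<tau>\<close> has mean zero, \<open>h\<close> may be replaced by \<open>h - h c\<close> for any point \<open>c\<close>
  without changing the pairing. The estimate of \<open>pairing_bound\<close> for \<open>h - h c\<close> is then averaged over all \<open>c\<close>
  in the ball, which turns its right-hand side into the double integral of the Slobodeckij seminorm. Compared with the
  \<open>L\<^sup>p\<close> bound this gains the factor \<open>\<epsilon> powr \<theta>\<close>.\<close>

lemma slobodeckij_pairing_bound:
  fixes h \<tau> :: "real ^ 'n \<Rightarrow> real" and p \<theta> N \<epsilon> R T :: real
  assumes "open \<Omega>" "locally_integrable \<Omega> h" "cball x (R * \<epsilon>) \<subseteq> \<Omega>"
    and \<tau>: "continuous_on UNIV \<tau>" "\<And>y. y \<notin> cball x (R * \<epsilon>) \<Longrightarrow> \<tau> y = 0" "\<And>y. \<bar>\<tau> y\<bar> \<le> T"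
    and z: "(\<integral>y. \<tau> y \<partial>lborel) = 0"
    and p: "1 < p" and \<theta>: "\<theta> > 0" and N: "N > 0" "slobodeckij_seminorm \<theta> p \<Omega> h \<le> ennreal N"
    and \<epsilon>: "\<epsilon> > 0" and R: "R > 0"
  shows "\<bar>pairing \<Omega> h \<tau>\<bar> \<le>
    T * (unit_ball_vol CARD('n) * R ^ CARD('n) + (2 * R) powr (CARD('n) + \<theta> * p) / (unit_ball_vol CARD('n) * R ^ CARD('n)))
      * N * \<epsilon> powr (CARD('n) + \<theta> - CARD('n) / p)"
proof -
  let ?n = "real CARD('n)" and ?V = "unit_ball_vol CARD('n)" and ?K = "cball x (R * \<epsilon>)"
  let ?e = "?n + \<theta> * p"
  define A where "A = \<bar>pairing \<Omega> h \<tau>\<bar>"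
  define \<mu> where "\<mu> = N * \<epsilon> powr (\<theta> - ?n / p)"
  define m where "m = ?V * (R * \<epsilon>) ^ CARD('n)"
  have \<mu>: "\<mu> > 0" using N \<epsilon> by (simp add: \<mu>_def)
  have m: "m > 0" using R \<epsilon> by (simp add: m_def)
  have T: "T \<ge> 0" using \<tau>(3)[of 0] by (rule order_trans[OF abs_ge_zero])
  have eK: "emeasure lebesgue ?K = ennreal m"
    unfolding m_def using R \<epsilon> by (intro emeasure_lebesgue_cball) simp
  have KS: "?K \<in> sets lebesgue" by simp
  let ?J = "\<lambda>c. energy p h ?K c"
  have \<tau>0: "(\<integral>y. \<tau> y \<partial>lebesgue_on \<Omega>) = 0"
  proof -
    have eq: "indicator \<Omega> y *\<^sub>R \<tau> y = \<tau> y" for y using \<tau>(2)[of y] assms(3) by (cases "y \<in> \<Omega>") (auto simp del: mem_cball)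
    have "(\<integral>y. \<tau> y \<partial>lebesgue_on \<Omega>) = (\<integral>y. \<tau> y \<partial>lebesgue)"
      using assms(1) by (subst integral_restrict_space) (auto simp: eq simp del: real_scaleR_def)
    also have "\<dots> = 0" using z borel_measurable_continuous_onI[OF \<tau>(1)] by (simp add: integral_completion)
    finally show ?thesis .
  qed
  have le: "ennreal A \<le> ennreal (T * \<mu>) * ennreal m + ennreal (T * \<mu> powr (1 - p)) * ?J c" for c
  proof -
    have "integrable (lebesgue_on \<Omega>) (\<lambda>y. h y * \<tau> y)"
      by (rule locally_integrable_pairing(2)[OF assms(1,2) _ assms(3) \<tau>(1,2)]) auto
    moreover have "integrable (lebesgue_on \<Omega>) (\<lambda>y. 1 * \<tau> y)"
    proof (rule locally_integrable_pairing(2)[OF assms(1) _ _ assms(3) \<tau>(1,2)])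
      have "locally_integrable \<Omega> (\<lambda>y. (\<lambda>_. 0) y - (-1::real))"
        by (rule locally_integrable_diff_const) (simp add: locally_integrable_def absolutely_integrable_on_def)
      then show "locally_integrable \<Omega> (\<lambda>y. 1)" by simp
    qed auto
    ultimately have "(\<integral>y. (h y - h c) * \<tau> y \<partial>lebesgue_on \<Omega>) = pairing \<Omega> h \<tau>"
      using \<tau>0 by (simp add: left_diff_distrib)
    moreover have "ennreal \<bar>\<integral>y. (h y - h c) * \<tau> y \<partial>lebesgue_on \<Omega>\<bar> \<le>
      ennreal (T * \<mu>) * emeasure lebesgue ?K + ennreal (T * \<mu> powr (1 - p)) * ?J c"
      by (intro pairing_bound locally_integrable_diff_const assms(1-3) compact_cball \<tau> p \<mu>)
    ultimately show ?thesis unfolding A_def eK by simp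
  qed
  have "R * \<epsilon> > 0" using R \<epsilon> by simp
  note J = slobodeckij_double_integral[OF assms(1-3) this p \<theta> N]
  have "ennreal A * ennreal m = (\<integral>\<^sup>+c. ennreal A * indicator ?K c \<partial>lebesgue)"
    by (subst nn_integral_cmult_indicator[OF KS]) (simp only: eK)
  also have "\<dots> \<le> (\<integral>\<^sup>+c. (ennreal (T * \<mu>) * ennreal m) * indicator ?K c + ennreal (T * \<mu> powr (1 - p)) * (?J c * indicator ?K c) \<partial>lebesgue)"
    using le by (intro nn_integral_mono) (auto simp: indicator_def)
  also have "\<dots> \<le> ennreal (T * \<mu>) * ennreal m * ennreal m + ennreal (T * \<mu> powr (1 - p)) * ennreal ((2 * (R * \<epsilon>)) powr ?e * N powr p)"
  proof -
    have "(\<integral>\<^sup>+c. (ennreal (T * \<mu>) * ennreal m) * indicator ?K c + ennreal (T * \<mu> powr (1 - p)) * (?J c * indicator ?K c) \<partial>lebesgue)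
      = ennreal (T * \<mu>) * ennreal m * ennreal m + ennreal (T * \<mu> powr (1 - p)) * (\<integral>\<^sup>+c. ?J c * indicator ?K c \<partial>lebesgue)"
    proof (subst nn_integral_add)
      show "(\<lambda>c. ennreal (T * \<mu>) * ennreal m * indicator ?K c) \<in> borel_measurable lebesgue"
        using KS by measurable
      show "(\<lambda>c. ennreal (T * \<mu> powr (1 - p)) * (?J c * indicator ?K c)) \<in> borel_measurable lebesgue"
        using J(1) by measurable
    qed (simp only: nn_integral_cmult_indicator[OF KS] nn_integral_cmult[OF J(1)] eK)
    then show ?thesis using J(2) by (simp add: add_left_mono mult_left_mono)
  qed
  also have "\<dots> = ennreal (T * \<mu> * m * m + T * \<mu> powr (1 - p) * ((2 * (R * \<epsilon>)) powr ?e * N powr p))"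
    using T \<mu> m by (simp add: ennreal_mult)
  finally have "ennreal (A * m) \<le> ennreal (T * \<mu> * m * m + T * \<mu> powr (1 - p) * ((2 * (R * \<epsilon>)) powr ?e * N powr p))"
    using m by (subst ennreal_mult) (auto simp: A_def)
  then have "A * m \<le> T * \<mu> * m * m + T * \<mu> powr (1 - p) * ((2 * (R * \<epsilon>)) powr ?e * N powr p)"
    using T \<mu> m by (subst (asm) ennreal_le_iff) (simp_all add: A_def)
  then have "A \<le> T * (\<mu> * m) + T * (\<mu> powr (1 - p) * ((2 * (R * \<epsilon>)) powr ?e * N powr p) / m)"
    using m by (simp add: field_simps)
  also have "\<mu> * m = ?V * R ^ CARD('n) * N * \<epsilon> powr (?n + \<theta> - ?n / p)"
    using \<epsilon> by (simp add: \<mu>_def m_def power_mult_distrib powr_diff powr_add powr_realpow)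
  also have "\<mu> powr (1 - p) * ((2 * (R * \<epsilon>)) powr ?e * N powr p) / m =
      (2 * R) powr ?e / (?V * R ^ CARD('n)) * N * \<epsilon> powr (?n + \<theta> - ?n / p)"
  proof -
    have Nid: "N powr (1 - p) * N powr p = N" using N by (simp flip: powr_add)
    have \<epsilon>id: "\<epsilon> powr ((\<theta> - ?n / p) * (1 - p)) * \<epsilon> powr ?e * \<epsilon> powr (- ?n) = \<epsilon> powr (?n + \<theta> - ?n / p)"
    proof -
      have "(\<theta> - ?n / p) * (1 - p) + ?e + (- ?n) = ?n + \<theta> - ?n / p" using p by (simp add: field_simps)
      then show ?thesis by (simp flip: powr_add)
    qed
    have "\<mu> powr (1 - p) = N powr (1 - p) * \<epsilon> powr ((\<theta> - ?n / p) * (1 - p))"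
      using N \<epsilon> by (simp add: \<mu>_def powr_mult powr_powr)
    moreover have "(2 * (R * \<epsilon>)) powr ?e = (2 * R) powr ?e * \<epsilon> powr ?e"
      using R \<epsilon> powr_mult[of "2 * R" \<epsilon> ?e] by (simp add: mult.assoc)
    moreover have "1 / m = 1 / (?V * R ^ CARD('n)) * \<epsilon> powr (- ?n)"
      using \<epsilon> by (simp add: m_def power_mult_distrib powr_minus powr_realpow field_simps)
    ultimately have
      "\<mu> powr (1 - p) * ((2 * (R * \<epsilon>)) powr ?e * N powr p) * (1 / m) =
        (2 * R) powr ?e * (1 / (?V * R ^ CARD('n))) * (N powr (1 - p) * N powr p) *
          (\<epsilon> powr ((\<theta> - ?n / p) * (1 - p)) * \<epsilon> powr ?e * \<epsilon> powr (- ?n))"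
      by (simp only: mult_ac)
    also have "\<dots> = (2 * R) powr ?e * (1 / (?V * R ^ CARD('n))) * N * \<epsilon> powr (?n + \<theta> - ?n / p)"
      by (simp only: Nid \<epsilon>id)
    finally show ?thesis by simp
  qed
  finally show ?thesis unfolding A_def by (simp add: algebra_simps)
qed

section \<open>Mollification of Sobolev functions\<close>

text \<open>A finite norm forces the weak derivatives to exist, so that the choice made in
  \<^const>\<open>weak_deriv\<close> is a genuine one, and each summand is bounded by the whole norm.\<close>

lemma Wsp_norm_leD:
  fixes f :: "real ^ 'n \<Rightarrow> real"
  assumes W: "Wsp_norm s p \<Omega> f \<le> ennreal N"
  shows "mi_order \<nu> \<le> nat \<lfloor>s\<rfloor> \<Longrightarrow> has_weak_deriv \<Omega> \<nu> f (weak_deriv \<Omega> \<nu> f)"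
    and "mi_order \<nu> \<le> nat \<lfloor>s\<rfloor> \<Longrightarrow> Lp_norm p \<Omega> (weak_deriv \<Omega> \<nu> f) \<le> ennreal N"
    and "mi_order \<nu> = nat \<lfloor>s\<rfloor> \<Longrightarrow> frac s \<noteq> 0 \<Longrightarrow> slobodeckij_seminorm (frac s) p \<Omega> (weak_deriv \<Omega> \<nu> f) \<le> ennreal N"
proof -
  let ?k = "nat \<lfloor>s\<rfloor>"
  have K: "Wkp_norm ?k p \<Omega> f \<le> ennreal N"
    using W order_trans[OF add_increasing2] unfolding Wsp_norm_def Let_def
    by (meson add_increasing2 order_refl order_trans zero_le)
  then have ex: "\<forall>\<nu>. mi_order \<nu> \<le> ?k \<longrightarrow> (\<exists>h. has_weak_deriv \<Omega> \<nu> f h)"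
  proof (rule contrapos_pp)
    assume n: "\<not> (\<forall>\<nu>. mi_order \<nu> \<le> ?k \<longrightarrow> (\<exists>h. has_weak_deriv \<Omega> \<nu> f h))"
    have "Wkp_norm ?k p \<Omega> f = \<infinity>" unfolding Wkp_norm_def by (rule if_not_P[OF n])
    then show "\<not> Wkp_norm ?k p \<Omega> f \<le> ennreal N" by (simp add: top_unique)
  qed
  show "has_weak_deriv \<Omega> \<nu> f (weak_deriv \<Omega> \<nu> f)" if "mi_order \<nu> \<le> ?k"
  proof -
    have "\<exists>h. has_weak_deriv \<Omega> \<nu> f h" using ex that by blast
    then show ?thesis unfolding weak_deriv_def by (rule someI_ex[of "has_weak_deriv \<Omega> \<nu> f"])
  qed
  show "Lp_norm p \<Omega> (weak_deriv \<Omega> \<nu> f) \<le> ennreal N" if "mi_order \<nu> \<le> ?k"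
  proof -
    have "Lp_norm p \<Omega> (weak_deriv \<Omega> \<nu> f) \<le> (\<Sum>\<nu> | mi_order \<nu> \<le> ?k. Lp_norm p \<Omega> (weak_deriv \<Omega> \<nu> f))"
      by (rule member_le_sum[where f = "\<lambda>\<nu>. Lp_norm p \<Omega> (weak_deriv \<Omega> \<nu> f)"])
        (use that finite_multi_indices in simp_all)
    also have "\<dots> = Wkp_norm ?k p \<Omega> f" unfolding Wkp_norm_def by (rule if_P[OF ex, symmetric])
    finally show ?thesis using K by (rule order_trans)
  qed
  show "slobodeckij_seminorm (frac s) p \<Omega> (weak_deriv \<Omega> \<nu> f) \<le> ennreal N"
    if "mi_order \<nu> = ?k" "frac s \<noteq> 0"
  proof -
    have "finite {\<nu> :: 'n multi_index. mi_order \<nu> = ?k}"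
      by (rule finite_subset[OF _ finite_multi_indices[of ?k]]) auto
    then have "slobodeckij_seminorm (frac s) p \<Omega> (weak_deriv \<Omega> \<nu> f) \<le>
        (\<Sum>\<nu> | mi_order \<nu> = ?k. slobodeckij_seminorm (frac s) p \<Omega> (weak_deriv \<Omega> \<nu> f))"
      using that
      by (intro member_le_sum[where f = "\<lambda>\<nu>. slobodeckij_seminorm (frac s) p \<Omega> (weak_deriv \<Omega> \<nu> f)"]) auto
    also have "\<dots> \<le> Wsp_norm s p \<Omega> f"
      unfolding Wsp_norm_def Let_def using that by simp
    finally show ?thesis using W by (rule order_trans)
  qed
qed

lemma continuous_compact_support_bounded:
  fixes \<kappa> :: "real ^ 'n \<Rightarrow> real"
  assumes "continuous_on UNIV \<kappa>" "\<And>y. norm y > R \<Longrightarrow> \<kappa> y = 0"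
  obtains T where "\<And>y. \<bar>\<kappa> y\<bar> \<le> T" "T \<ge> 0"
proof -
  have "bounded (\<kappa> ` cball 0 R)"
    using assms(1) by (intro compact_imp_bounded compact_continuous_image) (auto intro: continuous_on_subset)
  then obtain T where "\<forall>x\<in>cball 0 R. \<bar>\<kappa> x\<bar> \<le> T" by (auto simp: bounded_iff)
  then have T: "\<bar>\<kappa> y\<bar> \<le> T" if "norm y \<le> R" for y using that by simp
  have "\<bar>\<kappa> y\<bar> \<le> \<bar>T\<bar>" for y
    by (cases "norm y \<le> R") (use T[of y] assms(2)[of y] in auto)
  then show ?thesis using that[of "\<bar>T\<bar>"] by auto
qed

lemma scaled_kernel:
  fixes \<kappa> :: "real ^ 'n \<Rightarrow> real"
  assumes "continuous_on UNIV \<kappa>" "\<And>y. norm y > R \<Longrightarrow> \<kappa> y = 0" "\<epsilon> > 0"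
  shows scaled_kernel_continuous: "continuous_on UNIV (rescale \<kappa> \<epsilon> x)"
    and scaled_kernel_support: "y \<notin> cball x (R * \<epsilon>) \<Longrightarrow> rescale \<kappa> \<epsilon> x y = 0"
    and scaled_kernel_integral: "(\<integral>y. rescale \<kappa> \<epsilon> x y \<partial>lborel) = \<epsilon> ^ CARD('n) * (\<integral>y. \<kappa> y \<partial>lborel)"
proof -
  show c: "continuous_on UNIV (rescale \<kappa> \<epsilon> x)"
    by (rule continuous_on_compose2[OF assms(1)]) (auto intro!: continuous_intros)
  show "rescale \<kappa> \<epsilon> x y = 0" if "y \<notin> cball x (R * \<epsilon>)"
  proof (rule assms(2))
    have "R < norm (x - y) / \<epsilon>" using that assms(3) by (simp add: dist_norm field_simps)
    then show "R < norm ((1 / \<epsilon>) *\<^sub>R (x - y))" unfolding norm_scaleR using assms(3) by simp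
  qed
  have "(\<integral>y. rescale \<kappa> \<epsilon> x y \<partial>lborel) =
      \<bar>- \<epsilon>\<bar> ^ DIM(real ^ 'n) * (\<integral>z. \<kappa> ((1 / \<epsilon>) *\<^sub>R (x - (x + (- \<epsilon>) *\<^sub>R z))) \<partial>lborel)"
    using assms(3) borel_measurable_continuous_onI[OF c] by (intro integral_lborel_affine) auto
  then show "(\<integral>y. rescale \<kappa> \<epsilon> x y \<partial>lborel) = \<epsilon> ^ CARD('n) * (\<integral>y. \<kappa> y \<partial>lborel)"
    using assms(3) by simp
qed

lemma Wsp_norm_locally_integrable: "Wsp_norm s p \<Omega> f \<le> ennreal N \<Longrightarrow> locally_integrable \<Omega> f"
  using Wsp_norm_leD(1)[of s p \<Omega> f N "\<lambda>_. 0"] by (simp add: has_weak_deriv_def mi_order_def)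

text \<open>The data at which the estimates below are made: a point \<open>x\<close>, a scale \<open>\<epsilon>\<close> for which the kernels
  are supported in \<open>\<Omega>\<close>, and a positive bound \<open>N\<close> of the norm of \<open>f\<close>. The constants have to be independent of
  all of them; \<open>N\<close> is used in place of the norm because the parameter \<open>\<mu>\<close> of the estimates must be positive.\<close>

definition admissible ::
  "real \<Rightarrow> real \<Rightarrow> real \<Rightarrow> (real ^ 'n) set \<Rightarrow> (real ^ 'n \<Rightarrow> real) \<Rightarrow> real \<Rightarrow> real ^ 'n \<Rightarrow> real \<Rightarrow> bool" where
  "admissible s p R \<Omega> f N x \<epsilon> \<longleftrightarrow>
    open \<Omega> \<and> Wsp_norm s p \<Omega> f \<le> ennreal N \<and> N > 0 \<and> \<epsilon> > 0 \<and> cball x (R * \<epsilon>) \<subseteq> \<Omega>"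

text \<open>For integral \<open>s\<close> this is the \<open>L\<^sup>p\<close> bound, otherwise the Slobodeckij bound with
  \<open>\<theta> = frac s\<close>; the exponents of \<open>\<epsilon>\<close> fit together.\<close>

lemma kernel_pairing_bound:
  fixes \<kappa> :: "real ^ 'n \<Rightarrow> real" and s p R :: real
  assumes s: "s > 0" and p: "p > 1" and R: "R > 0"
    and \<kappa>: "continuous_on UNIV \<kappa>" "\<And>y. norm y > R \<Longrightarrow> \<kappa> y = 0" "(\<integral>y. \<kappa> y \<partial>lborel) = 0"
  shows "\<exists>C\<ge>0. \<forall>\<Omega> f N x \<epsilon> \<nu>. admissible s p R \<Omega> f N x \<epsilon> \<longrightarrow> mi_order \<nu> = nat \<lfloor>s\<rfloor> \<longrightarrow>
    \<bar>pairing \<Omega> (weak_deriv \<Omega> \<nu> f) (rescale \<kappa> \<epsilon> x)\<bar> \<le>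
      C * N * \<epsilon> powr (CARD('n) + frac s - CARD('n) / p)"
proof -
  obtain T where T: "\<And>y. \<bar>\<kappa> y\<bar> \<le> T" "T \<ge> 0"
    using continuous_compact_support_bounded[OF \<kappa>(1,2)] by metis
  let ?V = "unit_ball_vol CARD('n) * R ^ CARD('n)"
  define C where "C = T * (?V + 1) + T * (?V + (2 * R) powr (CARD('n) + frac s * p) / ?V)"
  have V: "?V > 0" using R by simp
  have C1: "T * (?V + 1) \<le> C" and C2: "T * (?V + (2 * R) powr (CARD('n) + frac s * p) / ?V) \<le> C" and "C \<ge> 0"
    using V T unfolding C_def by (auto intro!: add_nonneg_nonneg mult_nonneg_nonneg)
  show ?thesis
  proof (intro exI[of _ C] conjI \<open>C \<ge> 0\<close> allI impI)
    fix \<Omega> :: "(real ^ 'n) set" and f N x \<epsilon> and \<nu> :: "'n multi_index"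
    assume adm: "admissible s p R \<Omega> f N x \<epsilon>" and \<nu>: "mi_order \<nu> = nat \<lfloor>s\<rfloor>"
    then have O: "open \<Omega>" and W: "Wsp_norm s p \<Omega> f \<le> ennreal N" and N: "N > 0" and \<epsilon>: "\<epsilon> > 0"
      and B: "cball x (R * \<epsilon>) \<subseteq> \<Omega>" by (simp_all add: admissible_def)
    let ?h = "weak_deriv \<Omega> \<nu> f" and ?\<tau> = "rescale \<kappa> \<epsilon> x"
    have h: "locally_integrable \<Omega> ?h"
      using Wsp_norm_leD(1)[OF W, of \<nu>] \<nu> by (simp add: has_weak_deriv_def)
    note \<tau> = scaled_kernel[OF \<kappa>(1,2) \<epsilon>, where x = x]
    show "\<bar>pairing \<Omega> ?h ?\<tau>\<bar> \<le> C * N * \<epsilon> powr (CARD('n) + frac s - CARD('n) / p)"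
    proof (cases "frac s = 0")
      case True
      have "\<bar>pairing \<Omega> ?h ?\<tau>\<bar> \<le> T * (?V + 1) * N * \<epsilon> powr (CARD('n) - CARD('n) / p)"
        by (rule Lp_pairing_bound[OF O h B \<tau>(1,2) T(1) p N _ \<epsilon> R]) (use Wsp_norm_leD(2)[OF W, of \<nu>] \<nu> in auto)
      also have "\<dots> \<le> C * N * \<epsilon> powr (CARD('n) - CARD('n) / p)"
        using N by (intro mult_right_mono C1) auto
      finally show ?thesis by (simp only: True add_0_right)
    next
      case False
      then have \<theta>: "frac s > 0" by (simp add: frac_ge_0 order_less_le)
      have "\<bar>pairing \<Omega> ?h ?\<tau>\<bar> \<le>
        T * (?V + (2 * R) powr (CARD('n) + frac s * p) / ?V) * N * \<epsilon> powr (CARD('n) + frac s - CARD('n) / p)"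
        by (rule slobodeckij_pairing_bound[OF O h B \<tau>(1,2) T(1) _ p \<theta> N _ \<epsilon> R])
          (use Wsp_norm_leD(3)[OF W \<nu> False] \<tau>(3) \<kappa>(3) in auto)
      also have "\<dots> \<le> C * N * \<epsilon> powr (CARD('n) + frac s - CARD('n) / p)"
        using N by (intro mult_right_mono C2) auto
      finally show ?thesis .
    qed
  qed
qed

definition mollify :: "(real ^ 'n \<Rightarrow> real) \<Rightarrow> (real ^ 'n) set \<Rightarrow> (real ^ 'n \<Rightarrow> real) \<Rightarrow> real \<Rightarrow> real ^ 'n \<Rightarrow> real" where
  "mollify \<eta> \<Omega> f \<epsilon> x = (1 / \<epsilon>) ^ CARD('n) * pairing \<Omega> f (rescale \<eta> \<epsilon> x)"

lemma iterated_partial_eq_0: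
  assumes "open S" "\<And>y. y \<in> S \<Longrightarrow> f y = 0" "x \<in> S"
  shows "iterated_partial is f x = 0"
  using assms(3)
proof (induction "is" arbitrary: x)
  case Nil then show ?case using assms(2) by (simp add: iterated_partial_def)
next
  case (Cons i "is")
  have "((\<lambda>_. 0) has_derivative (\<lambda>_. 0)) (at x)" by simp
  then have "(iterated_partial is f has_derivative (\<lambda>_. 0)) (at x)"
    by (rule has_derivative_transform_within_open[OF _ assms(1) Cons.prems]) (use Cons.IH in simp)
  from fun_cong[OF frechet_derivative_at[OF this], of "axis i 1"] show ?case
    by (simp add: iterated_partial_def partial_deriv_def)
qed

lemma count_list_replicate_if: "count_list (replicate k i) j = (if j = i then k else 0)"
  by (induction k) auto

lemma scaled_test_function:
  fixes \<kappa> :: "real ^ 'n \<Rightarrow> real"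
  assumes "smooth_on UNIV \<kappa>" "\<And>y. norm y > R \<Longrightarrow> \<kappa> y = 0" "\<epsilon> > 0" "cball x (R * \<epsilon>) \<subseteq> \<Omega>"
  shows "test_function \<Omega> (rescale \<kappa> \<epsilon> x)"
proof -
  let ?\<tau> = "rescale \<kappa> \<epsilon> x"
  have "smooth_on UNIV (\<lambda>y. \<kappa> ((- 1 / \<epsilon>) *\<^sub>R y + (1 / \<epsilon>) *\<^sub>R x))"
    by (rule smooth_on_affine_compose[OF assms(1)])
  also have "(\<lambda>y. \<kappa> ((- 1 / \<epsilon>) *\<^sub>R y + (1 / \<epsilon>) *\<^sub>R x)) = ?\<tau>"
    by (simp add: algebra_simps)
  finally have "smooth_on UNIV ?\<tau>" .
  moreover have "closure {y. ?\<tau> y \<noteq> 0} \<subseteq> cball x (R * \<epsilon>)"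
    using scaled_kernel_support[where \<kappa> = \<kappa> and R = R, OF smooth_on_continuous_on[OF assms(1)] assms(2,3)]
    by (intro closure_minimal) (auto simp del: mem_cball)
  moreover from this have "compact (closure {y. ?\<tau> y \<noteq> 0})"
    by (meson bounded_cball bounded_subset closed_closure compact_eq_bounded_closed)
  ultimately show ?thesis using assms(4) unfolding test_function_def by auto
qed

text \<open>The difference of the mollifications at the scales \<open>\<epsilon>\<close> and \<open>\<epsilon> / 2\<close> is the pairing of \<open>f\<close> with a
  rescaled sum of pure derivatives of order \<open>k = \<lfloor>s\<rfloor>\<close>. Rescaled kernels are test functions, so by the definition of
  weak derivatives it becomes \<open>\<epsilon> ^ k\<close> times a sum of pairings of the derivatives of \<open>f\<close> with the mean zero kernels
  \<open>\<theta> i\<close>, which are small by \<open>kernel_pairing_bound\<close>.\<close>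

lemma mollify_step:
  fixes \<eta> :: "real ^ 'n \<Rightarrow> real" and s p :: real
  assumes s: "s > 0" and p: "p > 1" and k: "smoothing_pair (nat \<lfloor>s\<rfloor>) \<eta> \<theta>"
  shows "\<exists>C\<ge>0. \<forall>\<Omega> f N x \<epsilon>. admissible s p (real CARD('n)) \<Omega> f N x \<epsilon> \<longrightarrow>
    \<bar>mollify \<eta> \<Omega> f \<epsilon> x - mollify \<eta> \<Omega> f (\<epsilon> / 2) x\<bar> \<le> C * N * \<epsilon> powr (s - CARD('n) / p)"
proof -
  let ?k = "nat \<lfloor>s\<rfloor>" and ?n = "real CARD('n)"
  have \<eta>: "smooth_on UNIV \<eta>" "\<And>y. norm y > ?n \<Longrightarrow> \<eta> y = 0"
    and \<theta>: "\<And>i. smooth_on UNIV (\<theta> i)" "\<And>i y. norm y > ?n \<Longrightarrow> \<theta> i y = 0" "\<And>i. (\<integral>y. \<theta> i y \<partial>lborel) = 0"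
    and tele: "\<And>y. \<eta> y - 2 ^ CARD('n) * \<eta> (2 *\<^sub>R y) = (\<Sum>i\<in>UNIV. iterated_partial (replicate ?k i) (\<theta> i) y)"
    using k unfolding smoothing_pair_def by blast+
  have "\<forall>i. \<exists>C\<ge>0. \<forall>\<Omega> f N x \<epsilon> \<nu>. admissible s p ?n \<Omega> f N x \<epsilon> \<longrightarrow> mi_order \<nu> = ?k \<longrightarrow>
    \<bar>pairing \<Omega> (weak_deriv \<Omega> \<nu> f) (rescale (\<theta> i) \<epsilon> x)\<bar> \<le> C * N * \<epsilon> powr (?n + frac s - ?n / p)"
    by (rule allI, rule kernel_pairing_bound[OF s p _ smooth_on_continuous_on[OF \<theta>(1)] \<theta>(2,3)]) auto
  from choice[OF this] obtain C where C: "\<forall>i. C i \<ge> 0 \<and>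
    (\<forall>\<Omega> f N x \<epsilon> \<nu>. admissible s p ?n \<Omega> f N x \<epsilon> \<longrightarrow> mi_order \<nu> = ?k \<longrightarrow>
    \<bar>pairing \<Omega> (weak_deriv \<Omega> \<nu> f) (rescale (\<theta> i) \<epsilon> x)\<bar> \<le> C i * N * \<epsilon> powr (?n + frac s - ?n / p))"
    by (elim exE) (rule that)
  show ?thesis
  proof (intro exI[of _ "\<Sum>i\<in>UNIV. C i"] conjI sum_nonneg C[THEN spec, THEN conjunct1] allI impI)
    fix \<Omega> :: "(real ^ 'n) set" and f N x \<epsilon>
    assume adm: "admissible s p ?n \<Omega> f N x \<epsilon>"
    then have O: "open \<Omega>" and W: "Wsp_norm s p \<Omega> f \<le> ennreal N" and N: "N > 0" and \<epsilon>: "\<epsilon> > 0"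
      and B: "cball x (?n * \<epsilon>) \<subseteq> \<Omega>" by (simp_all add: admissible_def)
    note f = Wsp_norm_locally_integrable[OF W]
    let ?a = "1 / \<epsilon>" and ?K = "cball x (?n * \<epsilon>)"
    let ?g = "\<lambda>i y. iterated_partial (replicate ?k i) (\<theta> i) (?a *\<^sub>R (x - y))"
    let ?\<tau> = "\<lambda>i y. \<theta> i (?a *\<^sub>R (x - y))"
    note int = integrable_pairing[OF O f compact_cball B]
    have g_eq: "iterated_partial (replicate ?k i) (?\<tau> i) y = (- ?a) ^ ?k * ?g i y" for i y
      using iterated_partial_affine[OF \<theta>(1), of "replicate ?k i" i ?a x] by simp
    have intg: "integrable (lebesgue_on \<Omega>) (\<lambda>y. f y * ?g i y)" for i
    proof (rule int)
      show "continuous_on UNIV (?g i)"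
        by (rule continuous_on_compose2[OF smooth_on_continuous_on[OF smooth_on_iterated_partial[OF \<theta>(1)]]])
          (auto intro!: continuous_intros)
      show "?g i y = 0" if "y \<notin> ?K" for y
      proof -
        have "iterated_partial (replicate ?k i) (?\<tau> i) y = 0"
          by (rule iterated_partial_eq_0[of "- ?K"])
            (use that scaled_kernel_support[where \<kappa> = "\<theta> i" and R = ?n, OF smooth_on_continuous_on[OF \<theta>(1)] \<theta>(2) \<epsilon>] in \<open>auto simp del: mem_cball\<close>)
        then show ?thesis using g_eq \<epsilon> by simp
      qed
    qed
    have pair: "pairing \<Omega> f (?g i) =
      \<epsilon> ^ ?k * (\<integral>y. weak_deriv \<Omega> (\<lambda>j. if j = i then ?k else 0) f y * ?\<tau> i y \<partial>lebesgue_on \<Omega>)" for i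
    proof -
      let ?\<nu> = "\<lambda>j. if j = i then ?k else 0"
      have \<nu>: "mi_order ?\<nu> = ?k" by (simp add: mi_order_def)
      have "test_function \<Omega> (?\<tau> i)" by (rule scaled_test_function[OF \<theta>(1,2) \<epsilon> B])
      then have "(\<integral>y. f y * iterated_partial (replicate ?k i) (?\<tau> i) y \<partial>lebesgue_on \<Omega>) =
          (- 1) ^ ?k * (\<integral>y. weak_deriv \<Omega> ?\<nu> f y * ?\<tau> i y \<partial>lebesgue_on \<Omega>)"
        using Wsp_norm_leD(1)[OF W, of ?\<nu>] \<nu> unfolding has_weak_deriv_def by (simp add: count_list_replicate_if)
      moreover have "(\<integral>y. f y * iterated_partial (replicate ?k i) (?\<tau> i) y \<partial>lebesgue_on \<Omega>) =
          (- ?a) ^ ?k * pairing \<Omega> f (?g i)"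
        unfolding g_eq mult.left_commute[of "f _"] by (rule integral_mult_right_zero)
      ultimately have "(- ?a) ^ ?k * pairing \<Omega> f (?g i) =
          (- 1) ^ ?k * (\<integral>y. weak_deriv \<Omega> ?\<nu> f y * ?\<tau> i y \<partial>lebesgue_on \<Omega>)"
        by (simp only:)
      moreover have "(- ?a) ^ ?k = (- 1) ^ ?k * (1 / \<epsilon> ^ ?k)"
        by (metis mult_minus1 power_mult_distrib power_one_over)
      ultimately show ?thesis using \<epsilon> by (simp add: field_simps)
    qed
    have c1: "integrable (lebesgue_on \<Omega>) (\<lambda>y. f y * \<eta> (?a *\<^sub>R (x - y)))"
      by (intro int scaled_kernel_continuous[OF smooth_on_continuous_on[OF \<eta>(1)] \<eta>(2) \<epsilon>]
        scaled_kernel_support[OF smooth_on_continuous_on[OF \<eta>(1)] \<eta>(2) \<epsilon>])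
    have c2: "integrable (lebesgue_on \<Omega>) (\<lambda>y. f y * rescale \<eta> (\<epsilon> / 2) x y)"
    proof (rule int)
      have "\<epsilon> / 2 > 0" using \<epsilon> by simp
      note sc = scaled_kernel[OF smooth_on_continuous_on[OF \<eta>(1)] \<eta>(2) this, where x = x]
      show "continuous_on UNIV (rescale \<eta> (\<epsilon> / 2) x)" by (rule sc(1))
      show "rescale \<eta> (\<epsilon> / 2) x y = 0" if "y \<notin> ?K" for y
      proof (rule sc(2))
        have "?n * (\<epsilon> / 2) \<le> ?n * \<epsilon>" using \<epsilon> by (intro mult_left_mono) auto
        then show "y \<notin> cball x (?n * (\<epsilon> / 2))" using that by (simp only: mem_cball not_le)
      qed
    qed
    have "mollify \<eta> \<Omega> f \<epsilon> x - mollify \<eta> \<Omega> f (\<epsilon> / 2) x =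
       ?a ^ CARD('n) * (\<integral>y. f y * \<eta> (?a *\<^sub>R (x - y)) - 2 ^ CARD('n) * (f y * rescale \<eta> (\<epsilon> / 2) x y) \<partial>lebesgue_on \<Omega>)"
      using c1 c2 unfolding mollify_def by (simp add: power_divide right_diff_distrib)
    also have "(\<lambda>y. f y * \<eta> (?a *\<^sub>R (x - y)) - 2 ^ CARD('n) * (f y * rescale \<eta> (\<epsilon> / 2) x y)) = (\<lambda>y. \<Sum>i\<in>UNIV. f y * ?g i y)"
    proof
      fix y
      have "f y * \<eta> (?a *\<^sub>R (x - y)) - 2 ^ CARD('n) * (f y * rescale \<eta> (\<epsilon> / 2) x y) =
        f y * (\<eta> (?a *\<^sub>R (x - y)) - 2 ^ CARD('n) * \<eta> (2 *\<^sub>R (?a *\<^sub>R (x - y))))"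
        by (simp add: right_diff_distrib mult.left_commute)
      also have "\<dots> = (\<Sum>i\<in>UNIV. f y * ?g i y)" unfolding tele by (simp add: sum_distrib_left)
      finally show "f y * \<eta> (?a *\<^sub>R (x - y)) - 2 ^ CARD('n) * (f y * rescale \<eta> (\<epsilon> / 2) x y) = (\<Sum>i\<in>UNIV. f y * ?g i y)" .
    qed
    also have "(\<integral>y. (\<Sum>i\<in>UNIV. f y * ?g i y) \<partial>lebesgue_on \<Omega>) = (\<Sum>i\<in>UNIV. \<integral>y. f y * ?g i y \<partial>lebesgue_on \<Omega>)"
      by (rule Bochner_Integration.integral_sum[OF intg])
    finally have diff: "mollify \<eta> \<Omega> f \<epsilon> x - mollify \<eta> \<Omega> f (\<epsilon> / 2) x = ?a ^ CARD('n) * (\<Sum>i\<in>UNIV. \<integral>y. f y * ?g i y \<partial>lebesgue_on \<Omega>)" .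
    have "\<bar>\<Sum>i\<in>UNIV. \<integral>y. f y * ?g i y \<partial>lebesgue_on \<Omega>\<bar> \<le> (\<Sum>i\<in>UNIV. \<epsilon> ^ ?k * (C i * N * \<epsilon> powr (?n + frac s - ?n / p)))"
    proof (rule order_trans[OF sum_abs sum_mono])
      fix i
      show "\<bar>pairing \<Omega> f (?g i)\<bar> \<le> \<epsilon> ^ ?k * (C i * N * \<epsilon> powr (?n + frac s - ?n / p))"
        unfolding pair abs_mult using \<epsilon>
        by (intro mult_mono C[THEN spec, THEN conjunct2, rule_format, OF adm]) (auto simp: mi_order_def)
    qed
    then have "\<bar>mollify \<eta> \<Omega> f \<epsilon> x - mollify \<eta> \<Omega> f (\<epsilon> / 2) x\<bar> \<le>
      ?a ^ CARD('n) * (\<Sum>i\<in>UNIV. \<epsilon> ^ ?k * (C i * N * \<epsilon> powr (?n + frac s - ?n / p)))"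
      unfolding diff abs_mult using \<epsilon> by (intro mult_mono) auto
    also have "\<dots> = (\<Sum>i\<in>UNIV. C i) * N * (\<epsilon> powr (- ?n) * \<epsilon> powr ?k * \<epsilon> powr (?n + frac s - ?n / p))"
      using \<epsilon> by (simp add: sum_distrib_left sum_distrib_right powr_minus powr_realpow power_one_over divide_inverse power_inverse mult_ac)
    also have "\<epsilon> powr (- ?n) * \<epsilon> powr ?k * \<epsilon> powr (?n + frac s - ?n / p) = \<epsilon> powr (s - ?n / p)"
    proof -
      have "real ?k = of_int \<lfloor>s\<rfloor>" using s by simp
      then have "- ?n + ?k + (?n + frac s - ?n / p) = s - ?n / p" by (simp add: frac_def)
      then show ?thesis by (simp only: powr_add[symmetric])
    qed
    finally show "\<bar>mollify \<eta> \<Omega> f \<epsilon> x - mollify \<eta> \<Omega> f (\<epsilon> / 2) x\<bar> \<le> (\<Sum>i\<in>UNIV. C i) * N * \<epsilon> powr (s - ?n / p)" .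
  qed
qed

text \<open>The function \<open>weak_deriv \<Omega> 0 f\<close>, whose \<open>L\<^sup>p\<close> norm is part of the Sobolev norm, has the same
  pairings with test functions as \<open>f\<close>.\<close>

lemma mollify_bound:
  fixes \<eta> :: "real ^ 'n \<Rightarrow> real" and s p :: real
  assumes p: "p > 1" and k: "smoothing_pair k \<eta> \<theta>"
  shows "\<exists>C\<ge>0. \<forall>\<Omega> f N x \<epsilon>. admissible s p (real CARD('n)) \<Omega> f N x \<epsilon> \<longrightarrow>
    \<bar>mollify \<eta> \<Omega> f \<epsilon> x\<bar> \<le> C * N * \<epsilon> powr (- (CARD('n) / p))"
proof -
  let ?n = "real CARD('n)"
  have \<eta>: "smooth_on UNIV \<eta>" "\<And>y. norm y > ?n \<Longrightarrow> \<eta> y = 0"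
    using k unfolding smoothing_pair_def by blast+
  note c = smooth_on_continuous_on[OF \<eta>(1)]
  obtain T where T: "\<And>y. \<bar>\<eta> y\<bar> \<le> T" "T \<ge> 0"
    using continuous_compact_support_bounded[OF c \<eta>(2)] by metis
  let ?C = "T * (unit_ball_vol CARD('n) * ?n ^ CARD('n) + 1)"
  show ?thesis
  proof (intro exI[of _ ?C] conjI allI impI)
    show "?C \<ge> 0" using T(2) by simp
    fix \<Omega> :: "(real ^ 'n) set" and f N x \<epsilon>
    assume "admissible s p ?n \<Omega> f N x \<epsilon>"
    then have O: "open \<Omega>" and W: "Wsp_norm s p \<Omega> f \<le> ennreal N" and N: "N > 0" and \<epsilon>: "\<epsilon> > 0"
      and B: "cball x (?n * \<epsilon>) \<subseteq> \<Omega>" by (simp_all add: admissible_def)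
    let ?h = "weak_deriv \<Omega> (\<lambda>_. 0) f" and ?\<tau> = "rescale \<eta> \<epsilon> x"
    have o: "mi_order (\<lambda>_::'n. 0) = 0" by (simp add: mi_order_def)
    have wd: "has_weak_deriv \<Omega> (\<lambda>_. 0) f ?h" and Lp: "Lp_norm p \<Omega> ?h \<le> ennreal N"
      using Wsp_norm_leD(1,2)[OF W, of "\<lambda>_. 0"] o by simp_all
    have "test_function \<Omega> ?\<tau>" by (rule scaled_test_function[OF \<eta> \<epsilon> B])
    then have "(\<integral>y. f y * iterated_partial [] ?\<tau> y \<partial>lebesgue_on \<Omega>) = (- 1) ^ mi_order (\<lambda>_::'n. 0) * pairing \<Omega> ?h ?\<tau>"
      by (intro wd[unfolded has_weak_deriv_def, THEN conjunct2, THEN conjunct2, rule_format]) simp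
    then have "mollify \<eta> \<Omega> f \<epsilon> x = (1 / \<epsilon>) ^ CARD('n) * pairing \<Omega> ?h ?\<tau>"
      unfolding mollify_def o by (simp add: iterated_partial_def)
    moreover have "\<bar>pairing \<Omega> ?h ?\<tau>\<bar> \<le> ?C * N * \<epsilon> powr (?n - ?n / p)"
      by (rule Lp_pairing_bound[OF O _ B scaled_kernel(1,2)[OF c \<eta>(2) \<epsilon>] T(1) p N Lp \<epsilon>])
        (use wd in \<open>auto simp: has_weak_deriv_def\<close>)
    ultimately have "\<bar>mollify \<eta> \<Omega> f \<epsilon> x\<bar> \<le> (1 / \<epsilon>) ^ CARD('n) * (?C * N * \<epsilon> powr (?n - ?n / p))"
      using \<epsilon> by (simp add: abs_mult mult_left_mono divide_right_mono)
    also have "\<dots> = ?C * N * \<epsilon> powr (- (?n / p))"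
      using \<epsilon> by (simp add: powr_diff powr_minus powr_realpow power_one_over field_simps)
    finally show "\<bar>mollify \<eta> \<Omega> f \<epsilon> x\<bar> \<le> ?C * N * \<epsilon> powr (- (?n / p))" .
  qed
qed

section \<open>The interior Sobolev embedding\<close>

lemma compact_neighbourhood_in_open:
  fixes K :: "'a::euclidean_space set"
  assumes "compact K" "(\<Union>x\<in>K. cball x r) \<subseteq> \<Omega>"
  defines "K' \<equiv> {x + z | x z. x \<in> K \<and> z \<in> cball 0 r}"
  shows "compact K'" "K' \<subseteq> \<Omega>" "\<And>x. x \<in> K \<Longrightarrow> cball x r \<subseteq> K'"
proof -
  show "compact K'" unfolding K'_def by (rule compact_sums[OF assms(1) compact_cball])
  show "K' \<subseteq> \<Omega>"
  proof
    fix y assume "y \<in> K'"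
    then obtain x z where "y = x + z" "x \<in> K" "z \<in> cball 0 r" unfolding K'_def by blast
    then have "x \<in> K" "y \<in> cball x r" by (auto simp: dist_norm)
    then show "y \<in> \<Omega>" using assms(2) by blast
  qed
  show "cball x r \<subseteq> K'" if "x \<in> K" for x
  proof
    fix y assume "y \<in> cball x r"
    then have "y = x + (y - x)" "y - x \<in> cball 0 r" by (auto simp: dist_norm norm_minus_commute)
    then show "y \<in> K'" using that unfolding K'_def by blast
  qed
qed

lemma mollify_eq:
  fixes f \<eta> :: "real ^ 'n \<Rightarrow> real"
  assumes O: "open \<Omega>" "locally_integrable \<Omega> f"
    and \<eta>: "continuous_on UNIV \<eta>" "\<And>y. norm y > R \<Longrightarrow> \<eta> y = 0" and \<epsilon>: "\<epsilon> > 0"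
    and K: "compact K" "K \<subseteq> \<Omega>" "cball x (R * \<epsilon>) \<subseteq> K"
  shows "mollify \<eta> \<Omega> f \<epsilon> x = (1 / \<epsilon>) ^ CARD('n) * (\<integral>y. (indicator K y * f y) * rescale \<eta> \<epsilon> x y \<partial>lebesgue)"
  unfolding mollify_def
proof (subst integral_pairing_eq[OF O K(1,2)])
  show "rescale \<eta> \<epsilon> x y = 0" if "y \<notin> K" for y
    using that K(3) by (intro scaled_kernel_support[where R = R and \<kappa> = \<eta>] \<eta> \<epsilon>) auto
qed (use scaled_kernel_continuous[where R = R and \<kappa> = \<eta>] \<eta> \<epsilon> in auto)

lemma mollify_continuous:
  fixes f \<eta> :: "real ^ 'n \<Rightarrow> real"
  assumes O: "open \<Omega>" "locally_integrable \<Omega> f"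
    and \<eta>: "continuous_on UNIV \<eta>" "\<And>y. norm y > R \<Longrightarrow> \<eta> y = 0" and \<epsilon>: "\<epsilon> > 0"
    and K: "compact K" "(\<Union>x\<in>K. cball x (R * \<epsilon>)) \<subseteq> \<Omega>"
  shows "continuous_on K (mollify \<eta> \<Omega> f \<epsilon>)"
proof -
  let ?K' = "{x + z | x z. x \<in> K \<and> z \<in> cball 0 (R * \<epsilon>)}"
  let ?G = "\<lambda>x y. (indicator ?K' y * f y) * rescale \<eta> \<epsilon> x y"
  let ?I = "\<lambda>x. \<integral>y. ?G x y \<partial>lebesgue"
  note K' = compact_neighbourhood_in_open[OF K]
  obtain T where T: "\<And>y. \<bar>\<eta> y\<bar> \<le> T" "T \<ge> 0"
    using continuous_compact_support_bounded[OF \<eta>] by metis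
  have int: "integrable lebesgue (\<lambda>y. indicator ?K' y * f y)"
    using integrable_on_compact[where \<tau> = "\<lambda>_. 0", OF O K'(1,2)] by simp
  have [measurable]: "(\<lambda>y. indicator ?K' y * f y) \<in> borel_measurable lebesgue"
    using int by (rule borel_measurable_integrable)
  have [measurable]: "rescale \<eta> \<epsilon> x \<in> borel_measurable lebesgue" for x
  proof -
    have "continuous_on UNIV (rescale \<eta> \<epsilon> x)"
      by (rule scaled_kernel_continuous[where R = R]) (use \<eta> \<epsilon> in auto)
    then show ?thesis using borel_measurable_continuous_onI by (intro measurable_completion) simp
  qed
  have "continuous_on K (\<lambda>x. (1 / \<epsilon>) ^ CARD('n) * ?I x)"
    unfolding continuous_on_sequentially comp_def
  proof (intro allI ballI impI, elim conjE)
    fix u :: "nat \<Rightarrow> real ^ 'n" and a assume u: "u \<longlonglongrightarrow> a"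
    have "(\<lambda>j. ?I (u j)) \<longlonglongrightarrow>
      ?I a"
    proof (rule integral_dominated_convergence[where w = "\<lambda>y. T * \<bar>indicator ?K' y * f y\<bar>"])
      show "AE y in lebesgue. (\<lambda>j. ?G (u j) y) \<longlonglongrightarrow>
        ?G a y"
        by (intro AE_I2 tendsto_mult tendsto_const continuous_on_tendsto_compose[OF \<eta>(1)] tendsto_scaleR tendsto_diff u) auto
      show "AE y in lebesgue. norm (?G (u j) y) \<le> T * \<bar>indicator ?K' y * f y\<bar>" for j
      proof (rule AE_I2)
        fix y
        have "\<bar>rescale \<eta> \<epsilon> (u j) y\<bar> * \<bar>indicator ?K' y * f y\<bar> \<le> T * \<bar>indicator ?K' y * f y\<bar>"
          by (intro mult_right_mono T) simp
        then show "norm (?G (u j) y) \<le> T * \<bar>indicator ?K' y * f y\<bar>"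
          by (simp only: real_norm_def abs_mult mult_ac)
      qed
      show "integrable lebesgue (\<lambda>y. T * \<bar>indicator ?K' y * f y\<bar>)" using int by simp
      show "(\<lambda>y. ?G a y) \<in> borel_measurable lebesgue"
        by (rule borel_measurable_times) measurable
      show "(\<lambda>y. ?G (u j) y) \<in> borel_measurable lebesgue" for j
        by (rule borel_measurable_times) measurable
    qed
    then show "(\<lambda>j. (1 / \<epsilon>) ^ CARD('n) * ?I (u j)) \<longlonglongrightarrow>
      (1 / \<epsilon>) ^ CARD('n) * ?I a"
      by (rule tendsto_mult_left)
  qed
  moreover have "mollify \<eta> \<Omega> f \<epsilon> x = (1 / \<epsilon>) ^ CARD('n) * ?I x"
    if "x \<in> K" for x
    by (rule mollify_eq[OF O \<eta> \<epsilon> K'(1,2) K'(3)[OF that]])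
  ultimately show ?thesis using continuous_on_cong[OF refl] by force
qed

lemma AE_lebesgue_negligible:
  assumes "AE x in lebesgue. P x" shows "negligible {x. \<not> P x}"
proof -
  obtain N where "{x. \<not> P x} \<subseteq> N" "N \<in> null_sets lebesgue"
    using assms unfolding eventually_ae_filter by auto
  then show ?thesis by (meson negligible_iff_null_sets negligible_subset)
qed

text \<open>Over small boxes, the mollifications have integrals converging to that of \<open>F\<close> by uniform
  convergence and to that of \<open>f\<close> by \<open>mollified_box_integral_tendsto\<close>. Hence \<open>F - f\<close> vanishes almost everywhere in
  each box whose closure lies in \<open>\<Omega>\<close>, and negligibility is a local property.\<close>

lemma mollify_limit_eq_AE:
  fixes f F \<eta> :: "real ^ 'n \<Rightarrow> real" and \<epsilon> :: "nat \<Rightarrow> real"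
  assumes O: "open \<Omega>" "locally_integrable \<Omega> f"
    and \<eta>: "continuous_on UNIV \<eta>" "\<And>y. norm y > R \<Longrightarrow> \<eta> y = 0" "(\<integral>y. \<eta> y \<partial>lborel) = 1" and R: "R > 0"
    and \<epsilon>: "\<And>j. \<epsilon> j > 0" "\<epsilon> \<longlonglongrightarrow> 0"
    and F: "continuous_on \<Omega> F"
    and lim: "\<And>K. compact K \<Longrightarrow> K \<subseteq> \<Omega> \<Longrightarrow> uniform_limit K (\<lambda>j. mollify \<eta> \<Omega> f (\<epsilon> j)) F sequentially"
  shows "negligible {x \<in> \<Omega>. f x \<noteq> F x}" (is "negligible ?Z")
proof -
  let ?m = "\<lambda>j. mollify \<eta> \<Omega> f (\<epsilon> j)"
  obtain T where T: "\<And>y. \<bar>\<eta> y\<bar> \<le> T" "T \<ge> 0"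
    using continuous_compact_support_bounded[OF \<eta>(1,2)] by metis
  have [measurable]: "\<eta> \<in> borel_measurable borel" using \<eta>(1) by (rule borel_measurable_continuous_onI)
  have \<eta>int: "integrable lborel \<eta>"
    using \<eta>(3) not_integrable_integral_eq by fastforce
  have loc: "negligible (?Z \<inter> box a b)" if ab: "cbox a b \<subseteq> \<Omega>" for a b
  proof -
    let ?K = "cbox a b"
    obtain e where e: "e > 0" "(\<Union>x\<in>?K. cball x e) \<subseteq> \<Omega>"
      using compact_subset_open_imp_cball_epsilon_subset[OF compact_cbox O(1) ab] by blast
    let ?K' = "{x + z | x z. x \<in> ?K \<and> z \<in> cball 0 e}"
    note K' = compact_neighbourhood_in_open[OF compact_cbox e(2)]
    have int: "integrable lebesgue (\<lambda>y. indicator ?K' y * f y)"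
      using integrable_on_compact[where \<tau> = "\<lambda>_. 0", OF O K'(1,2)] by simp
    \<comment> \<open>A Borel function is needed, as Fubini is applied to the product of two Lebesgue-Borel measures.\<close>
    obtain g where [measurable]: "g \<in> borel_measurable lborel" and "AE y in lborel. indicator ?K' y * f y = g y"
      using completion_ex_borel_measurable_real[OF borel_measurable_integrable[OF int]] by blast
    then have gAE: "AE y in lebesgue. indicator ?K' y * f y = g y" by (simp add: AE_completion)
    have "integrable lebesgue g"
      using int gAE by (subst integrable_cong_AE[symmetric, OF _ _ gAE])
        (auto intro: measurable_completion borel_measurable_integrable)
    then have g: "integrable lborel g" by (simp add: integrable_completion)
    let ?G = "\<lambda>j x y. (indicator ?K' y * f y) * rescale \<eta> (\<epsilon> j) x y" and ?H = "\<lambda>j x y. g y * rescale \<eta> (\<epsilon> j) x y"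
    have moll: "?m j x = (1 / \<epsilon> j) ^ CARD('n) * (\<integral>y. ?H j x y \<partial>lborel)"
      if "x \<in> ?K" "R * \<epsilon> j \<le> e" for x j
    proof -
      have m: "rescale \<eta> (\<epsilon> j) x \<in> borel_measurable borel"
        by (rule borel_measurable_continuous_onI, rule scaled_kernel_continuous[where R = R]) (use \<eta> \<epsilon> in auto)
      have "?m j x = (1 / \<epsilon> j) ^ CARD('n) * (\<integral>y. ?G j x y \<partial>lebesgue)"
        by (rule mollify_eq[OF O \<eta>(1,2) \<epsilon>(1) K'(1,2) order_trans[OF subset_cball[OF that(2)] K'(3)[OF that(1)]]])
      also have "(\<integral>y. ?G j x y \<partial>lebesgue) = (\<integral>y. ?H j x y \<partial>lebesgue)"
      proof (rule integral_cong_AE)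
        show "AE y in lebesgue. ?G j x y = ?H j x y"
          using gAE by (rule eventually_mono) simp
        show "(\<lambda>y. ?G j x y) \<in> borel_measurable lebesgue"
          by (intro borel_measurable_times borel_measurable_integrable[OF int] measurable_completion) (use m in simp)
        show "(\<lambda>y. ?H j x y) \<in> borel_measurable lebesgue"
          by (intro borel_measurable_times measurable_completion) (use m in simp_all)
      qed
      also have "\<dots> = (\<integral>y. ?H j x y \<partial>lborel)"
        using m by (intro integral_completion) simp
      finally show ?thesis .
    qed
    have FK: "continuous_on ?K F" using F ab continuous_on_subset by blast
    have intF: "integrable lborel (\<lambda>x. indicator ?K x * F x)"
      using borel_integrable_compact[OF compact_cbox FK] by simp
    \<comment> \<open>Dominated convergence needs a bound for all indices, so the first terms of the sequence are dropped.\<close>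
    have "\<forall>\<^sub>F j in sequentially. \<epsilon> j < e / R"
      using order_tendstoD(2)[OF \<epsilon>(2), of "e / R"] e(1) R by simp
    moreover have "\<forall>\<^sub>F j in sequentially. \<forall>x\<in>?K. dist (?m j x) (F x) < 1"
      using uniform_limitD[OF lim[OF compact_cbox ab], of 1] by simp
    ultimately have "\<forall>\<^sub>F j in sequentially. \<epsilon> j < e / R \<and> (\<forall>x\<in>?K. dist (?m j x) (F x) < 1)"
      by (rule eventually_conj)
    then obtain j1 where j1: "\<And>j. j \<ge> j1 \<Longrightarrow> \<epsilon> j < e / R"
      "\<And>j x. j \<ge> j1 \<Longrightarrow> x \<in> ?K \<Longrightarrow> dist (?m j x) (F x) < 1"
      unfolding eventually_sequentially by blast
    have Re: "R * \<epsilon> (j + j1) \<le> e" for j using j1(1)[of "j + j1"] R by (simp add: field_simps)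
    have \<epsilon>': "(\<lambda>j. \<epsilon> (j + j1)) \<longlonglongrightarrow> 0" by (rule LIMSEQ_ignore_initial_segment[OF \<epsilon>(2)])
    let ?A = "\<lambda>j x. (1 / \<epsilon> (j + j1)) ^ CARD('n) * (\<integral>y. ?H (j + j1) x y \<partial>lborel)"
    have A: "?A j x = ?m (j + j1) x" if "x \<in> ?K" for j x
      by (rule moll[OF that Re, symmetric])
    have sub: "(\<integral>x. indicator (box c d) x * F x \<partial>lborel) = (\<integral>x. indicator (box c d) x * g x \<partial>lborel)"
      if cd: "box c d \<subseteq> ?K" for c d
    proof (rule LIMSEQ_unique)
      show "(\<lambda>j. \<integral>x. indicator (box c d) x * ?A j x \<partial>lborel) \<longlonglongrightarrow> (\<integral>x. indicator (box c d) x * g x \<partial>lborel)"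
        using mollified_box_integral_tendsto[OF g \<eta>(1) \<eta>int \<eta>(3) T(1), of "\<lambda>j. \<epsilon> (j + j1)" c d] \<epsilon>(1) \<epsilon>' by simp
      show "(\<lambda>j. \<integral>x. indicator (box c d) x * ?A j x \<partial>lborel) \<longlonglongrightarrow> (\<integral>x. indicator (box c d) x * F x \<partial>lborel)"
      proof (rule integral_dominated_convergence[where w = "\<lambda>x. \<bar>indicator ?K x * F x\<bar> + indicator ?K x"])
        show "AE x in lborel. (\<lambda>j. indicator (box c d) x * ?A j x) \<longlonglongrightarrow> indicator (box c d) x * F x"
        proof (rule AE_I2)
          fix x
          show "(\<lambda>j. indicator (box c d) x * ?A j x) \<longlonglongrightarrow> indicator (box c d) x * F x"
          proof (cases "x \<in> box c d")
            case True
            then have x: "x \<in> ?K" using cd by auto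
            have "(\<lambda>j. ?m (j + j1) x) \<longlonglongrightarrow> F x"
              by (rule LIMSEQ_ignore_initial_segment[OF tendsto_uniform_limitI[OF lim[OF compact_cbox ab] x]])
            then show ?thesis using True A[OF x] by simp
          qed simp
        qed
        show "AE x in lborel. norm (indicator (box c d) x * ?A j x) \<le> \<bar>indicator ?K x * F x\<bar> + indicator ?K x" for j
        proof (rule AE_I2)
          fix x
          show "norm (indicator (box c d) x * ?A j x) \<le> \<bar>indicator ?K x * F x\<bar> + indicator ?K x"
          proof (cases "x \<in> box c d")
            case True
            then have x: "x \<in> ?K" using cd by auto
            then show ?thesis using True A[OF x, of j] j1(2)[of "j + j1" x] by (simp add: dist_real_def)
          qed simp
        qed
        show "integrable lborel (\<lambda>x. \<bar>indicator ?K x * F x\<bar> + indicator ?K x)"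
          by (rule Bochner_Integration.integrable_add[OF integrable_abs[OF intF]
              integrable_real_indicator[OF _ emeasure_lborel_cbox_finite]]) simp
        have "(\<lambda>x. indicator (box c d) x * (indicator ?K x * F x)) \<in> borel_measurable lborel"
          using borel_measurable_integrable[OF intF] by measurable
        also have "(\<lambda>x. indicator (box c d) x * (indicator ?K x * F x)) = (\<lambda>x. indicator (box c d) x * F x)"
          using cd by (auto simp: indicator_def fun_eq_iff)
        finally show "(\<lambda>x. indicator (box c d) x * F x) \<in> borel_measurable lborel" .
        show "(\<lambda>x. indicator (box c d) x * ?A j x) \<in> borel_measurable lborel" for j
          by measurable
      qed
    qed
    define H where "H x = indicator (box a b) x * (indicator ?K x * F x - g x)" for x
    have "integrable lborel (\<lambda>x. indicator ?K x * F x - g x)" using intF g by simp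
    then have H: "integrable lborel H" unfolding H_def
      using integrable_mult_indicator[of "box a b" lborel "\<lambda>x. indicator ?K x * F x - g x"] by simp
    have "AE x in lborel. H x = 0"
    proof (rule AE_zero_if_box_integrals_zero[OF H])
      fix c d
      obtain c' d' where cd': "box c d \<inter> box a b = box c' d'" using box_Int_box[of c d a b] by blast
      then have sK: "box c' d' \<subseteq> ?K" using box_subset_cbox by blast
      have i1: "integrable lborel (\<lambda>x. indicator (box c' d') x * F x)"
      proof -
        have "integrable lborel (\<lambda>x. indicator (box c' d') x * (indicator ?K x * F x))"
          using integrable_mult_indicator[OF _ intF, of "box c' d'"] by simp
        also have "(\<lambda>x. indicator (box c' d') x * (indicator ?K x * F x)) = (\<lambda>x. indicator (box c' d') x * F x)"
          using sK by (auto simp: indicator_def fun_eq_iff)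
        finally show ?thesis .
      qed
      have i2: "integrable lborel (\<lambda>x. indicator (box c' d') x * g x)"
        using integrable_mult_indicator[OF _ g, of "box c' d'"] by simp
      have "(\<integral>x. indicator (box c d) x * H x \<partial>lborel) = (\<integral>x. indicator (box c' d') x * F x - indicator (box c' d') x * g x \<partial>lborel)"
        using sK cd' by (intro Bochner_Integration.integral_cong refl) (auto simp: H_def indicator_def)
      also have "\<dots> = 0" using sub[OF sK] i1 i2 by simp
      finally show "(\<integral>x. indicator (box c d) x * H x \<partial>lborel) = 0" .
    qed
    then have "AE x in lebesgue. H x = 0" by (rule AE_completion)
    then have "AE x in lebesgue. x \<in> box a b \<longrightarrow> f x = F x"
      using gAE
    proof eventually_elim
      case (elim x)
      show ?case
      proof
        assume x: "x \<in> box a b"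
        then have "x \<in> ?K" using box_subset_cbox by blast
        moreover from this have "x \<in> ?K'" using K'(3) e(1) by (meson centre_in_cball less_imp_le subsetD)
        ultimately show "f x = F x" using elim x by (simp add: H_def)
      qed
    qed
    then have "negligible {x. \<not> (x \<in> box a b \<longrightarrow> f x = F x)}" by (rule AE_lebesgue_negligible)
    then show ?thesis by (rule negligible_subset) auto
  qed
  show ?thesis
    unfolding locally_negligible_alt[of "?Z"]
  proof
    fix x assume "x \<in> ?Z"
    then obtain a b where "cbox a b \<subseteq> \<Omega>" "x \<in> box a b" using O(1) by (metis (no_types, lifting) mem_Collect_eq open_contains_cbox)
    then show "\<exists>U. openin (top_of_set ?Z) U \<and> x \<in> U \<and> negligible U"
      using loc[of a b] \<open>x \<in> ?Z\<close> by (intro exI[of _ "?Z \<inter> box a b"]) auto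
  qed
qed

text \<open>Along the scales \<open>2 ^ (- j)\<close> the successive differences of the mollifications are bounded by a
  geometric series, because \<open>s - n / p > 0\<close>. So they converge uniformly on compact sets; the limit is continuous, agrees with
  \<open>f\<close> almost everywhere, and on \<open>K\<close> differs by at most the sum of the series from a mollification at a scale for which the
  kernels centred in \<open>K\<close> are supported in \<open>\<Omega>\<close>.\<close>

theorem sobolev_embedding_interior:
  fixes \<Omega> K :: "(real ^ 'n) set" and s p :: real
  assumes O: "open \<Omega>" and p: "1 < p" and sp: "s * p > real CARD('n)" and K: "compact K" "K \<subseteq> \<Omega>"
  shows "\<exists>C\<ge>0. \<forall>f. Wsp_norm s p \<Omega> f < \<infinity> \<longrightarrow>
    (\<exists>F. continuous_on \<Omega> F \<and> negligible {x \<in> \<Omega>. f x \<noteq> F x} \<and>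
      (\<forall>x\<in>K. \<bar>F x\<bar> \<le> C * enn2real (Wsp_norm s p \<Omega> f)))"
proof -
  let ?n = "real CARD('n)" and ?k = "nat \<lfloor>s\<rfloor>"
  have "0 < s * p" using sp by (rule less_trans[rotated]) simp
  then have s: "s > 0" using p by (simp add: zero_less_mult_iff)
  define \<delta> where "\<delta> = s - ?n / p"
  have \<delta>: "\<delta> > 0" using sp p by (simp add: \<delta>_def field_simps)
  obtain \<eta> and \<theta> :: "'n \<Rightarrow> real ^ 'n \<Rightarrow> real" where pair: "smoothing_pair ?k \<eta> \<theta>"
    using smoothing_pair_exists by blast
  have \<eta>: "continuous_on UNIV \<eta>" "\<And>y. norm y > ?n \<Longrightarrow> \<eta> y = 0" "(\<integral>y. \<eta> y \<partial>lborel) = 1"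
    using pair unfolding smoothing_pair_def by (auto intro: smooth_on_continuous_on)
  obtain C1 where C1: "C1 \<ge> 0" "\<forall>\<Omega> f N x \<epsilon>. admissible s p ?n \<Omega> f N x \<epsilon> \<longrightarrow>
    \<bar>mollify \<eta> \<Omega> f \<epsilon> x - mollify \<eta> \<Omega> f (\<epsilon> / 2) x\<bar> \<le> C1 * N * \<epsilon> powr \<delta>"
    using mollify_step[OF s p pair, folded \<delta>_def] by (elim exE conjE) (rule that)
  obtain C2 where C2: "C2 \<ge> 0" "\<forall>\<Omega> f N x \<epsilon>. admissible s p ?n \<Omega> f N x \<epsilon> \<longrightarrow>
    \<bar>mollify \<eta> \<Omega> f \<epsilon> x\<bar> \<le> C2 * N * \<epsilon> powr (- (?n / p))"
    using mollify_bound[OF p pair, of s] by (elim exE conjE) (rule that)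
  define \<epsilon> :: "nat \<Rightarrow> real" where "\<epsilon> j = (1 / 2) ^ j" for j
  have \<epsilon>0: "\<epsilon> j > 0" for j by (simp add: \<epsilon>_def)
  have \<epsilon>lim: "\<epsilon> \<longlonglongrightarrow> 0" unfolding \<epsilon>_def[abs_def] by (rule LIMSEQ_power_zero) simp
  define r :: real where "r = (1 / 2) powr \<delta>"
  have r: "0 < r" "r < 1" using \<delta> powr_less_mono2[of \<delta> "1 / 2" 1] by (auto simp: r_def)
  have \<epsilon>r: "\<epsilon> j powr \<delta> = r ^ j" for j
  proof -
    have "\<epsilon> j = (1 / 2) powr j" by (simp add: \<epsilon>_def powr_realpow)
    then show ?thesis by (simp add: r_def powr_powr powr_realpow[symmetric] mult.commute)
  qed
  have inner: "\<exists>j0. \<forall>j\<ge>j0. \<forall>x\<in>L. cball x (?n * \<epsilon> j) \<subseteq> \<Omega>" if L: "compact L" "L \<subseteq> \<Omega>" for L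
  proof -
    obtain e where e: "e > 0" "(\<Union>x\<in>L. cball x e) \<subseteq> \<Omega>"
      using compact_subset_open_imp_cball_epsilon_subset[OF L(1) O L(2)] by blast
    have "\<forall>\<^sub>F j in sequentially. \<epsilon> j < e / ?n"
      using order_tendstoD(2)[OF \<epsilon>lim, of "e / ?n"] e(1) by simp
    then obtain j0 where j0: "\<And>j. j \<ge> j0 \<Longrightarrow> \<epsilon> j < e / ?n" unfolding eventually_sequentially by blast
    have "cball x (?n * \<epsilon> j) \<subseteq> \<Omega>" if "j \<ge> j0" "x \<in> L" for j x
    proof -
      have "?n * \<epsilon> j \<le> e" using j0[OF that(1)] by (simp add: field_simps)
      then show ?thesis using e(2) that(2) subset_cball by blast
    qed
    then show ?thesis by blast
  qed
  obtain jK where jK: "\<And>j x. j \<ge> jK \<Longrightarrow> x \<in> K \<Longrightarrow> cball x (?n * \<epsilon> j) \<subseteq> \<Omega>" using inner[OF K] by blast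
  define D where "D = C2 * \<epsilon> jK powr (- (?n / p)) + C1 * (1 / (1 - r))"
  show ?thesis
  proof (intro exI[of _ D] conjI allI impI)
    show "D \<ge> 0" using C1(1) C2(1) r by (auto simp: D_def intro!: add_nonneg_nonneg)
    fix f assume fin: "Wsp_norm s p \<Omega> f < \<infinity>"
    define w where "w = enn2real (Wsp_norm s p \<Omega> f)"
    have w: "Wsp_norm s p \<Omega> f = ennreal w" "w \<ge> 0" using fin by (auto simp: w_def)
    have W: "Wsp_norm s p \<Omega> f \<le> ennreal N" if "N > w" for N using that w by (simp add: ennreal_leI)
    note f = Wsp_norm_locally_integrable[OF W[of "w + 1", OF less_add_one]]
    let ?m = "\<lambda>j. mollify \<eta> \<Omega> f (\<epsilon> j)"
    define F where "F x = lim (\<lambda>j. ?m j x)" for x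
    have conv: "uniform_limit L ?m F sequentially \<and> (\<forall>x\<in>L. \<bar>F x - ?m j0 x\<bar> \<le> C1 * N * (1 / (1 - r)))"
      if j0: "\<And>j x. j \<ge> j0 \<Longrightarrow> x \<in> L \<Longrightarrow> cball x (?n * \<epsilon> j) \<subseteq> \<Omega>" and N: "N > w" for L j0 N
    proof -
      let ?f = "\<lambda>i x. ?m (Suc i + j0) x - ?m (i + j0) x"
      let ?M = "\<lambda>i. C1 * N * r ^ i"
      have b: "norm (?f i x) \<le> ?M i" if "x \<in> L" for i x
      proof -
        have "\<bar>?m (i + j0) x - mollify \<eta> \<Omega> f (\<epsilon> (i + j0) / 2) x\<bar> \<le> C1 * N * \<epsilon> (i + j0) powr \<delta>"
          using N w by (intro C1(2)[rule_format]) (auto simp: admissible_def O W \<epsilon>0 j0 that simp del: mem_cball)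
        also have "\<dots> = C1 * N * (r ^ i * r ^ j0)" by (simp add: \<epsilon>r power_add)
        also have "\<dots> \<le> C1 * N * (r ^ i * 1)"
          using r C1(1) N w by (intro mult_left_mono power_le_one) auto
        finally show ?thesis by (simp add: \<epsilon>_def abs_minus_commute)
      qed
      have M: "summable ?M" using r by (intro summable_mult summable_geometric) auto
      have tele: "(\<Sum>i<j. ?f i x) = ?m (j + j0) x - ?m j0 x" for j x
        using sum_lessThan_telescope[of "\<lambda>i. ?m (i + j0) x" j] by simp
      have "uniform_limit L (\<lambda>j x. \<Sum>i<j. ?f i x) (\<lambda>x. \<Sum>i. ?f i x) sequentially"
        by (rule Weierstrass_m_test[OF _ M]) (rule b)
      then have u: "uniform_limit L (\<lambda>j x. ?m (j + j0) x - ?m j0 x) (\<lambda>x. \<Sum>i. ?f i x) sequentially"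
        by (simp only: tele)
      have u2: "uniform_limit L (\<lambda>j x. ?m (j + j0) x) (\<lambda>x. (\<Sum>i. ?f i x) + ?m j0 x) sequentially"
        using u unfolding uniform_limit_iff by (simp add: dist_real_def diff_diff_eq add.commute)
      have u3: "uniform_limit L ?m (\<lambda>x. (\<Sum>i. ?f i x) + ?m j0 x) sequentially"
        unfolding uniform_limit_sequentially_iff
      proof (intro allI impI)
        fix e :: real assume "e > 0"
        then obtain i0 where i0: "\<And>i x. i \<ge> i0 \<Longrightarrow> x \<in> L \<Longrightarrow> dist (?m (i + j0) x) ((\<Sum>i. ?f i x) + ?m j0 x) < e"
          using u2 unfolding uniform_limit_sequentially_iff by blast
        show "\<exists>N. \<forall>j\<ge>N. \<forall>x\<in>L. dist (?m j x) ((\<Sum>i. ?f i x) + ?m j0 x) < e"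
        proof (intro exI[of _ "i0 + j0"] allI impI ballI)
          fix j x assume "i0 + j0 \<le> j" "x \<in> L"
          then show "dist (?m j x) ((\<Sum>i. ?f i x) + ?m j0 x) < e" using i0[of "j - j0" x] by simp
        qed
      qed
      have F: "F x = (\<Sum>i. ?f i x) + ?m j0 x" if "x \<in> L" for x
        unfolding F_def using tendsto_uniform_limitI[OF u3 that] by (rule limI)
      have "uniform_limit L ?m F sequentially"
        using u3 F unfolding uniform_limit_sequentially_iff by simp
      moreover have "\<bar>F x - ?m j0 x\<bar> \<le> C1 * N * (1 / (1 - r))" if "x \<in> L" for x
      proof -
        have "norm (\<Sum>i. ?f i x) \<le> (\<Sum>i. ?M i)"
          by (rule norm_suminf_le[OF b[OF that] M])
        also have "\<dots> = C1 * N * (1 / (1 - r))"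
          using r by (subst suminf_mult) (auto simp: suminf_geometric summable_geometric)
        finally show ?thesis by (simp add: F[OF that])
      qed
      ultimately show ?thesis by blast
    qed
    have unif: "uniform_limit L ?m F sequentially" if "compact L" "L \<subseteq> \<Omega>" for L
      using inner[OF that] conv[of _ L "w + 1"] by (metis less_add_one)
    have contF: "continuous_on \<Omega> F"
    proof (rule continuous_at_imp_continuous_on, rule ballI)
      fix x assume "x \<in> \<Omega>"
      then obtain e where e: "e > 0" "cball x e \<subseteq> \<Omega>" using O open_contains_cball by blast
      obtain j0 where j0: "\<And>j y. j \<ge> j0 \<Longrightarrow> y \<in> cball x e \<Longrightarrow> cball y (?n * \<epsilon> j) \<subseteq> \<Omega>"
        using inner[OF compact_cball e(2)] by blast
      have "continuous_on (cball x e) F"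
      proof (rule uniform_limit_theorem[OF _ unif[OF compact_cball e(2)]])
        show "\<forall>\<^sub>F j in sequentially. continuous_on (cball x e) (?m j)"
        proof (rule eventually_sequentiallyI[of j0])
          fix j assume "j \<ge> j0"
          then show "continuous_on (cball x e) (?m j)"
            using j0 by (intro mollify_continuous[OF O f \<eta>(1,2) \<epsilon>0 compact_cball]) blast+
        qed
      qed simp
      then show "isCont F x" using e(1) by (intro continuous_on_interior) auto
    qed
    show "\<exists>F. continuous_on \<Omega> F \<and> negligible {x \<in> \<Omega>. f x \<noteq> F x} \<and>
      (\<forall>x\<in>K. \<bar>F x\<bar> \<le> D * enn2real (Wsp_norm s p \<Omega> f))"
    proof (intro exI[of _ F] conjI contF ballI)
      show "negligible {x \<in> \<Omega>. f x \<noteq> F x}"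
        by (intro mollify_limit_eq_AE[where R = ?n and \<eta> = \<eta> and \<epsilon> = \<epsilon>] O f \<eta> \<epsilon>0 \<epsilon>lim contF unif) simp_all
      fix x assume x: "x \<in> K"
      have "\<bar>F x\<bar> \<le> D * N" if N: "N > w" for N
      proof -
        have "\<bar>?m jK x\<bar> \<le> C2 * N * \<epsilon> jK powr (- (?n / p))"
          using N w by (intro C2(2)[rule_format]) (auto simp: admissible_def O W \<epsilon>0 jK x)
        moreover have "\<bar>F x - ?m jK x\<bar> \<le> C1 * N * (1 / (1 - r))"
          using conv[OF jK N] x by blast
        moreover have "\<bar>F x\<bar> \<le> \<bar>F x - ?m jK x\<bar> + \<bar>?m jK x\<bar>" by simp
        ultimately have "\<bar>F x\<bar> \<le> C1 * N * (1 / (1 - r)) + C2 * N * \<epsilon> jK powr (- (?n / p))" by linarith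
        also have "\<dots> = D * N" by (simp add: D_def algebra_simps)
        finally show ?thesis .
      qed
      \<comment> \<open>Let \<open>N\<close> decrease to the norm, which may itself be zero.\<close>
      then have "\<bar>F x\<bar> \<le> D * (w + inverse (real (Suc i)))" for i by simp
      moreover have "(\<lambda>i. D * (w + inverse (real (Suc i)))) \<longlonglongrightarrow> D * (w + 0)"
        by (intro tendsto_mult_left tendsto_add tendsto_const LIMSEQ_inverse_real_of_nat)
      ultimately have "\<bar>F x\<bar> \<le> D * (w + 0)" by (meson LIMSEQ_le_const)
      then show "\<bar>F x\<bar> \<le> D * enn2real (Wsp_norm s p \<Omega> f)" by (simp add: w_def)
    qed
  qed
qed

section \<open>Charts, smooth maps and null sets\<close>

lemma topological_chartD:
  assumes "topological_chart X (U, \<phi>)"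
  shows chart_openin: "openin X U" and chart_open_image: "open (\<phi> ` U)" and chart_inj: "inj_on \<phi> U"
    and chart_subset: "U \<subseteq> topspace X"
    and chart_continuous: "continuous_map (subtopology X U) euclidean \<phi>"
    and chart_inv_continuous: "continuous_map (top_of_set (\<phi> ` U)) (subtopology X U) (inv_into U \<phi>)"
    and chart_image_open: "openin X V \<Longrightarrow> V \<subseteq> U \<Longrightarrow> open (\<phi> ` V)"
proof -
  have U: "openin X U" and o: "open (\<phi> ` U)" and h: "homeomorphic_map (subtopology X U) (top_of_set (\<phi> ` U)) \<phi>"
    using assms by (auto simp: topological_chart_def)
  show "openin X U" "open (\<phi> ` U)" by fact+
  show sub: "U \<subseteq> topspace X" using U by (rule openin_subset)
  then have ts: "topspace (subtopology X U) = U" by (simp add: inf.absorb2)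
  show inj: "inj_on \<phi> U" using homeomorphic_imp_injective_map[OF h] ts by simp
  show "continuous_map (subtopology X U) euclidean \<phi>"
    using homeomorphic_imp_continuous_map[OF h] by (rule continuous_map_into_fulltopology)
  obtain g where g: "homeomorphic_maps (subtopology X U) (top_of_set (\<phi> ` U)) \<phi> g"
    using h by (auto simp: homeomorphic_map_maps)
  have "continuous_map (top_of_set (\<phi> ` U)) (subtopology X U) g"
    using g by (simp add: homeomorphic_maps_def)
  moreover have "g y = inv_into U \<phi> y" if "y \<in> topspace (top_of_set (\<phi> ` U))" for y
    using g that ts inj by (auto simp: homeomorphic_maps_def)
  ultimately show "continuous_map (top_of_set (\<phi> ` U)) (subtopology X U) (inv_into U \<phi>)"
    by (rule continuous_map_eq)
  show "open (\<phi> ` V)" if "openin X V" "V \<subseteq> U"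
  proof -
    have "openin (subtopology X U) V" using that U by (simp add: openin_open_subtopology)
    then have "openin (top_of_set (\<phi> ` U)) (\<phi> ` V)"
      using homeomorphic_imp_open_map[OF h] by (auto simp: open_map_def)
    then show ?thesis using o by (simp add: openin_open_eq)
  qed
qed

lemma smooth_chart_topological: "smooth_chart M c \<Longrightarrow> topological_chart (Top M) c"
  by (simp add: smooth_chart_def)

lemma smooth_chart_transition:
  assumes "smooth_chart M (U, \<phi>)" "(W, \<omega>) \<in> Atlas M"
  shows "smooth_on (\<phi> ` (U \<inter> W)) (\<omega> \<circ> inv_into U \<phi>)"
    and "smooth_on (\<omega> ` (W \<inter> U)) (\<phi> \<circ> inv_into W \<omega>)"
proof -
  have "smooth_transition (U, \<phi>) (W, \<omega>) \<and> smooth_transition (W, \<omega>) (U, \<phi>)"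
    using assms(1)[unfolded smooth_chart_def, THEN conjunct2, THEN bspec, OF assms(2)] .
  then show "smooth_on (\<phi> ` (U \<inter> W)) (\<omega> \<circ> inv_into U \<phi>)"
    "smooth_on (\<omega> ` (W \<inter> U)) (\<phi> \<circ> inv_into W \<omega>)" by (simp_all add: smooth_transition_def)
qed

lemma smooth_manifold_atlas_cover:
  assumes "smooth_manifold M" "x \<in> carrier_of M"
  obtains W \<omega> where "(W, \<omega>) \<in> Atlas M" "x \<in> W" "smooth_chart M (W, \<omega>)"
proof -
  have "x \<in> \<Union> (fst ` Atlas M)" using assms by (simp add: smooth_manifold_def)
  then obtain c where "c \<in> Atlas M" "x \<in> fst c" by blast
  then show ?thesis
    using that[of "fst c" "snd c"] assms(1) by (simp add: smooth_manifold_def)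
qed

text \<open>Smoothness provides around each point charts in which the map is continuous; these local
  statements are pasted together.\<close>

lemma smooth_map_continuous_map:
  assumes "smooth_map M N f"
  shows "continuous_map (Top M) (Top N) f"
proof -
  have loc: "\<exists>U. openin (Top M) U \<and> x \<in> U \<and> continuous_map (subtopology (Top M) U) (Top N) f" if x: "x \<in> carrier_of M" for x
  proof -
    obtain U \<phi> V \<psi> where c: "smooth_chart M (U, \<phi>)" "smooth_chart N (V, \<psi>)" "x \<in> U" "f ` U \<subseteq> V"
      and sm: "smooth_on (\<phi> ` U) (\<psi> \<circ> f \<circ> inv_into U \<phi>)"
      using assms x unfolding smooth_map_def by blast
    note U = topological_chartD[OF smooth_chart_topological[OF c(1)]]
    note V = topological_chartD[OF smooth_chart_topological[OF c(2)]]
    have ts: "topspace (subtopology (Top M) U) = U" using U(4) by (simp add: inf.absorb2)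
    have im: "(\<psi> \<circ> f \<circ> inv_into U \<phi>) ` (\<phi> ` U) \<subseteq> \<psi> ` V"
      using c(4) U(3) by (auto simp: inv_into_f_f)
    have "continuous_map (subtopology (Top M) U) (top_of_set (\<phi> ` U)) \<phi>"
      using U(5) by (auto simp: continuous_map_in_subtopology)
    moreover have "continuous_map (top_of_set (\<phi> ` U)) (top_of_set (\<psi> ` V)) (\<psi> \<circ> f \<circ> inv_into U \<phi>)"
      using smooth_on_continuous_on[OF sm] im by (auto simp: continuous_map_in_subtopology)
    moreover have "continuous_map (top_of_set (\<psi> ` V)) (Top N) (inv_into V \<psi>)"
      using V(6) by (rule continuous_map_into_fulltopology)
    ultimately have "continuous_map (subtopology (Top M) U) (Top N) (inv_into V \<psi> \<circ> ((\<psi> \<circ> f \<circ> inv_into U \<phi>) \<circ> \<phi>))"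
      by (meson continuous_map_compose)
    moreover have "(inv_into V \<psi> \<circ> ((\<psi> \<circ> f \<circ> inv_into U \<phi>) \<circ> \<phi>)) y = f y" if "y \<in> topspace (subtopology (Top M) U)" for y
    proof -
      have "y \<in> U" "f y \<in> V" using that ts c(4) by auto
      then show ?thesis using U(3) V(3) by simp
    qed
    ultimately have "continuous_map (subtopology (Top M) U) (Top N) f" by (rule continuous_map_eq)
    then show ?thesis using U(1) c(3) by blast
  qed
  then obtain T where T: "\<And>x. x \<in> carrier_of M \<Longrightarrow> openin (Top M) (T x)" "\<And>x. x \<in> carrier_of M \<Longrightarrow> x \<in> T x"
    "\<And>x. x \<in> carrier_of M \<Longrightarrow> continuous_map (subtopology (Top M) (T x)) (Top N) f" by metis
  show ?thesis
    by (rule pasting_lemma[where I = "carrier_of M" and T = T and f = "\<lambda>_. f"]) (use T in auto)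
qed

lemma inv_into_restrict:
  assumes "inj_on \<phi> U" "V \<subseteq> U" "z \<in> \<phi> ` V"
  shows "inv_into V \<phi> z = inv_into U \<phi> z"
  using assms by (auto simp: inv_into_f_f inj_on_subset subset_iff)

text \<open>Smooth charts are compatible with the charts of the given atlas only, so the transition
  between two of them is factored near each point through a chart of the atlas.\<close>

lemma chart_transition_differentiable:
  assumes M: "smooth_manifold M" and c: "smooth_chart M (U, \<phi>)" "smooth_chart M (V, \<xi>)" and x: "x \<in> U" "x \<in> V"
  shows "(\<xi> \<circ> inv_into U \<phi>) differentiable (at (\<phi> x))"
proof -
  note U = topological_chartD[OF smooth_chart_topological[OF c(1)]]
  note V = topological_chartD[OF smooth_chart_topological[OF c(2)]]
  have "x \<in> carrier_of M" using x U(4) by auto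
  then obtain W \<omega> where W: "(W, \<omega>) \<in> Atlas M" "x \<in> W" and cW: "smooth_chart M (W, \<omega>)"
    by (rule smooth_manifold_atlas_cover[OF M])
  note Wt = topological_chartD[OF smooth_chart_topological[OF cW]]
  have "smooth_on (\<phi> ` (U \<inter> W)) (\<omega> \<circ> inv_into U \<phi>)"
    by (rule smooth_chart_transition[OF c(1) W(1)])
  then have 1: "(\<omega> \<circ> inv_into U \<phi>) differentiable (at (\<phi> x))"
    by (rule smooth_on_differentiable) (use x W in auto)
  have "smooth_on (\<omega> ` (W \<inter> V)) (\<xi> \<circ> inv_into W \<omega>)"
    by (rule smooth_chart_transition[OF c(2) W(1)])
  then have "(\<xi> \<circ> inv_into W \<omega>) differentiable (at (\<omega> x))"
    by (rule smooth_on_differentiable) (use x W in auto)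
  then have 2: "(\<xi> \<circ> inv_into W \<omega>) differentiable (at ((\<omega> \<circ> inv_into U \<phi>) (\<phi> x)))"
    using x U(3) by simp
  have "((\<xi> \<circ> inv_into W \<omega>) \<circ> (\<omega> \<circ> inv_into U \<phi>)) differentiable (at (\<phi> x))"
    by (rule differentiable_chain_at[OF 1 2])
  then obtain D where D: "((\<xi> \<circ> inv_into W \<omega>) \<circ> (\<omega> \<circ> inv_into U \<phi>) has_derivative D) (at (\<phi> x))"
    unfolding differentiable_def by blast
  have op: "open (\<phi> ` (U \<inter> W))" by (rule U(7)) (use U(1) Wt(1) in auto)
  have "(\<xi> \<circ> inv_into U \<phi> has_derivative D) (at (\<phi> x))"
  proof (rule has_derivative_transform_within_open[OF D op])
    show "\<phi> x \<in> \<phi> ` (U \<inter> W)" using x W by auto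
    fix z assume "z \<in> \<phi> ` (U \<inter> W)"
    then obtain y where "y \<in> U" "y \<in> W" "z = \<phi> y" by auto
    then show "((\<xi> \<circ> inv_into W \<omega>) \<circ> (\<omega> \<circ> inv_into U \<phi>)) z = (\<xi> \<circ> inv_into U \<phi>) z"
      using U(3) Wt(3) by simp
  qed
  then show ?thesis unfolding differentiable_def by blast
qed

lemma chart_negligible_transfer:
  fixes M :: "('m, 'a::euclidean_space) manifold"
  assumes M: "smooth_manifold M" and c: "smooth_chart M (U, \<phi>)" "smooth_chart M (V, \<xi>)"
    and A: "A \<subseteq> U" "A \<subseteq> V" "negligible (\<phi> ` A)"
  shows "negligible (\<xi> ` A)"
proof -
  note U = topological_chartD[OF smooth_chart_topological[OF c(1)]]
  have "negligible ((\<xi> \<circ> inv_into U \<phi>) ` (\<phi> ` A))"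
  proof (rule negligible_differentiable_image_negligible[OF order_refl A(3)])
    show "(\<xi> \<circ> inv_into U \<phi>) differentiable_on (\<phi> ` A)"
      unfolding differentiable_on_def
      using chart_transition_differentiable[OF M c] A by (auto intro: differentiable_at_withinI)
  qed
  also have "(\<xi> \<circ> inv_into U \<phi>) ` (\<phi> ` A) = \<xi> ` A"
    using A(1) U(3) by (force simp: image_image image_iff subset_iff)
  finally show ?thesis .
qed

text \<open>Null sets may be tested in finitely many charts covering the manifold, since the transition maps are
  differentiable and therefore preserve null sets.\<close>

lemma ae_on_coverI:
  fixes M :: "('m, real ^ 'n) manifold"
  assumes M: "smooth_manifold M" and I: "finite I"
    and c: "\<And>i. i \<in> I \<Longrightarrow> smooth_chart M (U i, \<phi> i)" and A: "\<And>i. i \<in> I \<Longrightarrow> A i \<subseteq> U i"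
    and cov: "carrier_of M \<subseteq> (\<Union>i\<in>I. A i)"
    and N: "\<And>i. i \<in> I \<Longrightarrow> negligible (\<phi> i ` {x \<in> A i. \<not> P x})"
  shows "ae_on M P"
  unfolding ae_on_def
proof (intro allI impI)
  fix V \<xi> assume V: "smooth_chart M (V, \<xi>)"
  note Vt = topological_chartD[OF smooth_chart_topological[OF V]]
  have "negligible (\<xi> ` {x \<in> A i \<inter> V. \<not> P x})" if i: "i \<in> I" for i
  proof (rule chart_negligible_transfer[OF M c[OF i] V])
    show "negligible (\<phi> i ` {x \<in> A i \<inter> V. \<not> P x})" by (rule negligible_subset[OF N[OF i]]) auto
  qed (use A[OF i] in auto)
  then have "negligible (\<Union>i\<in>I. \<xi> ` {x \<in> A i \<inter> V. \<not> P x})"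
    using I by (intro negligible_Union) auto
  then show "negligible (\<xi> ` {x \<in> V. \<not> P x})"
    by (rule negligible_subset) (use Vt(4) cov in blast)
qed

lemma smooth_chart_restrict:
  assumes c: "smooth_chart M (U, \<phi>)" and at: "\<forall>c\<in>Atlas M. topological_chart (Top M) c" and V: "openin (Top M) V" "V \<subseteq> U"
  shows "smooth_chart M (V, \<phi>)"
proof -
  note U = topological_chartD[OF smooth_chart_topological[OF c]]
  have h: "homeomorphic_map (subtopology (Top M) U) (top_of_set (\<phi> ` U)) \<phi>"
    using c by (auto simp: smooth_chart_def topological_chart_def)
  have "homeomorphic_map (subtopology (subtopology (Top M) U) V) (subtopology (top_of_set (\<phi> ` U)) (\<phi> ` V)) \<phi>"
    by (rule homeomorphic_map_subtopologies[OF h]) (use V U(4) in auto)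
  then have "homeomorphic_map (subtopology (Top M) V) (top_of_set (\<phi> ` V)) \<phi>"
    using V(2) by (simp add: subtopology_subtopology inf.absorb2 image_mono)
  then have t: "topological_chart (Top M) (V, \<phi>)"
    using V U(7)[OF V] by (simp add: topological_chart_def)
  have "smooth_transition (V, \<phi>) (W, \<omega>) \<and> smooth_transition (W, \<omega>) (V, \<phi>)" if W: "(W, \<omega>) \<in> Atlas M" for W \<omega>
  proof
    have Wo: "openin (Top M) W" using at W topological_chartD(1) by blast
    note r = smooth_chart_transition(2)[OF c W]
    have "smooth_on (\<phi> ` (V \<inter> W)) (\<omega> \<circ> inv_into U \<phi>)"
      by (rule smooth_on_subset[OF smooth_chart_transition(1)[OF c W]]) (use V in auto)
    moreover have "(\<omega> \<circ> inv_into U \<phi>) z = (\<omega> \<circ> inv_into V \<phi>) z" if "z \<in> \<phi> ` (V \<inter> W)" for z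
      using inv_into_restrict[OF U(3) V(2), of z] that by auto
    moreover have "open (\<phi> ` (V \<inter> W))" by (rule U(7)) (use V Wo in auto)
    ultimately show "smooth_transition (V, \<phi>) (W, \<omega>)"
      unfolding smooth_transition_def using smooth_on_cong by (metis (no_types, lifting) case_prod_conv)
    show "smooth_transition (W, \<omega>) (V, \<phi>)"
      unfolding smooth_transition_def using smooth_on_subset[OF r] V(2) by (simp add: image_mono inf.coboundedI2 inf_mono)
  qed
  then show ?thesis using t unfolding smooth_chart_def by auto
qed

lemma smooth_chart_open_submanifold_iff:
  assumes at: "\<forall>c\<in>Atlas M. topological_chart (Top M) c" and S: "openin (Top M) S"
  shows "smooth_chart (open_submanifold M S) (U, \<phi>) \<longleftrightarrow> smooth_chart M (U, \<phi>) \<and> U \<subseteq> S"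
proof -
  have t: "topological_chart (subtopology (Top M) S) (U, \<phi>) \<longleftrightarrow> topological_chart (Top M) (U, \<phi>) \<and> U \<subseteq> S"
    using S by (auto simp: topological_chart_def openin_open_subtopology subtopology_subtopology inf.absorb2)
  have "smooth_transition (U, \<phi>) (W \<inter> S, \<omega>) \<longleftrightarrow> smooth_transition (U, \<phi>) (W, \<omega>)"
    and "smooth_transition (W \<inter> S, \<omega>) (U, \<phi>) \<longleftrightarrow> smooth_transition (W, \<omega>) (U, \<phi>)"
    if W: "(W, \<omega>) \<in> Atlas M" and U: "topological_chart (Top M) (U, \<phi>)" "U \<subseteq> S" for W \<omega>
  proof -
    have "topological_chart (Top M) (W, \<omega>)" using at W by blast
    note Wt = topological_chartD[OF this]
    have e: "U \<inter> (W \<inter> S) = U \<inter> W" "W \<inter> S \<inter> U = W \<inter> U" using U(2) by auto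
    show "smooth_transition (U, \<phi>) (W \<inter> S, \<omega>) \<longleftrightarrow> smooth_transition (U, \<phi>) (W, \<omega>)"
      by (simp add: smooth_transition_def e)
    have "open (\<omega> ` (W \<inter> U))" by (rule Wt(7)) (use Wt(1) topological_chartD(1)[OF U(1)] in auto)
    moreover have "(\<phi> \<circ> inv_into (W \<inter> S) \<omega>) z = (\<phi> \<circ> inv_into W \<omega>) z" if "z \<in> \<omega> ` (W \<inter> U)" for z
      using inv_into_restrict[OF Wt(3), of "W \<inter> S" z] that U(2) by auto
    ultimately show "smooth_transition (W \<inter> S, \<omega>) (U, \<phi>) \<longleftrightarrow> smooth_transition (W, \<omega>) (U, \<phi>)"
      unfolding smooth_transition_def prod.case e by (rule smooth_on_cong)
  qed
  note tr = this
  have "(\<forall>d\<in>Atlas (open_submanifold M S). smooth_transition (U, \<phi>) d \<and> smooth_transition d (U, \<phi>)) \<longleftrightarrow>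
      (\<forall>d\<in>Atlas M. smooth_transition (U, \<phi>) d \<and> smooth_transition d (U, \<phi>))"
    if U: "topological_chart (Top M) (U, \<phi>)" "U \<subseteq> S"
    unfolding open_submanifold_def manifold.simps ball_simps
  proof (rule ball_cong[OF refl])
    fix d assume "d \<in> Atlas M"
    then show "smooth_transition (U, \<phi>) (case d of (W, \<omega>) \<Rightarrow> (W \<inter> S, \<omega>)) \<and> smooth_transition (case d of (W, \<omega>) \<Rightarrow> (W \<inter> S, \<omega>)) (U, \<phi>)
      \<longleftrightarrow> smooth_transition (U, \<phi>) d \<and> smooth_transition d (U, \<phi>)"
      using tr[OF _ U] by (cases d) simp
  qed
  then show ?thesis
    using t unfolding smooth_chart_def by (auto simp: open_submanifold_def)
qed

section \<open>Local frames and fibre norms\<close>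

lemma smooth_manifold_atlas_topological: "smooth_manifold M \<Longrightarrow> \<forall>c\<in>Atlas M. topological_chart (Top M) c"
  by (auto simp: smooth_manifold_def smooth_chart_def)

lemma carrier_restrict_total: "carrier_of (restrict_total E U) = {v \<in> carrier_of (total E). bproj E v \<in> U}"
  by (auto simp: restrict_total_def open_submanifold_def)

lemma carrier_trivial_product:
  "carrier_of (prod_manifold (open_submanifold M U) euclidean_manifold) = (carrier_of M \<inter> U) \<times> UNIV"
  by (auto simp: prod_manifold_def open_submanifold_def euclidean_manifold_def)

lemma smooth_map_in_carrier:
  assumes "smooth_map M N f" "x \<in> carrier_of M"
  shows "f x \<in> carrier_of N"
  using continuous_map_image_subset_topspace[OF smooth_map_continuous_map[OF assms(1)]] assms(2) by auto

text \<open>The inverse diffeomorphism; its values at \<open>(x, w)\<close> for fixed \<open>w\<close> form the local frames used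
  below.\<close>

lemma trivialization_inverse:
  assumes "trivialization M E U \<rho>"
  obtains h where "smooth_map (prod_manifold (open_submanifold M U) euclidean_manifold) (restrict_total E U) h"
    and "\<And>x w. x \<in> U \<Longrightarrow> h (x, w) \<in> fibre E x" "\<And>x w. x \<in> U \<Longrightarrow> \<rho> (h (x, w)) = w"
    and "\<And>x v. x \<in> U \<Longrightarrow> v \<in> fibre E x \<Longrightarrow> h (x, \<rho> v) = v"
proof -
  have U: "openin (Top M) U" and d: "diffeomorphism (restrict_total E U) (prod_manifold (open_submanifold M U) euclidean_manifold) (\<lambda>v. (bproj E v, \<rho> v))"
    using assms by (auto simp: trivialization_def)
  obtain h where h: "smooth_map (prod_manifold (open_submanifold M U) euclidean_manifold) (restrict_total E U) h"
    and hl: "\<And>v. v \<in> carrier_of (restrict_total E U) \<Longrightarrow> h (bproj E v, \<rho> v) = v"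
    and hr: "\<And>y. y \<in> carrier_of (prod_manifold (open_submanifold M U) euclidean_manifold) \<Longrightarrow> (bproj E (h y), \<rho> (h y)) = y"
    using d unfolding diffeomorphism_def by blast
  have UM: "U \<subseteq> carrier_of M" using U by (rule openin_subset)
  have c: "(x, w) \<in> carrier_of (prod_manifold (open_submanifold M U) euclidean_manifold)" if "x \<in> U" for x w
    using that UM by (auto simp: carrier_trivial_product)
  show ?thesis
  proof (rule that[OF h])
    show "h (x, w) \<in> fibre E x" if "x \<in> U" for x w
      using smooth_map_in_carrier[OF h c[OF that]] hr[OF c[OF that]] by (auto simp: fibre_def carrier_restrict_total)
    show "\<rho> (h (x, w)) = w" if "x \<in> U" for x w using hr[OF c[OF that]] by auto
    show "h (x, \<rho> v) = v" if "x \<in> U" "v \<in> fibre E x" for x v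
      using hl[of v] that by (auto simp: fibre_def carrier_restrict_total)
  qed
qed

lemma smooth_on_Pair_const: "open S \<Longrightarrow> smooth_on S (\<lambda>z::'a::euclidean_space. (z, w :: 'b::euclidean_space))"
proof -
  assume S: "open S"
  have "bounded_linear (\<lambda>z::'a. (z, 0 :: 'b))" by (intro bounded_linear_Pair bounded_linear_ident bounded_linear_zero)
  then have "smooth_on S (\<lambda>z::'a. (z, 0 :: 'b) + (0, w))"
    using S unfolding smooth_on_def by (intro allI Ck_on_add Ck_on_linear Ck_on_const)
  then show ?thesis by simp
qed

text \<open>A smooth map comes with some charts of the product \<open>U \<times> \<real>\<^sup>r\<close>, which need not be products.
  Passing to a product of a chart of \<open>M\<close> with the identity, by a smooth transition map, makes the inclusion
  \<open>x \<mapsto> (x, w)\<close> affine in coordinates.\<close>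

lemma constant_frame_smooth:
  fixes M :: "('m, real ^ 'n) manifold" and E :: "('e, 'm, (real ^ 'n) \<times> (real ^ 'r)) vector_bundle"
  assumes M: "smooth_manifold M" and E: "smooth_vector_bundle M E" and U: "openin (Top M) U"
    and h: "smooth_map (prod_manifold (open_submanifold M U) euclidean_manifold) (restrict_total E U) h"
    and fib: "\<And>x w. x \<in> U \<Longrightarrow> h (x, w) \<in> fibre E x"
  shows "smooth_section M E U (\<lambda>x. h (x, w :: real ^ 'r))"
proof -
  let ?N = "prod_manifold (open_submanifold M U) (euclidean_manifold :: (real ^ 'r, real ^ 'r) manifold)"
  have T: "smooth_manifold (total E)" and \<pi>: "smooth_map (total E) M (bproj E)"
    using E by (auto simp: smooth_vector_bundle_def)
  let ?S = "{v \<in> carrier_of (total E). bproj E v \<in> U}"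
  have So: "openin (Top (total E)) ?S"
    by (rule openin_continuous_map_preimage[OF smooth_map_continuous_map[OF \<pi>] U])
  have UM: "U \<subseteq> carrier_of M" using U by (rule openin_subset)
  have "smooth_map (open_submanifold M U) (total E) (\<lambda>x. h (x, w))"
    unfolding smooth_map_def
  proof
    fix x assume "x \<in> carrier_of (open_submanifold M U)"
    then have x: "x \<in> U" "x \<in> carrier_of M" by (auto simp: open_submanifold_def)
    have "(x, w) \<in> carrier_of ?N" using x by (simp add: carrier_trivial_product)
    then obtain W \<kappa> V \<omega> where W: "smooth_chart ?N (W, \<kappa>)" and V: "smooth_chart (restrict_total E U) (V, \<omega>)"
      and xW: "(x, w) \<in> W" and hW: "h ` W \<subseteq> V" and sm: "smooth_on (\<kappa> ` W) (\<omega> \<circ> h \<circ> inv_into W \<kappa>)"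
      using h unfolding smooth_map_def by blast
    note Wt = topological_chartD[OF smooth_chart_topological[OF W]]
    obtain Ua \<phi> where Ua: "(Ua, \<phi>) \<in> Atlas M" "x \<in> Ua" "smooth_chart M (Ua, \<phi>)"
      by (rule smooth_manifold_atlas_cover[OF M x(2)])
    note Ut = topological_chartD[OF smooth_chart_topological[OF Ua(3)]]
    let ?X = "(Ua \<inter> U) \<times> (UNIV :: (real ^ 'r) set)" and ?m = "map_prod \<phi> (id :: real ^ 'r \<Rightarrow> real ^ 'r)"
    have a1: "(Ua \<inter> U, \<phi>) \<in> Atlas (open_submanifold M U)"
      unfolding open_submanifold_def manifold.simps by (rule image_eqI[OF _ Ua(1)]) simp
    have a2: "(UNIV, id) \<in> Atlas (euclidean_manifold :: (real ^ 'r, real ^ 'r) manifold)"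
      by (simp add: euclidean_manifold_def)
    have "(?X, ?m) \<in> Atlas ?N"
      unfolding prod_manifold_def manifold.simps using a1 a2 by blast
    from smooth_chart_transition(2)[OF W this]
    have tr: "smooth_on (?m ` (?X \<inter> W)) (\<kappa> \<circ> inv_into ?X ?m)" .
    define B where "B = {y \<in> Ua \<inter> U. (y, w) \<in> W}"
    have "continuous_map (subtopology (Top M) U) (prod_topology (subtopology (Top M) U) euclidean) (\<lambda>y. (y, w))"
      by (rule continuous_map_pairedI) (simp_all add: continuous_map_id[unfolded id_def])
    moreover have "openin (prod_topology (subtopology (Top M) U) euclidean) W"
      using Wt(1) by (simp add: prod_manifold_def open_submanifold_def euclidean_manifold_def)
    ultimately have "openin (subtopology (Top M) U) {y \<in> topspace (subtopology (Top M) U). (y, w) \<in> W}"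
      by (rule openin_continuous_map_preimage)
    then have "openin (Top M) {y \<in> topspace (subtopology (Top M) U). (y, w) \<in> W}"
      using U by (simp add: openin_open_subtopology)
    then have "openin (Top M) (Ua \<inter> {y \<in> topspace (subtopology (Top M) U). (y, w) \<in> W})"
      using Ut(1) by blast
    also have "Ua \<inter> {y \<in> topspace (subtopology (Top M) U). (y, w) \<in> W} = B"
      using UM by (auto simp: B_def)
    finally have Bo: "openin (Top M) B" .
    have B: "B \<subseteq> Ua" "B \<subseteq> U" "x \<in> B" using x Ua(2) xW by (auto simp: B_def)
    have cB: "smooth_chart (open_submanifold M U) (B, \<phi>)"
      using smooth_chart_restrict[OF Ua(3) smooth_manifold_atlas_topological[OF M] Bo B(1)] B(2)
      by (simp add: smooth_chart_open_submanifold_iff[OF smooth_manifold_atlas_topological[OF M] U])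
    have cV: "smooth_chart (total E) (V, \<omega>)"
      using V smooth_chart_open_submanifold_iff[OF smooth_manifold_atlas_topological[OF T] So]
      by (simp add: restrict_total_def)
    have \<phi>B: "open (\<phi> ` B)" by (rule Ut(7)[OF Bo B(1)])
    have injm: "inj_on ?m ?X" using Ut(3) by (auto simp: inj_on_def)
    have inv_m: "inv_into ?X ?m (\<phi> y, w) = (y, w)" if "y \<in> B" for y
    proof -
      have "(y, w) \<in> ?X" using that B by auto
      from inv_into_f_f[OF injm this] show ?thesis by simp
    qed
    have s1: "smooth_on (\<phi> ` B) (\<lambda>z. (\<kappa> \<circ> inv_into ?X ?m) (z, w))"
    proof (rule smooth_on_compose[OF \<phi>B _ tr smooth_on_Pair_const[OF \<phi>B]])
      show "(\<lambda>z. (z, w)) ` \<phi> ` B \<subseteq> ?m ` (?X \<inter> W)"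
      proof clarify
        fix y assume "y \<in> B"
        then have "(y, w) \<in> ?X \<inter> W" by (auto simp: B_def)
        then have "?m (y, w) \<in> ?m ` (?X \<inter> W)" by (rule imageI)
        then show "(\<phi> y, w) \<in> ?m ` (?X \<inter> W)" by simp
      qed
    qed
    have s2: "smooth_on (\<phi> ` B) (\<lambda>z. (\<omega> \<circ> h \<circ> inv_into W \<kappa>) ((\<kappa> \<circ> inv_into ?X ?m) (z, w)))"
    proof (rule smooth_on_compose[OF \<phi>B _ sm s1])
      show "(\<lambda>z. (\<kappa> \<circ> inv_into ?X ?m) (z, w)) ` \<phi> ` B \<subseteq> \<kappa> ` W"
        using inv_m by (auto simp: B_def)
    qed
    have "smooth_on (\<phi> ` B) (\<omega> \<circ> (\<lambda>x. h (x, w)) \<circ> inv_into B \<phi>)"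
    proof (rule smooth_on_cong[THEN iffD1, OF \<phi>B _ s2])
      fix z assume "z \<in> \<phi> ` B"
      then obtain y where y: "y \<in> B" "z = \<phi> y" by auto
      have "inv_into W \<kappa> (\<kappa> (y, w)) = (y, w)" using y(1) Wt(3) by (auto simp: B_def)
      moreover have "inv_into B \<phi> (\<phi> y) = y" using y(1) Ut(3) B(1) by (meson inj_on_subset inv_into_f_f)
      ultimately show "(\<omega> \<circ> h \<circ> inv_into W \<kappa>) ((\<kappa> \<circ> inv_into ?X ?m) (z, w)) = (\<omega> \<circ> (\<lambda>x. h (x, w)) \<circ> inv_into B \<phi>) z"
        using inv_m[OF y(1)] y(2) by simp
    qed
    moreover have "(\<lambda>x. h (x, w)) ` B \<subseteq> V" using hW by (auto simp: B_def)
    ultimately show "\<exists>U' \<phi> V \<psi>. smooth_chart (open_submanifold M U) (U', \<phi>) \<and> smooth_chart (total E) (V, \<psi>) \<and> x \<in> U' \<and>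
        (\<lambda>x. h (x, w)) ` U' \<subseteq> V \<and> smooth_on (\<phi> ` U') (\<psi> \<circ> (\<lambda>x. h (x, w)) \<circ> inv_into U' \<phi>)"
      using cB cV B(3) by blast
  qed
  then show ?thesis using fib by (simp add: smooth_section_def section_over_def)
qed

lemma real_valued_bounded_on_compactin:
  assumes "continuous_map (subtopology X U) euclidean f" "compactin X K" "K \<subseteq> U"
  shows "\<exists>B::real. \<forall>x\<in>K. \<bar>f x\<bar> \<le> B"
proof -
  have "compact (f ` K)"
    using image_compactin[of "subtopology X U" K euclidean f] assms by (simp add: compactin_subtopology)
  then have "bounded (f ` K)" by (rule compact_imp_bounded)
  then show ?thesis by (auto simp: bounded_iff)
qed

text \<open>The metric is smooth only when evaluated on smooth sections, so it is expanded in the frame given by the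
  trivialization: its coefficients in that frame are smooth functions on \<open>U\<close>, hence bounded on \<open>K\<close>.\<close>

lemma fiber_norm_bound:
  fixes M :: "('m, real ^ 'n) manifold" and E :: "('e, 'm, (real ^ 'n) \<times> (real ^ 'r)) vector_bundle"
  assumes M: "smooth_manifold M" and E: "smooth_vector_bundle M E" and g: "fiber_metric M E g"
    and tr: "trivialization M E U \<rho>" and K: "compactin (Top M) K" "K \<subseteq> U"
  shows "\<exists>B\<ge>0. \<forall>x\<in>K. \<forall>v\<in>fibre E x. fiber_norm g v \<le> B * (\<Sum>l\<in>UNIV. \<bar>\<rho> v $ l\<bar>)"
proof -
  obtain h where h: "smooth_map (prod_manifold (open_submanifold M U) euclidean_manifold) (restrict_total E U) h"
    and fib: "\<And>x w. x \<in> U \<Longrightarrow> h (x, w) \<in> fibre E x" and \<rho>h: "\<And>x w. x \<in> U \<Longrightarrow> \<rho> (h (x, w)) = w"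
    and h\<rho>: "\<And>x v. x \<in> U \<Longrightarrow> v \<in> fibre E x \<Longrightarrow> h (x, \<rho> v) = v"
    using trivialization_inverse[OF tr] by metis
  have U: "openin (Top M) U" and iso: "\<And>x. x \<in> U \<Longrightarrow> fibre_iso E x \<rho>" using tr by (auto simp: trivialization_def)
  have UM: "U \<subseteq> carrier_of M" using U by (rule openin_subset)
  let ?e = "\<lambda>l::'r. axis l (1::real)"
  have "\<exists>B. \<forall>x\<in>K. \<bar>g (h (x, ?e l)) (h (x, ?e m))\<bar> \<le> B" for l m
  proof -
    have "smooth_map (open_submanifold M U) euclidean_manifold (\<lambda>x. g (h (x, ?e l)) (h (x, ?e m)))"
      using g U constant_frame_smooth[OF M E U h fib] unfolding fiber_metric_def by blast
    from smooth_map_continuous_map[OF this]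
    have "continuous_map (subtopology (Top M) U) euclidean (\<lambda>x. g (h (x, ?e l)) (h (x, ?e m)))"
      by (simp add: open_submanifold_def euclidean_manifold_def)
    then show ?thesis by (rule real_valued_bounded_on_compactin[OF _ K])
  qed
  note ex_bound = this
  define b where "b l m = (SOME B. \<forall>x\<in>K. \<bar>g (h (x, ?e l)) (h (x, ?e m))\<bar> \<le> B)" for l m
  have b: "\<bar>g (h (x, ?e l)) (h (x, ?e m))\<bar> \<le> b l m" if "x \<in> K" for l m x
    using someI_ex[OF ex_bound[of l m]] that unfolding b_def by blast
  define B where "B = (\<Sum>l\<in>UNIV. \<Sum>m\<in>UNIV. \<bar>b l m\<bar>)"
  have B0: "B \<ge> 0" by (simp add: B_def sum_nonneg)
  have bB: "\<bar>g (h (x, ?e l)) (h (x, ?e m))\<bar> \<le> B" if "x \<in> K" for x l m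
  proof -
    have "\<bar>b l m\<bar> \<le> (\<Sum>m\<in>UNIV. \<bar>b l m\<bar>)" by (rule member_le_sum) auto
    also have "\<dots> \<le> B" unfolding B_def by (rule member_le_sum[where f = "\<lambda>l. \<Sum>m\<in>UNIV. \<bar>b l m\<bar>"]) (auto simp: sum_nonneg)
    finally show ?thesis using b[OF that, of l m] by linarith
  qed
  have "fiber_norm g v \<le> sqrt B * (\<Sum>l\<in>UNIV. \<bar>\<rho> v $ l\<bar>)" if x: "x \<in> K" and v: "v \<in> fibre E x" for x v
  proof -
    have xU: "x \<in> U" and xM: "x \<in> carrier_of M" using x K UM by auto
    have vs: "real_vector_space_on (fibre E x) (fadd E) (fscale E)"
      using E xM by (simp add: smooth_vector_bundle_def)
    have add: "h (x, w + w') = fadd E (h (x, w)) (h (x, w'))" for w w'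
    proof -
      have "fadd E (h (x, w)) (h (x, w')) \<in> fibre E x"
        using vs fib[OF xU] by (simp add: real_vector_space_on_def)
      from h\<rho>[OF xU this] show ?thesis
        using iso[OF xU] fib[OF xU] \<rho>h[OF xU] by (simp add: fibre_iso_def)
    qed
    have scale: "h (x, a *\<^sub>R w) = fscale E a (h (x, w))" for a w
    proof -
      have "fscale E a (h (x, w)) \<in> fibre E x"
        using vs fib[OF xU] by (simp add: real_vector_space_on_def)
      from h\<rho>[OF xU this] show ?thesis
        using iso[OF xU] fib[OF xU] \<rho>h[OF xU] by (simp add: fibre_iso_def)
    qed
    let ?b = "\<lambda>w w'. g (h (x, w)) (h (x, w'))"
    have gx: "\<forall>u\<in>fibre E x. \<forall>v\<in>fibre E x.
        g u v = g v u \<and> (\<forall>w\<in>fibre E x. g (fadd E u v) w = g u w + g v w) \<and> (\<forall>a. g (fscale E a u) v = a * g u v)"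
      using g xM unfolding fiber_metric_def by blast
    have lin: "linear (\<lambda>w. ?b w w')" for w'
      by (rule linearI) (use gx fib[OF xU] in \<open>simp_all add: add scale\<close>)
    have sym: "?b w w' = ?b w' w" for w w' using gx fib[OF xU] by blast
    have expand: "?b w w' = (\<Sum>l\<in>UNIV. w $ l * ?b (?e l) w')" for w w'
    proof -
      have "?b w w' = ?b (\<Sum>l\<in>UNIV. (w $ l) *\<^sub>R ?e l) w'"
        using basis_expansion[of w] by (simp add: scalar_mult_eq_scaleR)
      also have "\<dots> = (\<Sum>l\<in>UNIV. w $ l * ?b (?e l) w')"
        by (simp add: linear_sum[OF lin] linear_scale[OF lin])
      finally show ?thesis .
    qed
    define w where "w = \<rho> v"
    have "?b w w = (\<Sum>l\<in>UNIV. w $ l * (\<Sum>m\<in>UNIV. w $ m * ?b (?e m) (?e l)))"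
      by (subst expand, subst sym, subst expand) simp
    also have "\<dots> \<le> (\<Sum>l\<in>UNIV. \<bar>w $ l\<bar> * (\<Sum>m\<in>UNIV. \<bar>w $ m\<bar> * B))"
    proof (rule sum_mono)
      fix l
      have "\<bar>\<Sum>m\<in>UNIV. w $ m * ?b (?e m) (?e l)\<bar> \<le> (\<Sum>m\<in>UNIV. \<bar>w $ m\<bar> * B)"
        by (rule order_trans[OF sum_abs sum_mono]) (simp add: abs_mult mult_left_mono bB[OF x])
      then have "\<bar>w $ l\<bar> * \<bar>\<Sum>m\<in>UNIV. w $ m * ?b (?e m) (?e l)\<bar> \<le> \<bar>w $ l\<bar> * (\<Sum>m\<in>UNIV. \<bar>w $ m\<bar> * B)"
        by (rule mult_left_mono) simp
      then show "w $ l * (\<Sum>m\<in>UNIV. w $ m * ?b (?e m) (?e l)) \<le> \<bar>w $ l\<bar> * (\<Sum>m\<in>UNIV. \<bar>w $ m\<bar> * B)"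
        unfolding abs_mult[symmetric] by linarith
    qed
    also have "\<dots> = B * (\<Sum>l\<in>UNIV. \<bar>w $ l\<bar>)\<^sup>2"
      by (simp add: power2_eq_square sum_distrib_left sum_distrib_right mult_ac)
    finally have "g v v \<le> B * (\<Sum>l\<in>UNIV. \<bar>w $ l\<bar>)\<^sup>2" using h\<rho>[OF xU v] by (simp add: w_def)
    then have "fiber_norm g v \<le> sqrt (B * (\<Sum>l\<in>UNIV. \<bar>w $ l\<bar>)\<^sup>2)" by (simp add: fiber_norm_def)
    also have "\<dots> = sqrt B * (\<Sum>l\<in>UNIV. \<bar>w $ l\<bar>)" by (simp add: real_sqrt_mult sum_nonneg)
    finally show ?thesis by (simp add: w_def)
  qed
  then show ?thesis using B0 by (intro exI[of _ "sqrt B"]) auto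
qed

section \<open>The embedding for sections\<close>

lemma smooth_function_continuous_map:
  "smooth_map M euclidean_manifold f \<Longrightarrow> continuous_map (Top M) euclidean f"
  using smooth_map_continuous_map[of M euclidean_manifold f] by (simp add: euclidean_manifold_def)

lemma augmented_atlas_component:
  assumes "augmented_total_trivialization_atlas M E \<Lambda>" "(U, \<phi>, \<rho>, \<psi>) \<in> set \<Lambda>"
  shows "smooth_chart M (U, \<phi>)" "trivialization M E U \<rho>" "continuous_map (Top M) euclidean \<psi>"
    and "{x \<in> carrier_of M. \<psi> x \<noteq> 0} \<subseteq> U"
proof -
  have "total_trivialization_triple M E (U, \<phi>, \<rho>) \<and> smooth_map M euclidean_manifold \<psi> \<and>
      Top M closure_of {x \<in> carrier_of M. \<psi> x \<noteq> 0} \<subseteq> U"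
    using assms unfolding augmented_total_trivialization_atlas_def by fastforce
  then show "smooth_chart M (U, \<phi>)" "trivialization M E U \<rho>" "continuous_map (Top M) euclidean \<psi>"
    and "{x \<in> carrier_of M. \<psi> x \<noteq> 0} \<subseteq> U"
    using closure_of_subset[of "{x \<in> carrier_of M. \<psi> x \<noteq> 0}" "Top M"] smooth_function_continuous_map
    by (auto simp: total_trivialization_triple_def)
qed

text \<open>The interior embedding applied to the components of \<open>\<rho> (\<psi> u)\<close> in the chart. The constant is
  independent of \<open>u\<close>.\<close>

lemma local_representative_regular:
  fixes M :: "('m, real ^ 'n) manifold" and E :: "('e, 'm, (real ^ 'n) \<times> (real ^ 'r)) vector_bundle"
    and \<Lambda> :: "('m, 'e, 'n, 'r) augmented_atlas" and s p :: real
  assumes \<Lambda>: "augmented_total_trivialization_atlas M E \<Lambda>" "(U, \<phi>, \<rho>, \<psi>) \<in> set \<Lambda>"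
    and p: "1 < p" and sp: "s * p > real CARD('n)" and A: "compactin (Top M) A" "A \<subseteq> U"
  shows "\<exists>C\<ge>0. \<forall>u. section_over E (carrier_of M) u \<and> W_norm E \<Lambda> s p u < \<infinity> \<longrightarrow>
    (\<exists>F :: real ^ 'n \<Rightarrow> real ^ 'r. continuous_on (\<phi> ` U) F \<and>
      negligible (\<phi> ` {x \<in> U. F (\<phi> x) \<noteq> \<psi> x *\<^sub>R \<rho> (u x)}) \<and>
      (\<forall>x\<in>A. \<forall>l. \<bar>F (\<phi> x) $ l\<bar> \<le> C * enn2real (W_norm E \<Lambda> s p u)))"
proof -
  note q = augmented_atlas_component[OF \<Lambda>]
  note Ut = topological_chartD[OF smooth_chart_topological[OF q(1)]]
  have iso: "fibre_iso E x \<rho>" if "x \<in> U" for x using q(2) that by (simp add: trivialization_def)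
  have "compact (\<phi> ` A)"
    using image_compactin[of "subtopology (Top M) U" A euclidean \<phi>] Ut(5) A by (simp add: compactin_subtopology)
  moreover have "\<phi> ` A \<subseteq> \<phi> ` U" using A(2) by (rule image_mono)
  ultimately have "\<exists>C\<ge>0. \<forall>f. Wsp_norm s p (\<phi> ` U) f < \<infinity> \<longrightarrow>
    (\<exists>F. continuous_on (\<phi> ` U) F \<and> negligible {z \<in> \<phi> ` U. f z \<noteq> F z} \<and>
      (\<forall>z\<in>\<phi> ` A. \<bar>F z\<bar> \<le> C * enn2real (Wsp_norm s p (\<phi> ` U) f)))"
    by (rule sobolev_embedding_interior[OF Ut(2) p sp])
  then obtain C where C: "C \<ge> 0" "\<forall>f. Wsp_norm s p (\<phi> ` U) f < \<infinity> \<longrightarrow>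
    (\<exists>F. continuous_on (\<phi> ` U) F \<and> negligible {z \<in> \<phi> ` U. f z \<noteq> F z} \<and>
      (\<forall>z\<in>\<phi> ` A. \<bar>F z\<bar> \<le> C * enn2real (Wsp_norm s p (\<phi> ` U) f)))" by (elim exE conjE) (rule that)
  show ?thesis
  proof (intro exI[of _ C] conjI C(1) allI impI, elim conjE)
    fix u assume u: "section_over E (carrier_of M) u" and fin: "W_norm E \<Lambda> s p u < \<infinity>"
    define f where "f l z = \<rho> (fscale E (\<psi> (inv_into U \<phi> z)) (u (inv_into U \<phi> z))) $ l" for l z
    have "(\<Sum>l\<in>UNIV. Wsp_norm s p (\<phi> ` U) (f l)) \<in> set (map (\<lambda>(U, \<phi>, \<rho>, \<psi>). \<Sum>l\<in>UNIV.
       Wsp_norm s p (\<phi> ` U) (\<lambda>z. let x = inv_into U \<phi> z in \<rho> (fscale E (\<psi> x) (u x)) $ l)) \<Lambda>)"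
      unfolding set_map by (rule image_eqI[OF _ \<Lambda>(2)]) (simp add: f_def[abs_def] Let_def)
    from member_le_sum_list[OF this]
    have "(\<Sum>l\<in>UNIV. Wsp_norm s p (\<phi> ` U) (f l)) \<le> W_norm E \<Lambda> s p u" by (simp add: W_norm_def)
    moreover have "Wsp_norm s p (\<phi> ` U) (f l) \<le> (\<Sum>l\<in>UNIV. Wsp_norm s p (\<phi> ` U) (f l))" for l
      by (rule member_le_sum[where f = "\<lambda>l. Wsp_norm s p (\<phi> ` U) (f l)"]) auto
    ultimately have le: "Wsp_norm s p (\<phi> ` U) (f l) \<le> W_norm E \<Lambda> s p u" for l by (rule order_trans[rotated])
    then have finl: "Wsp_norm s p (\<phi> ` U) (f l) < \<infinity>" for l using fin by (rule le_less_trans)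
    have "\<forall>l. \<exists>F. continuous_on (\<phi> ` U) F \<and> negligible {z \<in> \<phi> ` U. f l z \<noteq> F z} \<and>
      (\<forall>z\<in>\<phi> ` A. \<bar>F z\<bar> \<le> C * enn2real (Wsp_norm s p (\<phi> ` U) (f l)))" by (intro allI C(2)[rule_format] finl)
    from choice[OF this] obtain F where F: "\<And>l. continuous_on (\<phi> ` U) (F l)"
      "\<And>l. negligible {z \<in> \<phi> ` U. f l z \<noteq> F l z}"
      "\<And>l z. z \<in> \<phi> ` A \<Longrightarrow> \<bar>F l z\<bar> \<le> C * enn2real (Wsp_norm s p (\<phi> ` U) (f l))" by blast
    show "\<exists>F :: real ^ 'n \<Rightarrow> real ^ 'r. continuous_on (\<phi> ` U) F \<and>
      negligible (\<phi> ` {x \<in> U. F (\<phi> x) \<noteq> \<psi> x *\<^sub>R \<rho> (u x)}) \<and>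
      (\<forall>x\<in>A. \<forall>l. \<bar>F (\<phi> x) $ l\<bar> \<le> C * enn2real (W_norm E \<Lambda> s p u))"
    proof (intro exI[of _ "\<lambda>z. \<chi> l. F l z"] conjI ballI allI)
      show "continuous_on (\<phi> ` U) (\<lambda>z. \<chi> l. F l z)" by (intro continuous_on_vec_lambda F(1))
      have "negligible (\<Union>l\<in>UNIV. {z \<in> \<phi> ` U. f l z \<noteq> F l z})"
        by (intro negligible_Union) (auto simp: F(2))
      moreover have "\<phi> ` {x \<in> U. (\<chi> l. F l (\<phi> x)) \<noteq> \<psi> x *\<^sub>R \<rho> (u x)} \<subseteq> (\<Union>l\<in>UNIV. {z \<in> \<phi> ` U. f l z \<noteq> F l z})"
      proof clarify
        fix x assume x: "x \<in> U" and ne: "(\<chi> l. F l (\<phi> x)) \<noteq> \<psi> x *\<^sub>R \<rho> (u x)"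
        then obtain l where l: "F l (\<phi> x) \<noteq> (\<psi> x *\<^sub>R \<rho> (u x)) $ l" by (auto simp: vec_eq_iff)
        have "u x \<in> fibre E x" using u x Ut(4) by (auto simp: section_over_def)
        then have "f l (\<phi> x) = (\<psi> x *\<^sub>R \<rho> (u x)) $ l"
          using iso[OF x] Ut(3) x by (simp add: f_def fibre_iso_def)
        then show "\<phi> x \<in> (\<Union>l\<in>UNIV. {z \<in> \<phi> ` U. f l z \<noteq> F l z})"
          using l x by (intro UN_I[of l]) auto
      qed
      ultimately show "negligible (\<phi> ` {x \<in> U. (\<chi> l. F l (\<phi> x)) \<noteq> \<psi> x *\<^sub>R \<rho> (u x)})"
        by (rule negligible_subset)
      fix x l assume "x \<in> A"
      then have "\<bar>F l (\<phi> x)\<bar> \<le> C * enn2real (Wsp_norm s p (\<phi> ` U) (f l))" by (intro F(3)) auto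
      also have "\<dots> \<le> C * enn2real (W_norm E \<Lambda> s p u)"
        using le[of l] fin by (intro mult_left_mono C(1) enn2real_mono) auto
      finally show "\<bar>(\<chi> l. F l (\<phi> x)) $ l\<bar> \<le> C * enn2real (W_norm E \<Lambda> s p u)" by simp
    qed
  qed
qed

text \<open>Where \<open>\<psi>\<close> does not vanish, \<open>u\<close> is recovered from \<open>\<psi> u\<close> by division.\<close>

lemma local_continuous_version:
  fixes M :: "('m, real ^ 'n) manifold" and E :: "('e, 'm, (real ^ 'n) \<times> (real ^ 'r)) vector_bundle"
    and \<Lambda> :: "('m, 'e, 'n, 'r) augmented_atlas" and s p :: real
  assumes \<Lambda>: "augmented_total_trivialization_atlas M E \<Lambda>" "(U, \<phi>, \<rho>, \<psi>) \<in> set \<Lambda>"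
    and p: "1 < p" and sp: "s * p > real CARD('n)"
    and u: "section_over E (carrier_of M) u" "W_norm E \<Lambda> s p u < \<infinity>"
  defines "V \<equiv> {x \<in> carrier_of M. \<psi> x \<noteq> 0}"
  shows "\<exists>v. continuous_map (subtopology (Top M) V) (Top (total E)) v \<and> (\<forall>x\<in>V. v x \<in> fibre E x) \<and>
    negligible (\<phi> ` {x \<in> V. u x \<noteq> v x})"
proof -
  note q = augmented_atlas_component[OF \<Lambda>]
  note Ut = topological_chartD[OF smooth_chart_topological[OF q(1)]]
  have VU: "V \<subseteq> U" using q(4) by (simp add: V_def)
  have "\<exists>F :: real ^ 'n \<Rightarrow> real ^ 'r. continuous_on (\<phi> ` U) F \<and> negligible (\<phi> ` {x \<in> U. F (\<phi> x) \<noteq> \<psi> x *\<^sub>R \<rho> (u x)})"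
    using local_representative_regular[OF \<Lambda> p sp, of "{}"] u by auto
  then obtain F :: "real ^ 'n \<Rightarrow> real ^ 'r" where F: "continuous_on (\<phi> ` U) F" "negligible (\<phi> ` {x \<in> U. F (\<phi> x) \<noteq> \<psi> x *\<^sub>R \<rho> (u x)})"
    by blast
  obtain h where h: "smooth_map (prod_manifold (open_submanifold M U) euclidean_manifold) (restrict_total E U) h"
    and fib: "\<And>x w. x \<in> U \<Longrightarrow> h (x, w) \<in> fibre E x"
    and h\<rho>: "\<And>x v. x \<in> U \<Longrightarrow> v \<in> fibre E x \<Longrightarrow> h (x, \<rho> v) = v"
    using trivialization_inverse[OF q(2)] by metis
  have hc: "continuous_map (prod_topology (subtopology (Top M) U) euclidean) (Top (total E)) h"
    using smooth_map_continuous_map[OF h]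
    by (auto simp: prod_manifold_def open_submanifold_def euclidean_manifold_def restrict_total_def
        intro: continuous_map_into_fulltopology)
  let ?X = "subtopology (Top M) V"
  define v where "v x = h (x, (1 / \<psi> x) *\<^sub>R F (\<phi> x))" for x
  have "continuous_map ?X (subtopology (Top M) U) (\<lambda>x. x)"
    using VU by (auto simp: continuous_map_in_subtopology intro: continuous_map_from_subtopology continuous_map_id[unfolded id_def])
  moreover have "continuous_map ?X euclidean (\<lambda>x. (1 / \<psi> x) *\<^sub>R F (\<phi> x))"
  proof -
    have "continuous_map ?X euclidean \<phi>"
      using Ut(5) VU by (rule continuous_map_from_subtopology_mono)
    then have "continuous_map ?X (top_of_set (\<phi> ` U)) \<phi>" using VU by (auto simp: continuous_map_in_subtopology)
    then have "continuous_map ?X euclidean (F \<circ> \<phi>)"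
      by (rule continuous_map_compose) (use F(1) in simp)
    moreover have "continuous_map ?X euclideanreal (\<lambda>x. 1 / \<psi> x)"
      by (intro continuous_map_real_divide continuous_map_from_subtopology[OF q(3)]) (auto simp: V_def)
    ultimately have "continuous_map ?X (prod_topology euclideanreal euclidean) (\<lambda>x. (1 / \<psi> x, (F \<circ> \<phi>) x))"
      by (intro continuous_map_pairedI)
    moreover have "continuous_map (prod_topology euclideanreal euclidean) euclidean (\<lambda>(a, w :: real ^ 'r). a *\<^sub>R w)"
      by (simp add: euclidean_product_topology split_beta continuous_on_scaleR continuous_on_fst continuous_on_snd)
    ultimately have "continuous_map ?X euclidean ((\<lambda>(a, w). a *\<^sub>R w) \<circ> (\<lambda>x. (1 / \<psi> x, (F \<circ> \<phi>) x)))"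
      by (rule continuous_map_compose)
    then show ?thesis by (simp add: o_def)
  qed
  ultimately have "continuous_map ?X (prod_topology (subtopology (Top M) U) euclidean) (\<lambda>x. (x, (1 / \<psi> x) *\<^sub>R F (\<phi> x)))"
    by (rule continuous_map_pairedI)
  from continuous_map_compose[OF this hc] have "continuous_map ?X (Top (total E)) v"
    by (simp add: v_def[abs_def] o_def)
  moreover have "v x \<in> fibre E x" if "x \<in> V" for x unfolding v_def using fib that VU by blast
  moreover have "negligible (\<phi> ` {x \<in> V. u x \<noteq> v x})"
  proof (rule negligible_subset[OF F(2)], rule image_mono, clarify, intro conjI notI)
    fix x assume x: "x \<in> V" and ne: "u x \<noteq> v x"
    show xU: "x \<in> U" using x VU by auto
    assume "F (\<phi> x) = \<psi> x *\<^sub>R \<rho> (u x)"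
    then have "(1 / \<psi> x) *\<^sub>R F (\<phi> x) = \<rho> (u x)" using x by (simp add: V_def)
    moreover have "u x \<in> fibre E x" using u(1) x by (simp add: section_over_def V_def)
    ultimately show False using ne h\<rho>[OF xU] by (simp add: v_def)
  qed
  ultimately show ?thesis by blast
qed

theorem theorem9p14:
  fixes M :: "('m, real ^ 'n) manifold"
    and E :: "('e, 'm, (real ^ 'n) \<times> (real ^ 'r)) vector_bundle"
    and g :: "'e \<Rightarrow> 'e \<Rightarrow> real"
    and \<Lambda> :: "('m, 'e, 'n, 'r) augmented_atlas"
    and s p :: real
  assumes "smooth_manifold M" and "compact_space (Top M)"
    and "smooth_vector_bundle M E"
    and "fiber_metric M E g"
    and "augmented_total_trivialization_atlas M E \<Lambda>"
    and "1 < p"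
    and "s * p > real CARD('n)"
  shows "continuously_included (W_sections M E g \<Lambda> s p) (W_norm E \<Lambda> s p)
           (Linf_sections M E g) (Linf_norm M g) \<and>
         (\<forall>u\<in>W_sections M E g \<Lambda> s p.
            \<exists>v. continuous_section M E v \<and> ae_on M (\<lambda>x. u x = v x))"
proof -
  note M = assms(1) and K = assms(2) and E = assms(3) and g = assms(4) and \<Lambda> = assms(5) and p = assms(6) and sp = assms(7)
  let ?X = "W_sections M E g \<Lambda> s p" and ?W = "W_norm E \<Lambda> s p"
  \<comment> \<open>The four components of a member of \<open>\<Lambda>\<close>.\<close>
  define dom :: "'m set \<times> ('m \<Rightarrow> real ^ 'n) \<times> ('e \<Rightarrow> real ^ 'r) \<times> ('m \<Rightarrow> real) \<Rightarrow> 'm set" where "dom q = fst q" for q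
  define chart :: "'m set \<times> ('m \<Rightarrow> real ^ 'n) \<times> ('e \<Rightarrow> real ^ 'r) \<times> ('m \<Rightarrow> real) \<Rightarrow> 'm \<Rightarrow> real ^ 'n" where "chart q = fst (snd q)" for q
  define triv :: "'m set \<times> ('m \<Rightarrow> real ^ 'n) \<times> ('e \<Rightarrow> real ^ 'r) \<times> ('m \<Rightarrow> real) \<Rightarrow> 'e \<Rightarrow> real ^ 'r" where "triv q = fst (snd (snd q))" for q
  define weight :: "'m set \<times> ('m \<Rightarrow> real ^ 'n) \<times> ('e \<Rightarrow> real ^ 'r) \<times> ('m \<Rightarrow> real) \<Rightarrow> 'm \<Rightarrow> real" where "weight q = snd (snd (snd q))" for q
  have q_eq: "(dom q, chart q, triv q, weight q) = q" for q by (simp add: dom_def chart_def triv_def weight_def)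
  have mem: "(dom q, chart q, triv q, weight q) \<in> set \<Lambda>" if "q \<in> set \<Lambda>" for q using that q_eq by simp
  note comp = augmented_atlas_component[OF \<Lambda> mem]
  have sec: "section_over E (carrier_of M) u" and fin: "?W u < \<infinity>" and meas: "measurable_section M E u" if "u \<in> ?X" for u
    using that by (auto simp: W_sections_def Lp_sections_def measurable_section_def)
  have sum1: "(\<Sum>q\<leftarrow>\<Lambda>. weight q x) = 1" if "x \<in> carrier_of M" for x
  proof -
    have "(\<Sum>(U, \<phi>, \<rho>, \<psi>)\<leftarrow>\<Lambda>. \<psi> x) = 1"
      using \<Lambda> that unfolding augmented_total_trivialization_atlas_def by blast
    also have "(\<lambda>(U, \<phi>, \<rho>, \<psi>). \<psi> x) = (\<lambda>q. weight q x)" by (auto simp: weight_def)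
    finally show ?thesis .
  qed
  \<comment> \<open>If all weights at a point were below \<open>c\<close>, they could not add up to \<open>1\<close>.\<close>
  define c where "c = 1 / (real (length \<Lambda>) + 1)"
  have c: "c > 0" by (simp add: c_def)
  have big: "\<exists>q\<in>set \<Lambda>. weight q x \<ge> c" if "x \<in> carrier_of M" for x
  proof (rule ccontr)
    assume "\<not> ?thesis"
    then have "(\<Sum>q\<leftarrow>\<Lambda>. weight q x) \<le> (\<Sum>q\<leftarrow>\<Lambda>. c)" by (intro sum_list_mono) force
    also have "\<dots> < 1" by (simp add: sum_list_triv c_def field_simps)
    finally show False using sum1[OF that] by simp
  qed
  define A where "A q = {x \<in> carrier_of M. weight q x \<ge> c}" for q
  have A: "compactin (Top M) (A q)" "A q \<subseteq> dom q" if "q \<in> set \<Lambda>" for q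
  proof -
    have "closedin (Top M) {x \<in> carrier_of M. weight q x \<in> {c..}}"
      by (rule closedin_continuous_map_preimage[OF comp(3)[OF that]]) simp
    then show "compactin (Top M) (A q)" using K by (simp add: A_def closedin_compact_space)
    show "A q \<subseteq> dom q" using comp(4)[OF that] c by (auto simp: A_def)
  qed
  have Acov: "carrier_of M \<subseteq> (\<Union>q\<in>set \<Lambda>. A q)" using big by (auto simp: A_def)

  \<comment> \<open>On the compact set \<open>A q\<close> division by the weight costs at most the factor \<open>1 / c\<close>.\<close>
  have "\<forall>q\<in>set \<Lambda>. \<exists>D\<ge>0. \<forall>u\<in>?X. negligible (chart q ` {x \<in> A q. \<not> fiber_norm g (u x) \<le> D * enn2real (?W u)})"
  proof
    fix q assume q: "q \<in> set \<Lambda>"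
    obtain B where B: "B \<ge> 0" "\<And>x v. x \<in> A q \<Longrightarrow> v \<in> fibre E x \<Longrightarrow> fiber_norm g v \<le> B * (\<Sum>l\<in>UNIV. \<bar>triv q v $ l\<bar>)"
      using fiber_norm_bound[OF M E g comp(2)[OF q] A[OF q]] by blast
    obtain C where C: "C \<ge> 0" "\<forall>u. section_over E (carrier_of M) u \<and> ?W u < \<infinity> \<longrightarrow>
      (\<exists>F :: real ^ 'n \<Rightarrow> real ^ 'r. continuous_on (chart q ` dom q) F \<and>
        negligible (chart q ` {x \<in> dom q. F (chart q x) \<noteq> weight q x *\<^sub>R triv q (u x)}) \<and>
        (\<forall>x\<in>A q. \<forall>l. \<bar>F (chart q x) $ l\<bar> \<le> C * enn2real (?W u)))"
      using local_representative_regular[OF \<Lambda> mem[OF q] p sp A[OF q]] by (elim exE conjE) (rule that)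
    let ?D = "B * (real CARD('r) * (C / c))"
    show "\<exists>D\<ge>0. \<forall>u\<in>?X. negligible (chart q ` {x \<in> A q. \<not> fiber_norm g (u x) \<le> D * enn2real (?W u)})"
    proof (intro exI[of _ ?D] conjI ballI)
      show "?D \<ge> 0" using B(1) C(1) c by simp
      fix u assume u: "u \<in> ?X"
      obtain F :: "real ^ 'n \<Rightarrow> real ^ 'r" where F: "negligible (chart q ` {x \<in> dom q. F (chart q x) \<noteq> weight q x *\<^sub>R triv q (u x)})"
        "\<And>x l. x \<in> A q \<Longrightarrow> \<bar>F (chart q x) $ l\<bar> \<le> C * enn2real (?W u)"
        using C(2) sec[OF u] fin[OF u] by blast
      have "fiber_norm g (u x) \<le> ?D * enn2real (?W u)"
        if x: "x \<in> A q" and eq: "F (chart q x) = weight q x *\<^sub>R triv q (u x)" for x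
      proof -
        have w: "weight q x \<ge> c" and ux: "u x \<in> fibre E x" using x sec[OF u] by (auto simp: A_def section_over_def)
        have "\<bar>triv q (u x) $ l\<bar> \<le> C / c * enn2real (?W u)" for l
        proof -
          have "c * \<bar>triv q (u x) $ l\<bar> \<le> \<bar>weight q x\<bar> * \<bar>triv q (u x) $ l\<bar>"
            using w c by (intro mult_right_mono) auto
          also have "\<dots> \<le> C * enn2real (?W u)" using F(2)[OF x, of l] eq by (simp add: abs_mult)
          finally show ?thesis using c by (simp add: field_simps)
        qed
        then have "(\<Sum>l\<in>UNIV. \<bar>triv q (u x) $ l\<bar>) \<le> real CARD('r) * (C / c * enn2real (?W u))"
          using sum_bounded_above[of UNIV "\<lambda>l. \<bar>triv q (u x) $ l\<bar>" "C / c * enn2real (?W u)"] by simp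
        then have "B * (\<Sum>l\<in>UNIV. \<bar>triv q (u x) $ l\<bar>) \<le> B * (real CARD('r) * (C / c * enn2real (?W u)))"
          by (rule mult_left_mono[OF _ B(1)])
        then show ?thesis using B(2)[OF x ux] by (simp add: mult_ac)
      qed
      then show "negligible (chart q ` {x \<in> A q. \<not> fiber_norm g (u x) \<le> ?D * enn2real (?W u)})"
        using A(2)[OF q] by (intro negligible_subset[OF F(1)] image_mono) blast
    qed
  qed
  from bchoice[OF this] obtain D where "\<forall>q\<in>set \<Lambda>. D q \<ge> 0 \<and>
      (\<forall>u\<in>?X. negligible (chart q ` {x \<in> A q. \<not> fiber_norm g (u x) \<le> D q * enn2real (?W u)}))"
    by (elim exE) (rule that)
  then have D: "\<And>q. q \<in> set \<Lambda> \<Longrightarrow> D q \<ge> 0"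
    "\<And>q u. q \<in> set \<Lambda> \<Longrightarrow> u \<in> ?X \<Longrightarrow> negligible (chart q ` {x \<in> A q. \<not> fiber_norm g (u x) \<le> D q * enn2real (?W u)})"
    by simp_all
  define D' where "D' = (\<Sum>q\<in>set \<Lambda>. D q)"
  have Linf: "Linf_norm M g u \<le> ennreal D' * ?W u" if u: "u \<in> ?X" for u
  proof -
    have "ae_on M (\<lambda>x. ennreal (fiber_norm g (u x)) \<le> ennreal (D' * enn2real (?W u)))"
    proof (rule ae_on_coverI[OF M finite_set[of \<Lambda>] comp(1) A(2) Acov])
      fix q assume q: "q \<in> set \<Lambda>"
      have "D q \<le> D'" unfolding D'_def using D(1) q by (intro member_le_sum) auto
      then have "D q * enn2real (?W u) \<le> D' * enn2real (?W u)" by (rule mult_right_mono) simp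
      then show "negligible (chart q ` {x \<in> A q. \<not> ennreal (fiber_norm g (u x)) \<le> ennreal (D' * enn2real (?W u))})"
        by (intro negligible_subset[OF D(2)[OF q u]] image_mono) (auto intro!: ennreal_leI)
    qed
    then have "Linf_norm M g u \<le> ennreal (D' * enn2real (?W u))" unfolding Linf_norm_def by (intro Inf_lower) simp
    also have "\<dots> = ennreal D' * ?W u"
      using fin[OF u] D(1) by (simp add: ennreal_mult' D'_def sum_nonneg ennreal_enn2real)
    finally show ?thesis .
  qed
  have incl: "u \<in> Linf_sections M E g" if u: "u \<in> ?X" for u
    using Linf[OF u] fin[OF u] meas[OF u] by (auto simp: Linf_sections_def ennreal_mult_less_top intro: le_less_trans)

  have cont: "\<exists>v. continuous_section M E v \<and> ae_on M (\<lambda>x. u x = v x)" if u: "u \<in> ?X" for u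
  proof -
    define V where "V q = {x \<in> carrier_of M. weight q x \<noteq> 0}" for q
    have Vsub: "V q \<subseteq> dom q" if "q \<in> set \<Lambda>" for q using comp(4)[OF that] by (simp add: V_def)
    have Vopen: "openin (Top M) (V q)" if "q \<in> set \<Lambda>" for q
      using openin_continuous_map_preimage[OF comp(3)[OF that], of "- {0}"] by (simp add: V_def open_Compl)
    have Vcov: "carrier_of M \<subseteq> (\<Union>q\<in>set \<Lambda>. V q)" using big c by (force simp: V_def)
    have "\<forall>q\<in>set \<Lambda>. \<exists>v. continuous_map (subtopology (Top M) (V q)) (Top (total E)) v \<and> (\<forall>x\<in>V q. v x \<in> fibre E x) \<and>
      negligible (chart q ` {x \<in> V q. u x \<noteq> v x})"
      unfolding V_def by (intro ballI local_continuous_version[OF \<Lambda> mem p sp sec[OF u] fin[OF u]])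
    from bchoice[OF this] obtain v where "\<forall>q\<in>set \<Lambda>. continuous_map (subtopology (Top M) (V q)) (Top (total E)) (v q) \<and>
        (\<forall>x\<in>V q. v q x \<in> fibre E x) \<and> negligible (chart q ` {x \<in> V q. u x \<noteq> v q x})"
      by (elim exE) (rule that)
    then have v: "\<And>q. q \<in> set \<Lambda> \<Longrightarrow> continuous_map (subtopology (Top M) (V q)) (Top (total E)) (v q)"
      "\<And>q x. q \<in> set \<Lambda> \<Longrightarrow> x \<in> V q \<Longrightarrow> v q x \<in> fibre E x"
      "\<And>q. q \<in> set \<Lambda> \<Longrightarrow> negligible (chart q ` {x \<in> V q. u x \<noteq> v q x})" by simp_all
    \<comment> \<open>Both equal \<open>u\<close> almost everywhere, and the set where two continuous maps into a Hausdorff space differ is open.\<close>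
    have agree: "v i x = v j x" if ij: "i \<in> set \<Lambda>" "j \<in> set \<Lambda>" and x: "x \<in> carrier_of M \<inter> V i \<inter> V j" for i j x
    proof (rule ccontr)
      assume ne: "v i x \<noteq> v j x"
      note Ut = topological_chartD[OF smooth_chart_topological[OF comp(1)[OF ij(1)]]]
      let ?Y = "subtopology (Top M) (V i \<inter> V j)"
      have Vo: "openin (Top M) (V i \<inter> V j)" using Vopen ij by blast
      have tY: "topspace ?Y = V i \<inter> V j" using openin_subset[OF Vo] by auto
      have haus: "Hausdorff_space (Top (total E))" using E by (simp add: smooth_vector_bundle_def smooth_manifold_def)
      have "closedin ?Y {y \<in> topspace ?Y. v i y = v j y}"
        using v(1)[OF ij(1)] v(1)[OF ij(2)]
        by (intro closedin_continuous_maps_eq[OF haus]) (auto elim: continuous_map_from_subtopology_mono)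
      then have "openin ?Y (topspace ?Y - {y \<in> topspace ?Y. v i y = v j y})" by blast
      then have "openin (Top M) (topspace ?Y - {y \<in> topspace ?Y. v i y = v j y})"
        using Vo by (simp add: openin_open_subtopology)
      moreover define G where "G = {y \<in> V i \<inter> V j. v i y \<noteq> v j y}"
      moreover have "topspace ?Y - {y \<in> topspace ?Y. v i y = v j y} = G" unfolding tY G_def by auto
      ultimately have "openin (Top M) G" by simp
      then have "open (chart i ` G)" by (rule Ut(7)) (use Vsub[OF ij(1)] in \<open>auto simp: G_def\<close>)
      moreover have "negligible (chart i ` G)"
      proof -
        have "negligible (chart i ` {y \<in> V i \<inter> V j. u y \<noteq> v j y})"
          by (rule chart_negligible_transfer[OF M comp(1)[OF ij(2)] comp(1)[OF ij(1)]])
            (use Vsub[OF ij(1)] Vsub[OF ij(2)] in \<open>auto intro: negligible_subset[OF v(3)[OF ij(2)]]\<close>)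
        then have "negligible (chart i ` {y \<in> V i. u y \<noteq> v i y} \<union> chart i ` {y \<in> V i \<inter> V j. u y \<noteq> v j y})"
          using v(3)[OF ij(1)] by (rule negligible_Un[rotated])
        then show ?thesis by (rule negligible_subset) (auto simp: G_def)
      qed
      moreover have "chart i x \<in> chart i ` G" using x ne by (auto simp: G_def)
      ultimately show False using open_not_negligible by blast
    qed
    obtain w where w: "continuous_map (Top M) (Top (total E)) w"
      "\<And>x q. q \<in> set \<Lambda> \<Longrightarrow> x \<in> carrier_of M \<inter> V q \<Longrightarrow> w x = v q x"
      by (rule pasting_lemma_exists[OF Vcov Vopen v(1) agree]) (assumption | simp | blast)+
    have "section_over E (carrier_of M) w"
      unfolding section_over_def
    proof
      fix x assume x: "x \<in> carrier_of M"
      then obtain q where "q \<in> set \<Lambda>" "x \<in> V q" using Vcov by blast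
      then show "w x \<in> fibre E x" using v(2) w(2)[of q x] x by simp
    qed
    then have "continuous_section M E w" using w(1) by (simp add: continuous_section_def)
    moreover have "ae_on M (\<lambda>x. u x = w x)"
    proof (rule ae_on_coverI[OF M finite_set[of \<Lambda>] comp(1) Vsub Vcov])
      fix q assume q: "q \<in> set \<Lambda>"
      show "negligible (chart q ` {x \<in> V q. u x \<noteq> w x})"
        using w(2)[OF q] by (intro negligible_subset[OF v(3)[OF q]] image_mono) (auto simp: V_def)
    qed
    ultimately show ?thesis by blast
  qed
  show ?thesis
    unfolding continuously_included_def using incl Linf cont by blast
qed

end
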